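(* Edge Unique Label Cover, parameterized by $k$, is $W[1]$-hard, even in the restricted case when $\phi_v=\Sigma$ for all $v\in V(G)$ and $\psi_{uv,u},\psi_{uv,v}$ are permutations for all $uv\in E(G)$.
   Context: Edge Unique Label Cover: given an undirected graph $G$, a finite alphabet $\Sigma$ of size $s$, an integer $k$, for each vertex $v$ a set $\phi_v\subseteq\Sigma$, and for each edge $e=uv$ partial permutations $\psi_{e,u},\psi_{e,v}$ of $\Sigma$ with $\psi_{e,u}=\psi_{e,v}^{-1}$ (a partial permutation is a relation $\psi\subseteq\Sigma\times\Sigma$ in which every element appears at most once as a first coordinate and at most once as a second coordinate), decide whether there exist $F\subseteq E(G)$ with $|F|\le k$ and $\Psi:V(G)\to\Sigma$ such that $\Psi(v)\in\phi_v$ for all $v$ and $(\Psi(u),\Psi(v))\in\psi_{uv,u}$ for all $uv\in E(G)\setminus F$. The parameter is $k$ only. *)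

theory Defs
  imports Main
begin

section \<open>Machine model\<close>

text \<open>
  Algorithms are programs of Jones' WHILE language over binary trees. Every operation is charged
  the full size of the tree it produces (no sharing), so the amount of data in the store is
  bounded by the initial amount plus the running time, and this cost measure is polynomially
  related to Turing machine time.
\<close>

datatype tree = Leaf | Node tree tree

fun tsize :: "tree \<Rightarrow> nat" where
  "tsize Leaf = 1"
| "tsize (Node a b) = 1 + tsize a + tsize b"

fun tleft :: "tree \<Rightarrow> tree" where
  "tleft Leaf = Leaf"
| "tleft (Node a b) = a"

fun tright :: "tree \<Rightarrow> tree" where
  "tright Leaf = Leaf"
| "tright (Node a b) = b"

datatype expr =
    Var nat
  | LeafE
  | NodeE expr expr
  | LeftE expr
  | RightE expr
  | EqE expr expr

datatype com =
    Skip
  | Assign nat expr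
  | Seq com com
  | If expr com com
  | While expr com

type_synonym store = "nat \<Rightarrow> tree"

text \<open>\<open>Leaf\<close> represents false; \<open>Node Leaf Leaf\<close> represents true.\<close>

fun eval :: "expr \<Rightarrow> store \<Rightarrow> tree" where
  "eval (Var x) s = s x"
| "eval LeafE s = Leaf"
| "eval (NodeE a b) s = Node (eval a s) (eval b s)"
| "eval (LeftE a) s = tleft (eval a s)"
| "eval (RightE a) s = tright (eval a s)"
| "eval (EqE a b) s = (if eval a s = eval b s then Node Leaf Leaf else Leaf)"

fun ecost :: "expr \<Rightarrow> store \<Rightarrow> nat" where
  "ecost (Var x) s = tsize (s x)"
| "ecost LeafE s = 1"
| "ecost (NodeE a b) s = ecost a s + ecost b s + tsize (eval (NodeE a b) s)"
| "ecost (LeftE a) s = ecost a s + tsize (eval (LeftE a) s)"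
| "ecost (RightE a) s = ecost a s + tsize (eval (RightE a) s)"
| "ecost (EqE a b) s = ecost a s + ecost b s + tsize (eval (EqE a b) s)"

text \<open>\<open>exec p s t s'\<close>: from store \<open>s\<close>, program \<open>p\<close> halts at cost exactly \<open>t\<close> in store \<open>s'\<close>.\<close>

inductive exec :: "com \<Rightarrow> store \<Rightarrow> nat \<Rightarrow> store \<Rightarrow> bool" where
  exec_Skip: "exec Skip s 1 s"
| exec_Assign: "exec (Assign x e) s (1 + ecost e s) (s(x := eval e s))"
| exec_Seq: "exec p s t s' \<Longrightarrow> exec q s' t' s'' \<Longrightarrow> exec (Seq p q) s (1 + t + t') s''"
| exec_IfTrue:
    "eval e s \<noteq> Leaf \<Longrightarrow> exec p s t s' \<Longrightarrow> exec (If e p q) s (1 + ecost e s + t) s'"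
| exec_IfFalse:
    "eval e s = Leaf \<Longrightarrow> exec q s t s' \<Longrightarrow> exec (If e p q) s (1 + ecost e s + t) s'"
| exec_WhileFalse:
    "eval e s = Leaf \<Longrightarrow> exec (While e p) s (1 + ecost e s) s"
| exec_WhileTrue:
    "eval e s \<noteq> Leaf \<Longrightarrow> exec p s t s' \<Longrightarrow> exec (While e p) s' t' s'' \<Longrightarrow>
     exec (While e p) s (1 + ecost e s + t + t') s''"

text \<open>Input and output are passed in variable 0; all other variables are initially \<open>Leaf\<close>.\<close>

definition computes :: "com \<Rightarrow> tree \<Rightarrow> nat \<Rightarrow> tree \<Rightarrow> bool" where
  "computes p x t y \<longleftrightarrow> (\<exists>s. exec p ((\<lambda>_. Leaf)(0 := x)) t s \<and> s 0 = y)"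

fun enc_list :: "tree list \<Rightarrow> tree" where
  "enc_list [] = Leaf"
| "enc_list (x # xs) = Node x (enc_list xs)"

text \<open>Numbers are encoded in unary.\<close>

definition enc_nat :: "nat \<Rightarrow> tree" where
  "enc_nat n = enc_list (replicate n Leaf)"

definition computable :: "(nat \<Rightarrow> nat) \<Rightarrow> bool" where
  "computable f \<longleftrightarrow> (\<exists>p. \<forall>n. \<exists>t. computes p (enc_nat n) t (enc_nat (f n)))"

section \<open>Parameterized problems and the W-hierarchy\<close>

text \<open>
  A parameterized problem is a set of pairs of an input and a parameter; trees take the place of
  strings.
\<close>

type_synonym problem = "(tree \<times> nat) set"

definition fpt_reducible :: "problem \<Rightarrow> problem \<Rightarrow> bool" where
  "fpt_reducible A B \<longleftrightarrow>
    (\<exists>p f g c. computable f \<and> computable g \<and>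
      (\<forall>x k. \<exists>x' k' t.
        computes p (Node x (enc_nat k)) t (Node x' (enc_nat k')) \<and>
        t \<le> f k * tsize x ^ c \<and>
        k' \<le> g k \<and>
        ((x, k) \<in> A \<longleftrightarrow> (x', k') \<in> B)))"

datatype gate = NotG nat | AndG "nat list" | OrG "nat list"

fun fanin :: "gate \<Rightarrow> nat list" where
  "fanin (NotG j) = [j]"
| "fanin (AndG js) = js"
| "fanin (OrG js) = js"

text \<open>
  A circuit \<open>(n, gs)\<close> is a directed acyclic graph given in topological order: nodes \<open>0..<n\<close> are the
  input nodes, node \<open>n + i\<close> is the gate \<open>gs ! i\<close> (whose in-neighbours are listed by \<open>fanin\<close>), and
  the last node is the output node.
\<close>

type_synonym circuit = "nat \<times> gate list"

definition wf_circuit :: "circuit \<Rightarrow> bool" where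
  "wf_circuit C \<longleftrightarrow> (case C of (n, gs) \<Rightarrow>
     0 < n + length gs \<and>
     (\<forall>i<length gs. fanin (gs ! i) \<noteq> [] \<and> (\<forall>j\<in>set (fanin (gs ! i)). j < n + i)))"

text \<open>
  Labels the nodes one after the other, starting from the labels \<open>xs\<close> of the input nodes; a gate's
  label is obtained by \<open>h\<close> from the labels of its in-neighbours. The result is the output label.
\<close>

definition output_label :: "(gate \<Rightarrow> 'a list \<Rightarrow> 'a) \<Rightarrow> 'a list \<Rightarrow> gate list \<Rightarrow> 'a" where
  "output_label h xs gs =
     last (foldl (\<lambda>vs g. vs @ [h g (map (\<lambda>j. vs ! j) (fanin g))]) xs gs)"

fun gate_value :: "gate \<Rightarrow> bool list \<Rightarrow> bool" where
  "gate_value (NotG j) bs = (\<not> hd bs)"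
| "gate_value (AndG js) bs = (\<forall>b\<in>set bs. b)"
| "gate_value (OrG js) bs = (\<exists>b\<in>set bs. b)"

definition circuit_value :: "circuit \<Rightarrow> bool list \<Rightarrow> bool" where
  "circuit_value C xs = output_label gate_value xs (snd C)"

text \<open>Depth: the maximum number of gates on a path from an input node to the output node.\<close>

definition circuit_depth :: "circuit \<Rightarrow> nat" where
  "circuit_depth C =
     output_label (\<lambda>g ds. Suc (Max (set ds))) (replicate (fst C) 0) (snd C)"

text \<open>
  Weft: the maximum number of large gates, i.e. gates of fan-in greater than 2, on such a path.
\<close>

definition circuit_weft :: "circuit \<Rightarrow> nat" where
  "circuit_weft C =
     output_label (\<lambda>g ws. (if length (fanin g) > 2 then 1 else 0) + Max (set ws))
       (replicate (fst C) 0) (snd C)"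

fun enc_gate :: "gate \<Rightarrow> tree" where
  "enc_gate (NotG j) = Node (enc_nat 0) (enc_nat j)"
| "enc_gate (AndG js) = Node (enc_nat 1) (enc_list (map enc_nat js))"
| "enc_gate (OrG js) = Node (enc_nat 2) (enc_list (map enc_nat js))"

fun enc_circuit :: "circuit \<Rightarrow> tree" where
  "enc_circuit (n, gs) = Node (enc_nat n) (enc_list (map enc_gate gs))"

text \<open>
  Weighted Circuit Satisfiability for circuits of weft at most \<open>w\<close> and depth at most \<open>d\<close>: is there
  a satisfying assignment with exactly \<open>k\<close> true inputs?
\<close>

definition wcs :: "nat \<Rightarrow> nat \<Rightarrow> problem" where
  "wcs w d = {(enc_circuit C, k) | C k.
     wf_circuit C \<and> circuit_weft C \<le> w \<and> circuit_depth C \<le> d \<and>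
     (\<exists>xs. length xs = fst C \<and> count_list xs True = k \<and> circuit_value C xs)}"

definition W_class :: "nat \<Rightarrow> problem set" where
  "W_class w = {A. \<exists>d. fpt_reducible A (wcs w d)}"

definition W_hard :: "nat \<Rightarrow> problem \<Rightarrow> bool" where
  "W_hard w B \<longleftrightarrow> (\<forall>A\<in>W_class w. fpt_reducible A B)"

section \<open>Edge Unique Label Cover\<close>

text \<open>Edges are two-element vertex sets; \<open>psi I e u\<close> is the relation of edge \<open>e\<close> at endpoint \<open>u\<close>.\<close>

record ('v, 'a) eulc =
  vertices :: "'v set"
  edges :: "'v set set"
  alphabet :: "'a set"
  phi :: "'v \<Rightarrow> 'a set"
  psi :: "'v set \<Rightarrow> 'v \<Rightarrow> ('a \<times> 'a) set"

definition partial_permutation :: "'a set \<Rightarrow> ('a \<times> 'a) set \<Rightarrow> bool" where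
  "partial_permutation S r \<longleftrightarrow> r \<subseteq> S \<times> S \<and> single_valued r \<and> single_valued (r\<inverse>)"

definition is_permutation :: "'a set \<Rightarrow> ('a \<times> 'a) set \<Rightarrow> bool" where
  "is_permutation S r \<longleftrightarrow> (\<exists>f. bij_betw f S S \<and> r = {(a, f a) | a. a \<in> S})"

definition eulc_instance :: "('v, 'a) eulc \<Rightarrow> bool" where
  "eulc_instance I \<longleftrightarrow>
     finite (vertices I) \<and>
     edges I \<subseteq> {{u, v} | u v. u \<in> vertices I \<and> v \<in> vertices I \<and> u \<noteq> v} \<and>
     finite (alphabet I) \<and>
     (\<forall>v\<in>vertices I. phi I v \<subseteq> alphabet I) \<and>
     (\<forall>u v. {u, v} \<in> edges I \<longrightarrow>
        partial_permutation (alphabet I) (psi I {u, v} u) \<and>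
        psi I {u, v} u = (psi I {u, v} v)\<inverse>)"

definition eulc_solvable :: "('v, 'a) eulc \<Rightarrow> nat \<Rightarrow> bool" where
  "eulc_solvable I k \<longleftrightarrow>
     (\<exists>F \<Psi>. F \<subseteq> edges I \<and> card F \<le> k \<and>
        (\<forall>v\<in>vertices I. \<Psi> v \<in> alphabet I \<and> \<Psi> v \<in> phi I v) \<and>
        (\<forall>u v. {u, v} \<in> edges I - F \<longrightarrow> (\<Psi> u, \<Psi> v) \<in> psi I {u, v} u))"

definition eulc_restricted :: "('v, 'a) eulc \<Rightarrow> bool" where
  "eulc_restricted I \<longleftrightarrow>
     (\<forall>v\<in>vertices I. phi I v = alphabet I) \<and>
     (\<forall>u v. {u, v} \<in> edges I \<longrightarrow>
        is_permutation (alphabet I) (psi I {u, v} u) \<and>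
        is_permutation (alphabet I) (psi I {u, v} v))"

text \<open>
  An input consists of the list of vertices \<open>v\<close>, each with a list of the elements of \<open>phi I v\<close>;
  the list of symbols; and the list of edges \<open>uv\<close>, each with a list of the pairs in
  \<open>psi I {u, v} u\<close> (which determines \<open>psi I {u, v} v\<close>, its converse). Vertices and symbols are
  named by arbitrary trees, written out in full at each occurrence.
\<close>

definition enc_vertex :: "tree \<times> tree list \<Rightarrow> tree" where
  "enc_vertex = (\<lambda>(v, ls). Node v (enc_list ls))"

definition enc_edge :: "tree \<times> tree \<times> (tree \<times> tree) list \<Rightarrow> tree" where
  "enc_edge = (\<lambda>(u, v, ps). Node u (Node v (enc_list (map (\<lambda>(a, b). Node a b) ps))))"

definition encodes :: "tree \<Rightarrow> (tree, tree) eulc \<Rightarrow> bool" where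
  "encodes x I \<longleftrightarrow>
     (\<exists>vs ss es.
        x = Node (enc_list (map enc_vertex vs))
              (Node (enc_list ss) (enc_list (map enc_edge es))) \<and>
        vertices I = fst ` set vs \<and>
        (\<forall>(v, ls)\<in>set vs. phi I v = set ls) \<and>
        alphabet I = set ss \<and>
        edges I = (\<lambda>(u, v, ps). {u, v}) ` set es \<and>
        (\<forall>(u, v, ps)\<in>set es. psi I {u, v} u = set ps))"

definition edge_unique_label_cover :: problem where
  "edge_unique_label_cover =
     {(x, k). \<exists>I. encodes x I \<and> eulc_instance I \<and> eulc_solvable I k}"

definition restricted_edge_unique_label_cover :: problem where
  "restricted_edge_unique_label_cover =
     {(x, k). \<exists>I. encodes x I \<and> eulc_instance I \<and> eulc_restricted I \<and> eulc_solvable I k}"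

end

theory Submission
  imports Defs
begin

text \<open>
  A satisfying assignment of weight \<open>k\<close> is described by the positions \<open>y 1 < \<dots> < y k\<close> of its true
  inputs; between two consecutive positions all inputs are false. In a circuit of weft 1 and depth
  \<open>d\<close> the output depends, through small gates only, on at most \<open>q = 2 ^ d\<close> inputs and large
  gates, and each in-neighbour of such a large gate depends on at most \<open>q\<close> inputs. If in addition
  one guesses, for each of these large gates, an in-neighbour that determines its value (or that there is
  none), then the circuit is satisfied if and only if no refutation is found by looking at all guesses and
  at any \<open>2 * q\<close> of the positions. This is a constraint satisfaction problem with \<open>k + O(q)\<close>
  variables, polynomially large domains and constraints of bounded arity.

  In Edge Unique Label Cover, a path of identity edges whose ends are forced to carry labels of
  different kinds must be cut, and the position of the cut can be tied to the labels at both ends by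
  unary constraints on the inner vertices. Two such paths enforce the equality of a coordinate of one label
  with a coordinate of the other one, at the cost of two edges. Unary constraints are available
  because labels may be doubled by a bit, which a permutation flips on the forbidden labels.
\<close>

text \<open>The parameter of the constructed instance counts cut edges only, so alphabet and graph
  may be polynomially large: a path is as long as the domain, yet costs one cut. What must be
  bounded in \<open>k\<close> and \<open>d\<close> alone is the number of constraints and their
  arity. A large gate reads unboundedly many nodes, so no constraint of bounded arity can compute
  its value. A guessed witness turns the value into a universal statement, each instance of which
  concerns one in-neighbour and hence at most \<open>q\<close> inputs. The positions
  \<open>y i\<close> and \<open>y (i + 1)\<close> around an input settle it, which is the origin of
  \<open>2 * q\<close>. Every choice of \<open>2 * q\<close> among the \<open>k + 2\<close>
  positions (with a frame at each end) becomes a constraint of arity \<open>4 * q\<close>. Since it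
  sees only part of the assignment, it may reject only what is visibly wrong; hence the four node
  labels: false, true, unknown and refuted. The depth \<open>d\<close> is fixed with the problem
  being reduced, so \<open>q\<close> is a constant and all these tuples can be listed in polynomial
  time.\<close>

section \<open>Encodable types\<close>

text \<open>Every type used by the reduction gets an injective tree encoding, so that running time
  can be proved for ordinary functional terms, by structural rules, instead of for programs.\<close>

class enc =
  fixes enc :: "'a \<Rightarrow> tree"
  assumes enc_inj: "enc x = enc y \<Longrightarrow> x = y"

lemma enc_eq_iff [simp]: "enc x = enc y \<longleftrightarrow> x = y"
  using enc_inj by blast

lemma enc_list_inj: "enc_list xs = enc_list ys \<Longrightarrow> xs = ys"
proof (induction xs arbitrary: ys)
  case Nil
  then show ?case by (cases ys) auto
next
  case (Cons x xs)
  then show ?case by (cases ys) auto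
qed

lemma enc_nat_0: "enc_nat 0 = Leaf"
  and enc_nat_Suc: "enc_nat (Suc n) = Node Leaf (enc_nat n)"
  by (simp_all add: enc_nat_def)

lemma enc_nat_inj: "enc_nat m = enc_nat n \<Longrightarrow> m = n"
  unfolding enc_nat_def by (metis enc_list_inj length_replicate)

instantiation tree :: enc
begin
definition enc_tree: "enc (t::tree) = t"
instance by standard (simp add: enc_tree)
end

instantiation nat :: enc
begin
definition enc_nat_eq: "enc (n::nat) = enc_nat n"
instance by standard (simp add: enc_nat_inj enc_nat_eq)
end

instantiation unit :: enc
begin
definition enc_unit: "enc (u::unit) = Leaf"
instance by standard simp
end

instantiation bool :: enc
begin
definition enc_bool: "enc b = (if b then Node Leaf Leaf else Leaf)"
instance by standard (simp add: enc_bool split: if_splits)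
end

instantiation prod :: (enc, enc) enc
begin
definition enc_prod: "enc z = Node (enc (fst z)) (enc (snd z))"
instance by standard (simp add: enc_prod prod_eq_iff)
end

instantiation list :: (enc) enc
begin
definition enc_list_eq: "enc xs = enc_list (map enc xs)"
instance
proof
  fix x y :: "'a list"
  assume "enc x = enc y"
  then have "map enc x = map enc y" unfolding enc_list_eq by (rule enc_list_inj)
  then show "x = y" by (metis enc_inj inj_onI map_injective)
qed
end

lemma enc_gate_inj: "enc_gate g = enc_gate h \<Longrightarrow> g = h"
proof -
  have "map enc_nat js = map enc_nat js' \<Longrightarrow> js = js'" for js js'
    by (metis enc_nat_inj inj_onI map_injective)
  then show "enc_gate g = enc_gate h \<Longrightarrow> g = h"
    by (cases g; cases h) (auto dest: enc_nat_inj enc_list_inj)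
qed

instantiation gate :: enc
begin
definition enc_gate_eq: "enc g = enc_gate g"
instance by standard (simp add: enc_gate_eq enc_gate_inj)
end

lemma enc_0 [simp]: "enc (0::nat) = Leaf"
  and enc_Suc [simp]: "enc (Suc n) = Node Leaf (enc n)"
  and enc_unit_simp [simp]: "enc () = Leaf"
  and enc_True [simp]: "enc True = Node Leaf Leaf"
  and enc_False [simp]: "enc False = Leaf"
  and enc_Pair [simp]: "enc (a, b) = Node (enc a) (enc b)"
  and enc_Nil [simp]: "enc [] = Leaf"
  and enc_Cons [simp]: "enc (x # xs) = Node (enc x) (enc xs)"
  by (simp_all add: enc_nat_eq enc_nat_0 enc_nat_Suc enc_unit enc_bool enc_prod enc_list_eq)

abbreviation sz :: "'a::enc \<Rightarrow> nat" where "sz x \<equiv> tsize (enc x)"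

lemma tsize_ge1 [simp]: "Suc 0 \<le> tsize t"
  by (cases t) auto

lemma sz_nat: "sz (n::nat) = 2 * n + 1"
  by (induction n) simp_all

lemma sz_append: "sz (xs @ ys) + 1 = sz xs + sz (ys::'a::enc list)"
  by (induction xs) auto

lemma sz_rev_aux: "sz (xs @ [x]) = sz xs + sz (x::'a::enc) + 1"
  by (induction xs) auto

lemma sz_rev: "sz (rev xs) = sz (xs::'a::enc list)"
  by (induction xs) (simp_all add: sz_rev_aux)

lemma length_le_sz: "length xs \<le> sz (xs::'a::enc list)"
  by (induction xs) (auto simp: le_SucI trans_le_add2)

lemma sz_mem: "x \<in> set xs \<Longrightarrow> sz x \<le> sz (xs::'a::enc list)"
  by (induction xs) auto

lemma sz_list_bound: "(\<And>x. x \<in> set xs \<Longrightarrow> sz x \<le> B) \<Longrightarrow> sz (xs::'a::enc list) \<le> 1 + length xs * (1 + B)"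
proof (induction xs)
  case (Cons x xs)
  from Cons.prems[of x] Cons.IH[OF Cons.prems] show ?case by simp
qed simp

section \<open>Polynomial bounds\<close>

text \<open>The base \<open>sz x + 1\<close> is at least 2, so constants, sums and products are all
  absorbed by a larger exponent, and a single number \<open>c\<close> describes a polynomial
  bound.\<close>

definition pb :: "('a::enc \<Rightarrow> nat) \<Rightarrow> bool" where
  "pb h \<longleftrightarrow> (\<exists>c. \<forall>x. h x \<le> (sz x + 1) ^ c)"

lemma pbI: "(\<And>x. h x \<le> (sz x + 1) ^ c) \<Longrightarrow> pb h"
  unfolding pb_def by blast

lemma pb_mono: "pb h \<Longrightarrow> (\<And>x. h' x \<le> h x) \<Longrightarrow> pb h'"
  unfolding pb_def by (meson le_trans)

lemma base_ge2: "2 \<le> sz x + 1"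
  using tsize_ge1[of "enc x"] by linarith

lemma pb_const: "pb (\<lambda>_. n)"
proof (rule pbI[where c = n])
  fix x :: 'a
  have "n \<le> 2 ^ n" by (simp add: less_imp_le)
  also have "\<dots> \<le> (sz x + 1) ^ n" by (rule power_mono[OF base_ge2]) simp
  finally show "n \<le> (sz x + 1) ^ n" .
qed

lemma pb_sz: "pb (\<lambda>x. sz x)"
  by (rule pbI[where c = 1]) simp

lemma pb_mult: assumes "pb f" "pb g" shows "pb (\<lambda>x. f x * g x)"
proof -
  obtain a b where "\<And>x. f x \<le> (sz x + 1) ^ a" "\<And>x. g x \<le> (sz x + 1) ^ b"
    using assms unfolding pb_def by blast
  then show ?thesis
    by (intro pbI[where c = "a + b"]) (simp add: power_add mult_le_mono)
qed

lemma pb_add: assumes "pb f" "pb g" shows "pb (\<lambda>x. f x + g x)"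
proof (rule pb_mono)
  show "pb (\<lambda>x. (f x + 1) * (g x + 1))"
  proof -
    have *: "pb (\<lambda>x. h x + 1)" if h: "pb h" for h :: "'a \<Rightarrow> nat"
    proof -
      obtain a where a: "\<And>x. h x \<le> (sz x + 1) ^ a" using h unfolding pb_def by blast
      show ?thesis
      proof (rule pbI[where c = "a + 1"])
        fix x :: 'a
        have "h x + 1 \<le> (sz x + 1) ^ a + (sz x + 1) ^ a"
          using a[of x] one_le_power[of "sz x + 1" a] by (intro add_mono) simp_all
        also have "\<dots> \<le> (sz x + 1) ^ (a + 1)"
          using base_ge2[of x] by (simp add: mult_2[symmetric] mult_le_mono)
        finally show "h x + 1 \<le> (sz x + 1) ^ (a + 1)" .
      qed
    qed
    show ?thesis by (intro pb_mult * assms)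
  qed
qed simp

lemma pb_power: "pb f \<Longrightarrow> pb (\<lambda>x. f x ^ n)"
  by (induction n) (auto intro: pb_const pb_mult)

lemma pb_comp:
  assumes "pb h" and f: "pb (\<lambda>x. sz (f x))" shows "pb (\<lambda>x. h (f x))"
proof -
  from assms(1) obtain a where "\<forall>x. h x \<le> (sz x + 1) ^ a" unfolding pb_def by (rule exE)
  then show ?thesis
    by (intro pb_mono[OF pb_power[OF pb_add[OF f pb_const[of 1]], of a]]) simp
qed

section \<open>The WHILE language\<close>

text \<open>\<open>vbe\<close> and \<open>vbc\<close> are strict upper bounds on the indices of all variables that occur.\<close>

fun vbe :: "expr \<Rightarrow> nat" where
  "vbe (Var x) = Suc x"
| "vbe LeafE = 0"
| "vbe (NodeE a b) = max (vbe a) (vbe b)"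
| "vbe (LeftE a) = vbe a"
| "vbe (RightE a) = vbe a"
| "vbe (EqE a b) = max (vbe a) (vbe b)"

fun vbc :: "com \<Rightarrow> nat" where
  "vbc Skip = 0"
| "vbc (Assign x e) = max (Suc x) (vbe e)"
| "vbc (Seq p q) = max (vbc p) (vbc q)"
| "vbc (If e p q) = max (vbe e) (max (vbc p) (vbc q))"
| "vbc (While e p) = max (vbe e) (vbc p)"

lemma exec_frame: "exec p s t s' \<Longrightarrow> vbc p \<le> v \<Longrightarrow> s' v = s v"
  by (induction rule: exec.induct) auto

lemma tsize_eval_le_ecost: "tsize (eval e s) \<le> ecost e s"
  by (cases e) auto

text \<open>Every assignment pays at least the size of the tree it stores. Running time thus bounds
  output size, which is what composing two time bounds needs.\<close>

lemma exec_size: "exec p s t s' \<Longrightarrow> tsize (s' v) \<le> tsize (s v) + t"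
proof (induction rule: exec.induct)
  case (exec_Assign x e s)
  then show ?case using tsize_eval_le_ecost[of e s] by auto
qed auto

lemma eval_agree: "(\<And>v. v < N \<Longrightarrow> s v = s2 v) \<Longrightarrow> vbe e \<le> N \<Longrightarrow> eval e s = eval e s2"
  by (induction e) auto

lemma ecost_agree: "(\<And>v. v < N \<Longrightarrow> s v = s2 v) \<Longrightarrow> vbe e \<le> N \<Longrightarrow> ecost e s = ecost e s2"
proof (induction e)
  case (NodeE a b)
  then show ?case using eval_agree[of N s s2 "NodeE a b"] by simp
next
  case (LeftE a)
  then show ?case using eval_agree[of N s s2 "LeftE a"] by simp
next
  case (RightE a)
  then show ?case using eval_agree[of N s s2 "RightE a"] by simp
next
  case (EqE a b)
  then show ?case using eval_agree[of N s s2 "EqE a b"] by simp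
qed auto

text \<open>Programs whose behaviour is known only on a clean store can hereby be run after some
  data has been parked in a register beyond their variables.\<close>

lemma exec_agree:
  "exec p s t s' \<Longrightarrow> (\<And>v. v < N \<Longrightarrow> s v = s2 v) \<Longrightarrow> vbc p \<le> N \<Longrightarrow>
   \<exists>s2'. exec p s2 t s2' \<and> (\<forall>v<N. s' v = s2' v)"
proof (induction arbitrary: s2 rule: exec.induct)
  case (exec_Skip s)
  then show ?case using exec.exec_Skip by blast
next
  case (exec_Assign x e s)
  then have "eval e s = eval e s2" "ecost e s = ecost e s2"
    using eval_agree[of N s s2 e] ecost_agree[of N s s2 e] by auto
  then show ?case using exec.exec_Assign[of x e s2] exec_Assign(1) by auto
next
  case (exec_Seq p s t s' q t' s'')
  then obtain s2' where 1: "exec p s2 t s2'" "\<And>v. v < N \<Longrightarrow> s' v = s2' v" by force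
  with exec_Seq obtain s2'' where "exec q s2' t' s2''" "\<forall>v<N. s'' v = s2'' v" by force
  with exec.exec_Seq[OF 1(1), of q t' s2''] show ?case by blast
next
  case (exec_IfTrue e s p t s' q)
  have "eval e s = eval e s2" "ecost e s = ecost e s2"
    using eval_agree[of N s s2 e] ecost_agree[of N s s2 e] exec_IfTrue.prems by auto
  moreover obtain s2' where "exec p s2 t s2'" "\<forall>v<N. s' v = s2' v"
    using exec_IfTrue.IH[of s2] exec_IfTrue.prems by auto
  ultimately show ?case using exec.exec_IfTrue[of e s2 p t s2' q] exec_IfTrue.hyps by auto
next
  case (exec_IfFalse e s q t s' p)
  have "eval e s = eval e s2" "ecost e s = ecost e s2"
    using eval_agree[of N s s2 e] ecost_agree[of N s s2 e] exec_IfFalse.prems by auto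
  moreover obtain s2' where "exec q s2 t s2'" "\<forall>v<N. s' v = s2' v"
    using exec_IfFalse.IH[of s2] exec_IfFalse.prems by auto
  ultimately show ?case using exec.exec_IfFalse[of e s2 q t s2' p] exec_IfFalse.hyps by auto
next
  case (exec_WhileFalse e s p)
  have "eval e s = eval e s2" "ecost e s = ecost e s2"
    using eval_agree[of N s s2 e] ecost_agree[of N s s2 e] exec_WhileFalse.prems by auto
  then show ?case using exec.exec_WhileFalse[of e s2 p] exec_WhileFalse by auto
next
  case (exec_WhileTrue e s p t s' t' s'')
  have e: "eval e s = eval e s2" "ecost e s = ecost e s2"
    using eval_agree[of N s s2 e] ecost_agree[of N s s2 e] exec_WhileTrue.prems by auto
  obtain s2' where 1: "exec p s2 t s2'" "\<And>v. v < N \<Longrightarrow> s' v = s2' v"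
    using exec_WhileTrue.IH(1)[of s2] exec_WhileTrue.prems by auto
  obtain s2'' where "exec (While e p) s2' t' s2''" "\<forall>v<N. s'' v = s2'' v"
    using exec_WhileTrue.IH(2)[of s2'] exec_WhileTrue.prems 1 by auto
  with 1 e show ?case using exec.exec_WhileTrue[of e s2 p t s2' t' s2''] exec_WhileTrue.hyps by auto
qed

lemma ecost_linear:
  "vbe e \<le> 1 \<Longrightarrow> \<exists>C. \<forall>s. ecost e s \<le> C * (tsize (s 0) + 1)"
proof (induction e)
  case (Var x)
  then show ?case by (intro exI[of _ 1]) auto
next
  case LeafE
  then show ?case by (intro exI[of _ 1]) auto
next
  case (NodeE a b)
  then obtain C D where CD: "\<And>s. ecost a s \<le> C * (tsize (s 0) + 1)" "\<And>s. ecost b s \<le> D * (tsize (s 0) + 1)"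
    by auto
  have "ecost (NodeE a b) s \<le> (C + D + C + D + 1) * (tsize (s 0) + 1)" for s
    using CD[of s] tsize_eval_le_ecost[of a s] tsize_eval_le_ecost[of b s]
    by (simp add: algebra_simps)
  then show ?case by blast
next
  case (LeftE a)
  then obtain C where C: "\<And>s. ecost a s \<le> C * (tsize (s 0) + 1)" by auto
  have "tsize (tleft t) \<le> tsize t" for t by (cases t) auto
  then have "ecost (LeftE a) s \<le> (C + C) * (tsize (s 0) + 1)" for s
    using C[of s] le_trans[OF _ tsize_eval_le_ecost[of a s], of "tsize (tleft (eval a s))"]
    by (auto simp: algebra_simps)
  then show ?case by blast
next
  case (RightE a)
  then obtain C where C: "\<And>s. ecost a s \<le> C * (tsize (s 0) + 1)" by auto
  have "tsize (tright t) \<le> tsize t" for t by (cases t) auto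
  then have "ecost (RightE a) s \<le> (C + C) * (tsize (s 0) + 1)" for s
    using C[of s] le_trans[OF _ tsize_eval_le_ecost[of a s], of "tsize (tright (eval a s))"]
    by (auto simp: algebra_simps)
  then show ?case by blast
next
  case (EqE a b)
  then obtain C D where CD: "\<And>s. ecost a s \<le> C * (tsize (s 0) + 1)" "\<And>s. ecost b s \<le> D * (tsize (s 0) + 1)"
    by auto
  have "ecost (EqE a b) s \<le> (C + D + 3) * (tsize (s 0) + 1)" for s
    using CD[of s] by (simp add: algebra_simps)
  then show ?case by blast
qed

section \<open>Polynomial-time functions\<close>

text \<open>
  The program may start from a store with arbitrary contents in the variables other than 0, so
  that such programs can be composed without clearing variables.
\<close>

definition realizes :: "com \<Rightarrow> ('a::enc \<Rightarrow> nat) \<Rightarrow> ('a \<Rightarrow> 'b::enc) \<Rightarrow> bool" where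
  "realizes p h f \<longleftrightarrow>
     (\<forall>x s. s 0 = enc x \<longrightarrow> (\<exists>t s'. exec p s t s' \<and> s' 0 = enc (f x) \<and> t \<le> h x))"

definition pt :: "('a::enc \<Rightarrow> 'b::enc) \<Rightarrow> bool" where
  "pt f \<longleftrightarrow> (\<exists>p h. pb h \<and> realizes p h f)"

lemma realizesD:
  assumes "realizes p h f" "s 0 = enc x"
  obtains t s' where "exec p s t s'" "s' 0 = enc (f x)" "t \<le> h x"
  using assms unfolding realizes_def by blast

lemma ptI: "pb h \<Longrightarrow> (\<And>x s. s 0 = enc x \<Longrightarrow> \<exists>t s'. exec p s t s' \<and> s' 0 = enc (f x) \<and> t \<le> h x) \<Longrightarrow> pt f"
  unfolding pt_def realizes_def by blast

lemma pt_size: assumes "pt f" shows "pb (\<lambda>x. sz (f x))"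
proof -
  obtain p h where h: "pb h" "realizes p h f" using assms unfolding pt_def by blast
  show ?thesis
  proof (rule pb_mono[OF pb_add[OF pb_sz h(1)]])
    fix x
    obtain t s' where "exec p (\<lambda>_. enc x) t s'" "s' 0 = enc (f x)" "t \<le> h x"
      by (rule realizesD[OF h(2), of "\<lambda>_. enc x" x]) auto
    then show "sz (f x) \<le> sz x + h x" using exec_size[of p "\<lambda>_. enc x" t s' 0] by simp
  qed
qed

lemma pt_expr:
  assumes "vbe e \<le> 1" "\<And>x s. s 0 = enc x \<Longrightarrow> eval e s = enc (f x)"
  shows "pt f"
proof -
  obtain C where C: "\<And>s. ecost e s \<le> C * (tsize (s 0) + 1)" using ecost_linear[OF assms(1)] by blast
  show ?thesis
  proof (rule ptI)
    show "pb (\<lambda>x::'a. 1 + C * (sz x + 1))" by (intro pb_add pb_mult pb_const pb_sz)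
    fix x :: 'a and s :: store
    assume "s 0 = enc x"
    with assms(2) C[of s] exec_Assign[of 0 e s]
    show "\<exists>t s'. exec (Assign 0 e) s t s' \<and> s' 0 = enc (f x) \<and> t \<le> 1 + C * (sz x + 1)"
      by (metis add_left_mono fun_upd_same)
  qed
qed

text \<open>Functions that change the type but not the tree are computed by copying the input;
  several library functions below are of this kind.\<close>

lemma pt_cast: "(\<And>x. enc (f x) = enc x) \<Longrightarrow> pt f"
  by (rule pt_expr[of "Var 0"]) auto

lemma pt_id: "pt (\<lambda>x. x)"
  by (rule pt_cast) simp

lemma pt_const: "pt (\<lambda>_. c)"
proof -
  have "\<exists>e. vbe e = 0 \<and> (\<forall>s. eval e s = t)" for t
  proof (induction t)
    case Leaf
    show ?case by (intro exI[of _ LeafE]) simp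
  next
    case (Node a b)
    then obtain e f where "vbe e = 0" "vbe f = 0" "\<forall>s. eval e s = a" "\<forall>s. eval f s = b" by blast
    then show ?case by (intro exI[of _ "NodeE e f"]) simp
  qed
  then obtain e where "vbe e = 0" "\<And>s. eval e s = enc c" by blast
  then show ?thesis by (intro pt_expr[of e]) auto
qed

lemma pt_comp:
  fixes f :: "'a::enc \<Rightarrow> 'b::enc" and g :: "'b \<Rightarrow> 'c::enc"
  assumes "pt g" "pt f" shows "pt (\<lambda>x. g (f x))"
proof -
  obtain p h q k where p: "pb h" "realizes p h f" and q: "pb k" "realizes q k g"
    using assms unfolding pt_def by blast
  show ?thesis
  proof (rule ptI)
    show "pb (\<lambda>x. 1 + h x + k (f x))"
      by (intro pb_add pb_const p pb_comp[OF q(1)] pt_size assms)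
    fix x :: 'a and s :: store assume "s 0 = enc x"
    then obtain t s' where 1: "exec p s t s'" "s' 0 = enc (f x)" "t \<le> h x" by (rule realizesD[OF p(2)])
    then obtain t' s'' where 2: "exec q s' t' s''" "s'' 0 = enc (g (f x))" "t' \<le> k (f x)"
      by (meson realizesD[OF q(2)])
    from 1 2 exec_Seq[OF 1(1) 2(1)]
    show "\<exists>t s'. exec (Seq p q) s t s' \<and> s' 0 = enc (g (f x)) \<and> t \<le> 1 + h x + k (f x)"
      by (metis add_le_mono add_left_mono)
  qed
qed

lemma pt_recast: "pt f \<Longrightarrow> (\<And>x. enc (g x) = enc (f x)) \<Longrightarrow> pt g"
  unfolding pt_def realizes_def by simp

text \<open>The input must survive \<open>p\<close>, and the first result must survive
  \<open>q\<close>: both are parked in registers above every variable of the two programs.\<close>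

lemma pt_Pair:
  fixes f :: "'a::enc \<Rightarrow> 'b::enc" and g :: "'a \<Rightarrow> 'c::enc"
  assumes "pt f" "pt g" shows "pt (\<lambda>x. (f x, g x))"
proof -
  obtain p h q k where p: "pb h" "realizes p h f" and q: "pb k" "realizes q k g"
    using assms unfolding pt_def by blast
  define N where "N = Suc (max (vbc p) (vbc q))"
  have N: "vbc p \<le> N" "vbc q \<le> N" "N \<noteq> 0" "vbc q \<le> Suc N" "vbc p \<le> Suc N" unfolding N_def by auto
  let ?P = "Seq (Assign N (Var 0)) (Seq p (Seq (Assign (Suc N) (Var 0)) (Seq (Assign 0 (Var N))
     (Seq q (Assign 0 (NodeE (Var (Suc N)) (Var 0)))))))"
  show ?thesis
  proof (rule ptI)
    show "pb (\<lambda>x. 20 + sz x + h x + k x + sz x + sz (f x) + sz (f x) + sz (f x) + sz (g x) + sz (g x) )"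
      by (intro pb_add pb_const p q pb_sz pt_size assms)
    fix x :: 'a and s :: store assume s: "s 0 = enc x"
    let ?s1 = "s(N := enc x)"
    have 0: "exec (Assign N (Var 0)) s (1 + sz x) ?s1" using exec_Assign[of N "Var 0" s] s by simp
    obtain t2 s2 where 2: "exec p ?s1 t2 s2" "s2 0 = enc (f x)" "t2 \<le> h x"
      using realizesD[OF p(2), of ?s1 x] s N by auto
    have frame2: "s2 N = enc x" using exec_frame[OF 2(1) N(1)] by simp
    let ?s3 = "s2(Suc N := enc (f x))"
    have 3: "exec (Assign (Suc N) (Var 0)) s2 (1 + sz (f x)) ?s3"
      using exec_Assign[of "Suc N" "Var 0" s2] 2 by simp
    let ?s4 = "?s3(0 := enc x)"
    have 4: "exec (Assign 0 (Var N)) ?s3 (1 + sz x) ?s4"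
      using exec_Assign[of 0 "Var N" ?s3] frame2 by simp
    obtain t5 s5 where 5: "exec q ?s4 t5 s5" "s5 0 = enc (g x)" "t5 \<le> k x"
      using realizesD[OF q(2), of ?s4 x] by auto
    have frame5: "s5 (Suc N) = enc (f x)" using exec_frame[OF 5(1) N(4)] by simp
    note E = exec_Seq[OF 0 exec_Seq[OF 2(1) exec_Seq[OF 3 exec_Seq[OF 4 exec_Seq[OF 5(1)
      exec_Assign[of 0 "NodeE (Var (Suc N)) (Var 0)"]]]]]]
    show "\<exists>t s'. exec ?P s t s' \<and> s' 0 = enc (f x, g x) \<and>
        t \<le> 20 + sz x + h x + k x + sz x + sz (f x) + sz (f x) + sz (f x) + sz (g x) + sz (g x)"
      by (rule exI, rule exI, rule conjI[OF E]) (use 5 frame5 2 in simp)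
  qed
qed

text \<open>\<open>D\<close> is a change of type that keeps the tree but makes sense only where
  \<open>P\<close> holds, such as reading a nonempty list as a pair or a tested tree as a circuit.
  The program for \<open>f\<close> is therefore run on the unchanged tree.\<close>

lemma pt_if_cast:
  fixes P :: "'a::enc \<Rightarrow> bool" and f :: "'b::enc \<Rightarrow> 'c::enc"
  assumes "pt P" "pt f" "pt g" "\<And>x. P x \<Longrightarrow> enc (D x) = enc x"
  shows "pt (\<lambda>x. if P x then f (D x) else g x)"
proof -
  obtain p h where p: "pb h" "realizes p h (\<lambda>x. (x, P x))"
    using pt_Pair[OF pt_id assms(1)] unfolding pt_def by blast
  obtain q k q' k' where q: "pb k" "realizes q k f" and q': "pb k'" "realizes q' k' g"
    using assms unfolding pt_def by blast
  \<comment> \<open>The bound \<open>k\<close> is evaluated at \<open>D x\<close>, which is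
    controlled only through its size; the explicit power carries it over to
    \<open>x\<close>.\<close>
  obtain c where c: "\<And>x. k x \<le> (sz x + 1) ^ c" using q(1) unfolding pb_def by blast
  let ?P = "Seq p (If (RightE (Var 0)) (Seq (Assign 0 (LeftE (Var 0))) q) (Seq (Assign 0 (LeftE (Var 0))) q'))"
  show ?thesis
  proof (rule ptI)
    show "pb (\<lambda>x. 20 + h x + sz x + sz x + sz x + (sz x + 1) ^ c + k' x)"
      by (intro pb_add pb_const p q pb_sz q' pb_power)
    fix x :: 'a and s :: store assume s: "s 0 = enc x"
    obtain t1 s1 where 1: "exec p s t1 s1" "s1 0 = Node (enc x) (enc (P x))" "t1 \<le> h x"
      by (rule realizesD[OF p(2), of s x]) (use s in auto)
    let ?s2 = "s1(0 := enc x)"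
    have 2: "exec (Assign 0 (LeftE (Var 0))) s1 (1 + ecost (LeftE (Var 0)) s1) ?s2"
      using exec_Assign[of 0 "LeftE (Var 0)" s1] 1 by simp
    show "\<exists>t s'. exec ?P s t s' \<and> s' 0 = enc (if P x then f (D x) else g x) \<and>
        t \<le> 20 + h x + sz x + sz x + sz x + (sz x + 1) ^ c + k' x"
    proof (cases "P x")
      case True
      obtain t3 s3 where 3: "exec q ?s2 t3 s3" "s3 0 = enc (f (D x))" "t3 \<le> k (D x)"
        using realizesD[OF q(2), of ?s2 "D x"] True assms(4) by auto
      have 4: "t3 \<le> (sz x + 1) ^ c" using 3(3) c[of "D x"] assms(4)[OF True] by simp
      have "eval (RightE (Var 0)) s1 \<noteq> Leaf" using 1 True by simp
      note E = exec_Seq[OF 1(1) exec_IfTrue[OF this exec_Seq[OF 2 3(1)]]]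
      show ?thesis
        by (rule exI, rule exI, rule conjI[OF E]) (use 1 3 4 True in simp)
    next
      case False
      obtain t3 s3 where 3: "exec q' ?s2 t3 s3" "s3 0 = enc (g x)" "t3 \<le> k' x"
        using realizesD[OF q'(2), of ?s2 x] by auto
      have "eval (RightE (Var 0)) s1 = Leaf" using 1 False by simp
      note E = exec_Seq[OF 1(1) exec_IfFalse[OF this exec_Seq[OF 2 3(1)]]]
      show ?thesis
        by (rule exI, rule exI, rule conjI[OF E]) (use 1 3 False in simp)
    qed
  qed
qed

lemma pt_if: "pt P \<Longrightarrow> pt f \<Longrightarrow> pt g \<Longrightarrow> pt (\<lambda>x. if P x then f x else g x)"
  by (rule pt_if_cast[where D = "\<lambda>x. x"]) auto


section \<open>Loops\<close>

text \<open>Register \<open>N\<close> holds the rest of the list, \<open>N + 1\<close> the accumulator, \<open>N + 2\<close> the context.\<close>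

definition loop_body :: "nat \<Rightarrow> com \<Rightarrow> com" where
  "loop_body N q =
     Seq (Assign 0 (NodeE (Var (N + 2)) (NodeE (LeftE (Var N)) (Var (N + 1)))))
    (Seq q
    (Seq (Assign (N + 1) (Var 0)) (Assign N (RightE (Var N)))))"

lemma loop_body_exec:
  assumes q: "realizes q k (\<lambda>z. b (fst z) (fst (snd z)) (snd (snd z)))"
    and N: "vbc q \<le> N" "N \<noteq> 0"
    and s: "s N = enc (e # es)" "s (N + 1) = enc a" "s (N + 2) = enc x"
  shows "\<exists>t s'. exec (loop_body N q) s t s' \<and> s' N = enc es \<and> s' (N + 1) = enc (b x e a) \<and>
    s' (N + 2) = enc x \<and>
    t \<le> 20 + 2 * sz x + 3 * sz e + 3 * sz a + 3 * sz (e # es) + sz (b x e a) + k (x, e, a)"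
proof -
  let ?e1 = "NodeE (Var (N + 2)) (NodeE (LeftE (Var N)) (Var (N + 1)))"
  let ?s1 = "s(0 := enc (x, e, a))"
  have 1: "exec (Assign 0 ?e1) s (1 + ecost ?e1 s) ?s1"
    using exec_Assign[of 0 ?e1 s] s by simp
  obtain t2 s2 where 2: "exec q ?s1 t2 s2" "s2 0 = enc (b x e a)" "t2 \<le> k (x, e, a)"
    by (rule realizesD[OF q, of ?s1 "(x, e, a)"]) auto
  have f2: "s2 N = enc (e # es)" "s2 (N + 1) = enc a" "s2 (N + 2) = enc x"
    using exec_frame[OF 2(1), of N] exec_frame[OF 2(1), of "N + 1"] exec_frame[OF 2(1), of "N + 2"] N s
    by auto
  let ?s3 = "s2(N + 1 := enc (b x e a))"
  have 3: "exec (Assign (N + 1) (Var 0)) s2 (1 + sz (b x e a)) ?s3"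
    using exec_Assign[of "N + 1" "Var 0" s2] 2 by simp
  note E = exec_Seq[OF 1 exec_Seq[OF 2(1) exec_Seq[OF 3 exec_Assign[of N "RightE (Var N)"]]]]
  show ?thesis unfolding loop_body_def
    by (rule exI, rule exI, rule conjI[OF E]) (use 2 f2 s N in simp)
qed

text \<open>\<open>B\<close> is required only for accumulators reached on prefixes of the list,
  since arbitrary accumulators have unbounded size.\<close>

lemma loop_exec:
  assumes q: "realizes q k (\<lambda>z. b (fst z) (fst (snd z)) (snd (snd z)))"
    and N: "vbc q \<le> N" "N \<noteq> 0"
    and bound: "\<And>ys e zs. es = ys @ e # zs \<Longrightarrow>
      20 + 2 * sz x + 3 * sz e + 3 * sz (fold (b x) ys a) + 3 * sz (e # zs) +
      sz (b x e (fold (b x) ys a)) + k (x, e, fold (b x) ys a) \<le> B"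
    and s: "s N = enc es" "s (N + 1) = enc a" "s (N + 2) = enc x"
  shows "\<exists>t s'. exec (While (Var N) (loop_body N q)) s t s' \<and>
    s' (N + 1) = enc (fold (b x) es a) \<and> t \<le> 2 + length es * (1 + sz es + B)"
  using bound s
proof (induction es arbitrary: a s)
  case Nil
  then have "eval (Var N) s = Leaf" by simp
  from exec_WhileFalse[OF this, of "loop_body N q"] Nil show ?case by force
next
  case (Cons e es)
  from loop_body_exec[OF q N Cons.prems(2-4)] obtain t s' where
    1: "exec (loop_body N q) s t s'" "s' N = enc es" "s' (N + 1) = enc (b x e a)" "s' (N + 2) = enc x"
    "t \<le> 20 + 2 * sz x + 3 * sz e + 3 * sz a + 3 * sz (e # es) + sz (b x e a) + k (x, e, a)" by blast
  have "t \<le> B" using Cons.prems(1)[of "[]" e es] 1(5) by simp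
  have "\<exists>t s''. exec (While (Var N) (loop_body N q)) s' t s'' \<and>
    s'' (N + 1) = enc (fold (b x) es (b x e a)) \<and> t \<le> 2 + length es * (1 + sz es + B)"
  proof (rule Cons.IH[OF _ 1(2-4)])
    fix ys f zs assume "es = ys @ f # zs"
    then show "20 + 2 * sz x + 3 * sz f + 3 * sz (fold (b x) ys (b x e a)) + 3 * sz (f # zs) +
      sz (b x f (fold (b x) ys (b x e a))) + k (x, f, fold (b x) ys (b x e a)) \<le> B"
      using Cons.prems(1)[of "e # ys" f zs] by simp
  qed
  then obtain t' s'' where 2: "exec (While (Var N) (loop_body N q)) s' t' s''"
    "s'' (N + 1) = enc (fold (b x) es (b x e a))" "t' \<le> 2 + length es * (1 + sz es + B)" by blast
  have ne: "eval (Var N) s \<noteq> Leaf" using Cons.prems by simp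
  have "length es * (1 + sz es + B) \<le> length es * (1 + sz (e # es) + B)"
    by (intro mult_le_mono) simp_all
  then have "1 + ecost (Var N) s + t + t' \<le> 2 + length (e # es) * (1 + sz (e # es) + B)"
    using 2(3) \<open>t \<le> B\<close> Cons.prems(2) by simp
  with exec_WhileTrue[OF ne 1(1) 2(1)] 2(2) show ?case by (metis fold_simps(2))
qed

text \<open>A polynomial-time step may double the accumulator in every round, so a polynomial bound
  \<open>h\<close> on all intermediate accumulators has to be supplied.\<close>

lemma pt_fold:
  fixes l :: "'a::enc \<Rightarrow> 'e::enc list" and a :: "'a \<Rightarrow> 'b::enc"
  assumes l: "pt l" and a: "pt a" and b: "pt (\<lambda>z. b (fst z) (fst (snd z)) (snd (snd z)))"
    and h: "pb h" "\<And>x ys zs. l x = ys @ zs \<Longrightarrow> sz (fold (b x) ys (a x)) \<le> h x"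
  shows "pt (\<lambda>x. fold (b x) (l x) (a x))"
proof -
  obtain p hp where p: "pb hp" "realizes p hp (\<lambda>x. (x, l x, a x))"
    using pt_Pair[OF pt_id pt_Pair[OF l a]] unfolding pt_def by blast
  obtain q k where q: "pb k" "realizes q k (\<lambda>z. b (fst z) (fst (snd z)) (snd (snd z)))"
    using b unfolding pt_def by blast
  obtain c where c: "\<And>x. k x \<le> (sz x + 1) ^ c" using q(1) unfolding pb_def by blast
  define N where "N = Suc (vbc q)"
  have N: "vbc q \<le> N" "N \<noteq> 0" by (auto simp: N_def)
  let ?W = "Seq (While (Var N) (loop_body N q)) (Assign 0 (Var (N + 1)))"
  let ?P = "Seq p (Seq (Assign N (LeftE (RightE (Var 0)))) (Seq (Assign (N + 1) (RightE (RightE (Var 0))))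
    (Seq (Assign (N + 2) (LeftE (Var 0))) ?W)))"
  let ?B = "\<lambda>x. 20 + 2 * sz x + 6 * sz (l x) + 4 * h x + (sz x + sz (l x) + h x + 3) ^ c"
  let ?T = "\<lambda>x. 30 + hp x + 9 * sz (x, l x, a x) + h x + 2 + length (l x) * (1 + sz (l x) + ?B x)"
  show ?thesis
  proof (rule ptI)
    show "pb ?T"
      by (intro pb_add pb_const p pb_mult pb_sz pb_power h pt_size[OF l] pt_size[OF pt_Pair[OF pt_id pt_Pair[OF l a]]]
        pb_mono[OF pt_size[OF l] length_le_sz])
    fix x :: 'a and s :: store assume s: "s 0 = enc x"
    obtain t1 s1 where 1: "exec p s t1 s1" "s1 0 = enc (x, l x, a x)" "t1 \<le> hp x"
      by (rule realizesD[OF p(2), of s x]) (use s in auto)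
    let ?s2 = "s1(N := enc (l x))"
    have 2: "exec (Assign N (LeftE (RightE (Var 0)))) s1 (1 + ecost (LeftE (RightE (Var 0))) s1) ?s2"
      using exec_Assign[of N "LeftE (RightE (Var 0))" s1] 1 by simp
    let ?s3 = "?s2(N + 1 := enc (a x))"
    have 3: "exec (Assign (N + 1) (RightE (RightE (Var 0)))) ?s2 (1 + ecost (RightE (RightE (Var 0))) ?s2) ?s3"
      using exec_Assign[of "N + 1" "RightE (RightE (Var 0))" ?s2] 1 N by simp
    let ?s4 = "?s3(N + 2 := enc x)"
    have 4: "exec (Assign (N + 2) (LeftE (Var 0))) ?s3 (1 + ecost (LeftE (Var 0)) ?s3) ?s4"
      using exec_Assign[of "N + 2" "LeftE (Var 0)" ?s3] 1 N by simp
    have "\<exists>t s'. exec (While (Var N) (loop_body N q)) ?s4 t s' \<and>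
      s' (N + 1) = enc (fold (b x) (l x) (a x)) \<and> t \<le> 2 + length (l x) * (1 + sz (l x) + ?B x)"
    proof (rule loop_exec[OF q(2) N])
      fix ys e zs assume eq: "l x = ys @ e # zs"
      let ?f = "fold (b x) ys (a x)"
      have f: "sz ?f \<le> h x" using h(2)[OF eq] .
      have f': "sz (b x e ?f) \<le> h x" using h(2)[of x "ys @ [e]" zs] eq by simp
      have e: "sz e \<le> sz (l x)" "sz (e # zs) \<le> sz (l x)"
        using sz_mem[of e "l x"] sz_append[of ys "e # zs"] eq tsize_ge1[of "enc ys"] by auto
      have "k (x, e, ?f) \<le> (sz (x, e, ?f) + 1) ^ c" by (rule c)
      also have "\<dots> \<le> (sz x + sz (l x) + h x + 3) ^ c"
        using f e by (intro power_mono) auto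
      finally show "20 + 2 * sz x + 3 * sz e + 3 * sz ?f + 3 * sz (e # zs) + sz (b x e ?f) + k (x, e, ?f) \<le> ?B x"
        using f f' e by linarith
    qed auto
    then obtain t5 s5 where 5: "exec (While (Var N) (loop_body N q)) ?s4 t5 s5"
      "s5 (N + 1) = enc (fold (b x) (l x) (a x))" "t5 \<le> 2 + length (l x) * (1 + sz (l x) + ?B x)" by blast
    note E = exec_Seq[OF 1(1) exec_Seq[OF 2 exec_Seq[OF 3 exec_Seq[OF 4
      exec_Seq[OF 5(1) exec_Assign[of 0 "Var (N + 1)"]]]]]]
    have fin: "sz (fold (b x) (l x) (a x)) \<le> h x" using h(2)[of x "l x" "[]"] by simp
    show "\<exists>t s'. exec ?P s t s' \<and> s' 0 = enc (fold (b x) (l x) (a x)) \<and> t \<le> ?T x"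
      by (rule exI, rule exI, rule conjI[OF E]) (use fin 1 5 N in simp)
  qed
qed

section \<open>Library functions in polynomial time\<close>

named_theorems pt_intros

declare pt_id [pt_intros] pt_const [pt_intros] pt_Pair [pt_intros] pt_if [pt_intros]

lemma pt_fst [pt_intros]: "pt f \<Longrightarrow> pt (\<lambda>x. fst (f x))"
  by (rule pt_comp[of fst], rule pt_expr[of "LeftE (Var 0)"]) (auto simp: enc_prod)

lemma pt_snd [pt_intros]: "pt f \<Longrightarrow> pt (\<lambda>x. snd (f x))"
  by (rule pt_comp[of snd], rule pt_expr[of "RightE (Var 0)"]) (auto simp: enc_prod)

lemma pt_Not [pt_intros]: "pt P \<Longrightarrow> pt (\<lambda>x. \<not> P x)"
  by (rule pt_recast[OF pt_if[of P "\<lambda>_. False" "\<lambda>_. True"]]) (auto intro: pt_intros)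

lemma pt_conj [pt_intros]: "pt P \<Longrightarrow> pt Q \<Longrightarrow> pt (\<lambda>x. P x \<and> Q x)"
  by (rule pt_recast[OF pt_if[of P Q "\<lambda>_. False"]]) (auto intro: pt_intros)

lemma pt_disj [pt_intros]: "pt P \<Longrightarrow> pt Q \<Longrightarrow> pt (\<lambda>x. P x \<or> Q x)"
  by (rule pt_recast[OF pt_if[of P "\<lambda>_. True" Q]]) (auto intro: pt_intros)

lemma pt_imp [pt_intros]: "pt P \<Longrightarrow> pt Q \<Longrightarrow> pt (\<lambda>x. P x \<longrightarrow> Q x)"
  by (rule pt_recast[OF pt_if[of P Q "\<lambda>_. True"]]) (auto intro: pt_intros)

lemma pt_comp2:
  assumes "pt (\<lambda>z. g (fst z) (snd z))" "pt a" "pt b"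
  shows "pt (\<lambda>x. g (a x) (b x))"
  using pt_comp[OF assms(1) pt_Pair[OF assms(2,3)]] by simp

lemma pt_eq [pt_intros]: "pt f \<Longrightarrow> pt g \<Longrightarrow> pt (\<lambda>x. f x = g x)"
  by (rule pt_comp2[of "(=)"], rule pt_expr[of "EqE (LeftE (Var 0)) (RightE (Var 0))"])
    (auto simp: enc_prod)

lemma pt_Suc [pt_intros]: "pt f \<Longrightarrow> pt (\<lambda>x. Suc (f x))"
  by (rule pt_comp[of Suc], rule pt_expr[of "NodeE LeafE (Var 0)"]) auto

lemma pt_Node [pt_intros]: "pt f \<Longrightarrow> pt g \<Longrightarrow> pt (\<lambda>x. Node (f x) (g x))"
  by (rule pt_comp2[of Node], rule pt_cast) (auto simp: enc_prod enc_tree)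

lemma pt_tleft [pt_intros]: "pt f \<Longrightarrow> pt (\<lambda>x. tleft (f x))"
  by (rule pt_comp[of tleft], rule pt_expr[of "LeftE (Var 0)"]) (auto simp: enc_tree)

lemma pt_tright [pt_intros]: "pt f \<Longrightarrow> pt (\<lambda>x. tright (f x))"
  by (rule pt_comp[of tright], rule pt_expr[of "RightE (Var 0)"]) (auto simp: enc_tree)

lemma pt_Cons [pt_intros]: "pt f \<Longrightarrow> pt g \<Longrightarrow> pt (\<lambda>x. f x # g x)"
  by (rule pt_comp2[of "(#)"], rule pt_cast) (auto simp: enc_prod)

lemma pt_tl [pt_intros]: "pt f \<Longrightarrow> pt (\<lambda>x. tl (f x))"
proof (rule pt_comp[of tl], rule pt_expr[of "RightE (Var 0)"])
  show "eval (RightE (Var 0)) s = enc (tl xs)" if "s 0 = enc xs" for xs :: "'b list" and s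
    using that by (cases xs) auto
qed auto

lemma pt_enc [pt_intros]: "pt f \<Longrightarrow> pt (\<lambda>x. enc (f x))"
  by (rule pt_comp[of enc], rule pt_cast) (auto simp: enc_tree)

definition hdd :: "'a \<Rightarrow> 'a list \<Rightarrow> 'a" where
  "hdd d xs = (if xs = [] then d else hd xs)"

lemma pt_hdd [pt_intros]: 
  fixes d :: "'a::enc \<Rightarrow> 'b::enc"
  assumes "pt d" "pt f" shows "pt (\<lambda>x. hdd (d x) (f x))"
proof (rule pt_comp2[of hdd])
  have "pt (\<lambda>z::'b \<times> 'b list. if snd z = [] then fst z else fst (hd (snd z), tl (snd z)))"
  proof -
    \<comment> \<open>The encoding of a nonempty list is that of the pair of its head and its tail,
      so the head can be read off as a first component.\<close>
    have "pt (\<lambda>z::'b \<times> 'b list. if snd z \<noteq> [] then fst (snd (fst z, (hd (snd z), tl (snd z)))) else fst z)"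
    proof (rule pt_if_cast[where f = "\<lambda>w. fst (snd w)"])
      show "enc (fst z, hd (snd z), tl (snd z)) = enc z" if "snd z \<noteq> []" for z :: "'b \<times> 'b list"
        using that by (cases z; cases "snd z") auto
    qed (intro pt_intros)+
    then show ?thesis by (rule pt_recast) simp
  qed
  then show "pt (\<lambda>z::'b \<times> 'b list. hdd (fst z) (snd z))" by (rule pt_recast) (simp add: hdd_def)
qed fact+

lemma sz_prefix: "sz ys \<le> sz (ys @ (zs::'a::enc list))"
  using sz_append[of ys zs] tsize_ge1[of "enc zs"] by linarith

lemma pt_rev [pt_intros]: assumes "pt l" shows "pt (\<lambda>x. rev (l x))"
proof -
  have "pt (\<lambda>x. fold (#) (l x) [])"
  proof (rule pt_fold[OF assms pt_const, where h = "\<lambda>x. sz (l x)"])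
    show "pb (\<lambda>x. sz (l x))" by (intro pt_size assms)
    show "sz (fold (#) ys []) \<le> sz (l x)" if "l x = ys @ zs" for x ys zs
      using that sz_prefix[of ys zs] by (simp add: fold_Cons_rev sz_rev)
  qed (intro pt_intros)+
  then show ?thesis by (simp add: fold_Cons_rev)
qed

lemma pt_append [pt_intros]: assumes "pt f" "pt g" shows "pt (\<lambda>x. f x @ g x)"
proof -
  have "pt (\<lambda>x. fold (#) (rev (f x)) (g x))"
  proof (rule pt_fold[OF pt_rev[OF assms(1)] assms(2), where h = "\<lambda>x. sz (f x) + sz (g x)"])
    show "pb (\<lambda>x. sz (f x) + sz (g x))" by (intro pb_add pt_size assms)
    show "sz (fold (#) ys (g x)) \<le> sz (f x) + sz (g x)" if "rev (f x) = ys @ zs" for x ys zs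
      using sz_prefix[of ys zs] sz_append[of "rev ys" "g x"]
      by (simp add: fold_Cons_rev sz_rev flip: that)
  qed (intro pt_intros)+
  then show ?thesis by (simp add: fold_Cons_rev)
qed

lemma pt_map [pt_intros]:
  fixes l :: "'a::enc \<Rightarrow> 'e::enc list" and g :: "'a \<Rightarrow> 'e \<Rightarrow> 'b::enc"
  assumes l: "pt l" and g: "pt (\<lambda>z. g (fst z) (snd z))"
  shows "pt (\<lambda>x. map (g x) (l x))"
proof -
  have rev: "fold (\<lambda>e acc. f e # acc) ys zs = rev (map f ys) @ zs" for f :: "'e \<Rightarrow> 'b" and ys zs
    by (induction ys arbitrary: zs) auto
  \<comment> \<open>The exponent is uniform in \<open>x\<close> and \<open>e\<close>, so all entries
    of the result obey a single bound.\<close>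
  from pt_size[OF g] obtain c where c: "\<And>z. sz (g (fst z) (snd z)) \<le> (sz z + 1) ^ c"
    unfolding pb_def by blast
  let ?h = "\<lambda>x. 1 + sz (l x) * (1 + (2 + sz x + sz (l x)) ^ c)"
  have "pt (\<lambda>x. fold (\<lambda>e acc. g x e # acc) (l x) [])"
  proof (rule pt_fold[OF l pt_const, where h = ?h])
    show "pb ?h" by (intro pb_add pb_mult pb_power pb_const pb_sz pt_size l)
    show "pt (\<lambda>z. g (fst z) (fst (snd z)) # snd (snd z))"
      by (rule pt_Cons, rule pt_comp2[OF g]) (intro pt_intros)+
    fix x ys zs assume eq: "l x = ys @ zs"
    have "sz (g x e) \<le> (2 + sz x + sz (l x)) ^ c" if "e \<in> set ys" for e
    proof -
      have "sz e \<le> sz (l x)" using that eq by (intro sz_mem) auto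
      then show ?thesis
        using le_trans[OF c[of "(x, e)"] power_mono[of "sz (x, e) + 1" "2 + sz x + sz (l x)" c]] by simp
    qed
    then have "sz (rev (map (g x) ys)) \<le> 1 + length ys * (1 + (2 + sz x + sz (l x)) ^ c)"
      using sz_list_bound[of "map (g x) ys" "(2 + sz x + sz (l x)) ^ c"] by (auto simp: sz_rev)
    moreover have "length ys \<le> sz (l x)" using eq length_le_sz[of "l x"] by simp
    then have "length ys * (1 + (2 + sz x + sz (l x)) ^ c) \<le> sz (l x) * (1 + (2 + sz x + sz (l x)) ^ c)"
      by (rule mult_le_mono1)
    ultimately show "sz (fold (\<lambda>e acc. g x e # acc) ys []) \<le> ?h x"
      by (simp only: rev append_Nil2)
  qed
  from pt_rev[OF this] show ?thesis by (simp add: rev)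
qed

lemma sz_bool: "sz (b::bool) \<le> 3"
  by (cases b) auto

lemma pt_Bex [pt_intros]:
  fixes l :: "'a::enc \<Rightarrow> 'e::enc list"
  assumes l: "pt l" and P: "pt (\<lambda>z. P (fst z) (snd z))"
  shows "pt (\<lambda>x. \<exists>e\<in>set (l x). P x e)"
proof -
  have eq: "fold (\<lambda>e b. b \<or> Q e) ys a \<longleftrightarrow> a \<or> (\<exists>e\<in>set ys. Q e)" for Q :: "'e \<Rightarrow> bool" and ys a
    by (induction ys arbitrary: a) auto
  have "pt (\<lambda>x. fold (\<lambda>e b. b \<or> P x e) (l x) False)"
  proof (rule pt_fold[OF l pt_const, where h = "\<lambda>_. 3"])
    show "pt (\<lambda>z. snd (snd z) \<or> P (fst z) (fst (snd z)))"
      by (rule pt_disj, rule pt_snd, rule pt_snd, rule pt_id, rule pt_comp2[OF P]) (intro pt_intros)+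
  qed (simp_all add: pb_const sz_bool)
  then show ?thesis by (simp add: eq)
qed

lemma pt_Ball [pt_intros]:
  assumes "pt l" and "pt (\<lambda>z. P (fst z) (snd z))"
  shows "pt (\<lambda>x. \<forall>e\<in>set (l x). P x e)"
  using pt_Not[OF pt_Bex[OF assms(1) pt_Not[OF assms(2)]]] by simp

lemma pt_mem [pt_intros]: "pt f \<Longrightarrow> pt l \<Longrightarrow> pt (\<lambda>x. f x \<in> set (l x))"
proof -
  assume f: "pt f" and l: "pt l"
  have "pt (\<lambda>x. \<exists>e\<in>set (l x). f x = e)"
    by (rule pt_Bex[OF l], rule pt_eq, rule pt_comp[OF f]) (intro pt_intros)+
  then show ?thesis by (rule pt_recast) auto
qed

lemma pt_concat [pt_intros]:
  fixes l :: "'a::enc \<Rightarrow> 'e::enc list list"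
  assumes l: "pt l" shows "pt (\<lambda>x. concat (l x))"
proof -
  have eq: "fold (\<lambda>ys acc. acc @ ys) xss zs = zs @ concat xss" for xss :: "'e list list" and zs
    by (induction xss arbitrary: zs) auto
  have sz: "sz (concat xss) \<le> sz xss" for xss :: "'e list list"
  proof (induction xss)
    case (Cons xs xss)
    then show ?case using sz_append[of xs "concat xss"] by simp
  qed simp
  have "pt (\<lambda>x. fold (\<lambda>ys acc. acc @ ys) (l x) [])"
  proof (rule pt_fold[OF l pt_const, where h = "\<lambda>x. sz (l x)"])
    show "pb (\<lambda>x. sz (l x))" by (intro pt_size l)
    show "sz (fold (\<lambda>ys acc. acc @ ys) ys []) \<le> sz (l x)" if "l x = ys @ zs" for x ys zs
      using that sz_prefix[of ys zs] le_trans[OF sz[of ys]] by (simp add: eq)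
  qed (intro pt_intros)+
  then show ?thesis by (simp add: eq)
qed

lemma pt_length [pt_intros]:
  fixes l :: "'a::enc \<Rightarrow> 'e::enc list"
  assumes l: "pt l" shows "pt (\<lambda>x. length (l x))"
proof -
  have eq: "fold (\<lambda>_. Suc) ys n = n + length ys" for ys :: "'e list" and n
    by (induction ys arbitrary: n) auto
  have "pt (\<lambda>x. fold (\<lambda>_. Suc) (l x) 0)"
  proof (rule pt_fold[OF l pt_const, where h = "\<lambda>x. 1 + 2 * sz (l x)"])
    show "pb (\<lambda>x. 1 + 2 * sz (l x))" by (intro pb_add pb_mult pb_const pt_size l)
    show "sz (fold (\<lambda>_. Suc) ys 0) \<le> 1 + 2 * sz (l x)" if "l x = ys @ zs" for x ys zs
      using that length_le_sz[of "l x"] by (simp add: eq sz_nat)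
  qed (intro pt_intros)+
  then show ?thesis by (simp add: eq)
qed

lemma pt_units: "pt f \<Longrightarrow> pt (\<lambda>x. replicate (f x) ())"
proof (rule pt_comp[of "\<lambda>n. replicate n ()"], rule pt_cast)
  show "enc (replicate n ()) = enc n" for n by (induction n) auto
qed

lemma prefix_units: "replicate n () = ys @ zs \<Longrightarrow> length ys \<le> n"
  by (metis length_append length_replicate le_add1)

text \<open>Iteration is a fold over a list of units, since numbers are encoded in unary.\<close>

lemma pt_funpow:
  fixes n :: "'a::enc \<Rightarrow> nat" and a :: "'a \<Rightarrow> 'b::enc" and b :: "'a \<Rightarrow> 'b \<Rightarrow> 'b"
  assumes n: "pt n" and a: "pt a" and b: "pt (\<lambda>z. b (fst z) (snd z))"
    and h: "pb h" "\<And>x i. i \<le> n x \<Longrightarrow> sz ((b x ^^ i) (a x)) \<le> h x"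
  shows "pt (\<lambda>x. (b x ^^ n x) (a x))"
proof -
  have eq: "fold (\<lambda>_::unit. f) ys c = (f ^^ length ys) c" for f :: "'b \<Rightarrow> 'b" and ys c
    by (induction ys arbitrary: c) (auto simp: funpow_swap1)
  have "pt (\<lambda>x. fold (\<lambda>_. b x) (replicate (n x) ()) (a x))"
  proof (rule pt_fold[OF pt_units[OF n] a _ h(1)])
    show "pt (\<lambda>z. b (fst z) (snd (snd z)))" by (rule pt_comp2[OF b]) (intro pt_intros)+
    show "sz (fold (\<lambda>_. b x) ys (a x)) \<le> h x" if "replicate (n x) () = ys @ zs" for x ys zs
      using that h(2)[of "length ys" x] prefix_units by (simp add: eq)
  qed
  then show ?thesis by (simp add: eq)
qed

lemma pt_pred: "pt f \<Longrightarrow> pt (\<lambda>x. f x - Suc 0)"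
proof (rule pt_comp[of "\<lambda>n. n - Suc 0"], rule pt_expr[of "RightE (Var 0)"])
  show "eval (RightE (Var 0)) s = enc (n - Suc 0)" if "s 0 = enc n" for n :: nat and s
    using that by (cases n) auto
qed auto

lemma pt_add [pt_intros]:
  fixes f g :: "'a::enc \<Rightarrow> nat"
  assumes "pt f" "pt g" shows "pt (\<lambda>x. f x + g x)"
proof -
  have "pt (\<lambda>x. (Suc ^^ g x) (f x))"
  proof (rule pt_funpow[OF assms(2,1), where h = "\<lambda>x. sz (f x) + sz (g x)"])
    show "pb (\<lambda>x. sz (f x) + sz (g x))" by (intro pb_add pt_size assms)
  qed ((intro pt_intros)+, simp add: sz_nat)
  then show ?thesis by (simp add: add.commute)
qed

lemma pt_diff [pt_intros]:
  fixes f g :: "'a::enc \<Rightarrow> nat"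
  assumes "pt f" "pt g" shows "pt (\<lambda>x. f x - g x)"
proof -
  have eq: "((\<lambda>n. n - Suc 0) ^^ i) m = m - i" for i m
    by (induction i) auto
  have "pt (\<lambda>x. ((\<lambda>n. n - Suc 0) ^^ g x) (f x))"
  proof (rule pt_funpow[OF assms(2,1), where h = "\<lambda>x. sz (f x)"])
    show "pt (\<lambda>z::'a \<times> nat. snd z - Suc 0)" by (intro pt_pred pt_intros)
    show "pb (\<lambda>x. sz (f x))" by (intro pt_size assms)
  qed (simp add: sz_nat eq)
  then show ?thesis by (simp add: eq)
qed

lemma pt_mult [pt_intros]:
  fixes f g :: "'a::enc \<Rightarrow> nat"
  assumes "pt f" "pt g" shows "pt (\<lambda>x. f x * g x)"
proof -
  have eq: "((\<lambda>n. n + k) ^^ i) 0 = i * k" for i k :: nat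
    by (induction i) auto
  have "pt (\<lambda>x. ((\<lambda>n. n + f x) ^^ g x) 0)"
  proof (rule pt_funpow[OF assms(2) pt_const, where h = "\<lambda>x. 1 + 2 * (sz (f x) * sz (g x))"])
    show "pt (\<lambda>z::'a \<times> nat. snd z + f (fst z))" by (intro pt_intros pt_comp[OF assms(1)])
    show "pb (\<lambda>x. 1 + 2 * (sz (f x) * sz (g x)))" by (intro pb_add pb_mult pb_const pt_size assms)
    show "sz (((\<lambda>n. n + f x) ^^ i) 0) \<le> 1 + 2 * (sz (f x) * sz (g x))" if "i \<le> g x" for x i
    proof -
      have "i * f x \<le> sz (g x) * sz (f x)" using that by (intro mult_le_mono) (auto simp: sz_nat)
      then show ?thesis by (simp add: eq sz_nat mult.commute)
    qed
  qed
  then show ?thesis by (simp add: eq mult.commute)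
qed

lemma pt_power [pt_intros]:
  fixes f :: "'a::enc \<Rightarrow> nat"
  shows "pt f \<Longrightarrow> pt (\<lambda>x. f x ^ c)"
  by (induction c) (auto intro: pt_intros)

lemma pt_less [pt_intros]:
  fixes f g :: "'a::enc \<Rightarrow> nat"
  assumes "pt f" "pt g" shows "pt (\<lambda>x. f x < g x)"
proof -
  have "pt (\<lambda>x. g x - f x \<noteq> 0)" by (intro pt_intros assms)
  then show ?thesis by (rule pt_recast) auto
qed

lemma pt_le [pt_intros]:
  fixes f g :: "'a::enc \<Rightarrow> nat"
  assumes "pt f" "pt g" shows "pt (\<lambda>x. f x \<le> g x)"
proof -
  have "pt (\<lambda>x. f x - g x = 0)" by (intro pt_intros assms)
  then show ?thesis by (rule pt_recast) auto
qed

definition nthd :: "'a \<Rightarrow> 'a list \<Rightarrow> nat \<Rightarrow> 'a" where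
  "nthd d xs i = hdd d (drop i xs)"

lemma nthd_nth: "i < length xs \<Longrightarrow> nthd d xs i = xs ! i"
  by (simp add: nthd_def hdd_def hd_drop_conv_nth)

lemma pt_nthd [pt_intros]:
  fixes l :: "'a::enc \<Rightarrow> 'e::enc list"
  assumes "pt d" "pt l" "pt n" shows "pt (\<lambda>x. nthd (d x) (l x) (n x))"
proof -
  have eq: "(tl ^^ i) xs = drop i xs" for i and xs :: "'e list"
    by (induction i arbitrary: xs) (auto simp: drop_Suc tl_drop)
  have "pt (\<lambda>x. (tl ^^ n x) (l x))"
  proof (rule pt_funpow[OF assms(3,2), where h = "\<lambda>x. sz (l x)"])
    show "sz ((tl ^^ i) (l x)) \<le> sz (l x)" for i x
      using sz_append[of "take i (l x)" "drop i (l x)"] tsize_ge1[of "enc (take i (l x))"]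
      by (simp add: eq del: tsize_ge1)
  qed (intro pt_intros pt_size assms)+
  then have "pt (\<lambda>x. hdd (d x) (drop (n x) (l x)))" by (intro pt_hdd assms) (simp add: eq)
  then show ?thesis by (simp add: nthd_def)
qed

lemma pt_upt [pt_intros]:
  fixes f g :: "'a::enc \<Rightarrow> nat"
  assumes "pt f" "pt g" shows "pt (\<lambda>x. [f x..<g x])"
proof -
  have eq: "((\<lambda>z. (Suc (fst z), fst z # snd z)) ^^ i) (0, []) = (i, rev [0..<i])" for i
    by (induction i) auto
  have "pt (\<lambda>n. ((\<lambda>z. (Suc (fst z), fst z # snd z)) ^^ n) (0, []))"
  proof (rule pt_funpow[OF pt_id pt_const, where h = "\<lambda>n. 3 + 2 * n + n * (2 + 2 * n)"])
    show "pb (\<lambda>n. 3 + 2 * n + n * (2 + 2 * n))"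
      by (intro pb_add pb_mult pb_const pb_mono[OF pb_sz]) (simp_all add: sz_nat)
    show "sz (((\<lambda>z. (Suc (fst z), fst z # snd z)) ^^ i) (0, [])) \<le> 3 + 2 * n + n * (2 + 2 * n)"
      if "i \<le> n" for i n
    proof -
      have "sz [0..<i] \<le> 1 + length [0..<i] * (1 + (1 + 2 * n))"
        using that by (intro sz_list_bound) (auto simp: sz_nat)
      moreover have "i * (2 + 2 * n) \<le> n * (2 + 2 * n)" using that by (intro mult_le_mono) auto
      ultimately show ?thesis using that by (simp add: eq sz_rev sz_nat)
    qed
  qed (intro pt_intros)+
  then have "pt (\<lambda>n. rev (snd (((\<lambda>z. (Suc (fst z), fst z # snd z)) ^^ n) (0, []))))"
    by (intro pt_intros)
  then have "pt (\<lambda>n. [0..<n])" by (simp add: eq)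
  from pt_comp[OF this pt_diff[OF assms(2,1)]] have "pt (\<lambda>x. map (\<lambda>i. i + f x) [0..<g x - f x])"
    by (rule pt_map) (intro pt_intros pt_comp[OF assms(1)])
  moreover have "map (\<lambda>i. i + a) [0..<b - a] = [a..<b]" for a b :: nat
    by (cases "a \<le> b") (auto simp: map_add_upt)
  ultimately show ?thesis by simp
qed

text \<open>\<open>m\<close> is a fixed number and not an argument: the result has
  \<open>length (l x) ^ m\<close> entries, and each induction step on \<open>m\<close> nests one
  more polynomial-time map.\<close>

lemma pt_n_lists [pt_intros]:
  fixes l :: "'a::enc \<Rightarrow> 'e::enc list"
  assumes "pt l" shows "pt (\<lambda>x. List.n_lists m (l x))"
proof (induction m)
  case 0
  show ?case by (simp add: pt_const)
next
  case (Suc m)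
  have "pt (\<lambda>x. concat (map (\<lambda>ys. map (\<lambda>y. y # ys) (l x)) (List.n_lists m (l x))))"
    by (intro pt_intros Suc pt_comp[OF assms])
  then show ?case by simp
qed

text \<open>The numbers are the tags of \<open>enc_gate\<close>, so the kind is read off the left
  subtree.\<close>

fun kind :: "gate \<Rightarrow> nat" where
  "kind (NotG j) = 0"
| "kind (AndG js) = 1"
| "kind (OrG js) = 2"

lemma enc_gate_simps [simp]:
  "enc (NotG j) = Node (enc (0::nat)) (enc j)"
  "enc (AndG js) = Node (enc (1::nat)) (enc js)"
  "enc (OrG js) = Node (enc (2::nat)) (enc js)"
proof -
  have "enc = enc_nat" by (rule ext) (simp add: enc_nat_eq)
  then show "enc (NotG j) = Node (enc (0::nat)) (enc j)"
    "enc (AndG js) = Node (enc (1::nat)) (enc js)" "enc (OrG js) = Node (enc (2::nat)) (enc js)"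
    by (simp_all add: enc_gate_eq enc_list_eq)
qed

lemma pt_kind [pt_intros]: "pt f \<Longrightarrow> pt (\<lambda>x. kind (f x))"
proof (rule pt_comp[of kind], rule pt_expr[of "LeftE (Var 0)"])
  show "eval (LeftE (Var 0)) s = enc (kind g)" if "s 0 = enc g" for g and s
    using that by (cases g) auto
qed auto

lemma pt_fanin [pt_intros]: "pt f \<Longrightarrow> pt (\<lambda>x. fanin (f x))"
proof (rule pt_comp[of fanin])
  show "pt fanin"
  proof (rule pt_recast)
    \<comment> \<open>A negation stores a bare number, which becomes a one-element list by attaching
      \<open>Leaf\<close>.\<close>
    show "pt (\<lambda>g::gate. if kind g = 0 then Node (tright (enc g)) Leaf else tright (enc g))"
      by (intro pt_intros)
    show "enc (fanin g) = enc (if kind g = 0 then Node (tright (enc g)) Leaf else tright (enc g))" for g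
      by (cases g) (auto simp: enc_tree)
  qed
qed

section \<open>Typed instances of Edge Unique Label Cover\<close>

text \<open>An edge \<open>(u, v, f)\<close> demands that \<open>f\<close> maps the label of \<open>u\<close> to that of \<open>v\<close>.\<close>

definition eulc_input :: "'v::enc list \<Rightarrow> 'a::enc list \<Rightarrow> ('v \<times> 'v \<times> ('a \<Rightarrow> 'a)) list \<Rightarrow> tree" where
  "eulc_input vs ss es =
     enc (map (\<lambda>v. (v, ss)) vs, ss, map (\<lambda>(u, v, f). (u, v, map (\<lambda>a. (a, f a)) ss)) es)"

text \<open>Unordered pairs, because the budget counts edges of the graph rather than entries of
  \<open>es\<close>.\<close>

definition violated :: "('v \<times> 'v \<times> ('a \<Rightarrow> 'a)) list \<Rightarrow> ('v \<Rightarrow> 'a) \<Rightarrow> 'v set set" where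
  "violated es \<Psi> = {{u, v} | u v f. (u, v, f) \<in> set es \<and> f (\<Psi> u) \<noteq> \<Psi> v}"

definition labelable :: "'v list \<Rightarrow> 'a list \<Rightarrow> ('v \<times> 'v \<times> ('a \<Rightarrow> 'a)) list \<Rightarrow> nat \<Rightarrow> bool" where
  "labelable vs ss es k \<longleftrightarrow> (\<exists>\<Psi>. (\<forall>v\<in>set vs. \<Psi> v \<in> set ss) \<and> card (violated es \<Psi>) \<le> k)"

lemma inj_enc: "inj enc"
  by (rule injI) (rule enc_inj)

lemma inv_enc [simp]: "inv enc (enc a) = a"
  by (rule inv_f_f[OF inj_enc])

lemma enc_tree_id: "(enc :: tree \<Rightarrow> tree) = (\<lambda>t. t)"
  by (rule ext) (rule enc_tree)

lemma enc_vertex_eq: "enc_vertex = enc"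
  by (rule ext) (auto simp: enc_vertex_def enc_list_eq enc_tree_id)

lemma enc_edge_eq: "enc_edge = enc"
proof -
  have "(\<lambda>(a, b). Node a b) = (enc :: tree \<times> tree \<Rightarrow> tree)" by (rule ext) (auto simp: enc_tree_id)
  then show ?thesis by (intro ext) (auto simp: enc_edge_def enc_list_eq enc_tree_id)
qed

lemma encodes_iff:
  "encodes x I \<longleftrightarrow>
     (\<exists>vs ss es. x = enc (vs, ss, es) \<and>
        vertices I = fst ` set vs \<and>
        (\<forall>(v, ls)\<in>set vs. phi I v = set ls) \<and>
        alphabet I = set ss \<and>
        edges I = (\<lambda>(u, v, ps). {u, v}) ` set es \<and>
        (\<forall>(u, v, ps)\<in>set es. psi I {u, v} u = set ps))"
  unfolding encodes_def enc_vertex_eq enc_edge_eq enc_Pair enc_list_eq by (simp add: enc_tree_id)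

lemma encodes_enc:
  "encodes (enc (vs, ss, es)) I \<longleftrightarrow>
        vertices I = fst ` set vs \<and>
        (\<forall>(v, ls)\<in>set vs. phi I v = set ls) \<and>
        alphabet I = set ss \<and>
        edges I = (\<lambda>(u, v, ps). {u, v}) ` set es \<and>
        (\<forall>(u, v, ps)\<in>set es. psi I {u, v} u = set ps)"
  (is "_ \<longleftrightarrow> ?P vs ss es")
proof -
  have "encodes x I \<longleftrightarrow> (\<exists>vs ss es. x = enc (vs, ss, es) \<and> ?P vs ss es)" for x
    by (rule encodes_iff)
  then show ?thesis by (simp only: enc_eq_iff prod.inject) metis
qed

lemma enc_map_enc: "enc (map enc xs) = enc xs"
  by (induction xs) (simp_all add: enc_tree)

lemma enc_map_cong: "(\<And>x. x \<in> set xs \<Longrightarrow> enc (f x) = enc (g x)) \<Longrightarrow> enc (map f xs) = enc (map g xs)"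
  by (induction xs) simp_all

lemma encodes_eulc_input:
  "encodes (eulc_input vs ss es) I \<longleftrightarrow>
     vertices I = enc ` set vs \<and>
     (\<forall>v\<in>set vs. phi I (enc v) = enc ` set ss) \<and>
     alphabet I = enc ` set ss \<and>
     edges I = (\<lambda>(u, v, f). {enc u, enc v}) ` set es \<and>
     (\<forall>(u, v, f)\<in>set es. psi I {enc u, enc v} (enc u) = (\<lambda>a. (enc a, enc (f a))) ` set ss)"
proof -
  let ?vs = "map (\<lambda>v. (enc v, map enc ss)) vs"
  let ?es = "map (\<lambda>(u, v, f). (enc u, enc v, map (\<lambda>a. (enc a, enc (f a))) ss)) es"
  have "enc (map (\<lambda>v. (v, ss)) vs) = enc ?vs"
    by (rule enc_map_cong) (simp add: enc_tree enc_map_enc)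
  moreover have "enc (map (\<lambda>(u, v, f). (u, v, map (\<lambda>a. (a, f a)) ss)) es) = enc ?es"
    by (rule enc_map_cong) (auto simp: enc_tree intro!: enc_map_cong)
  ultimately have eq: "eulc_input vs ss es = enc (?vs, map enc ss, ?es)"
    by (simp add: eulc_input_def enc_map_enc)
  have 1: "fst ` set ?vs = enc ` set vs"
    by (simp add: image_image)
  have 2: "(\<forall>(v, ls)\<in>set ?vs. phi I v = set ls) \<longleftrightarrow> (\<forall>v\<in>set vs. phi I (enc v) = enc ` set ss)"
    by simp
  have 3: "(\<lambda>(u, v, ps). {u, v}) ` set ?es = (\<lambda>(u, v, f). {enc u, enc v}) ` set es"
    by (simp add: image_image case_prod_unfold)
  have 4: "(\<forall>(u, v, ps)\<in>set ?es. psi I {u, v} u = set ps) \<longleftrightarrow>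
      (\<forall>(u, v, f)\<in>set es. psi I {enc u, enc v} (enc u) = (\<lambda>a. (enc a, enc (f a))) ` set ss)"
    by (simp add: case_prod_unfold)
  show ?thesis unfolding eq encodes_enc 1 2 3 4 by (simp only: set_map)
qed

text \<open>An involution is its own converse, so the relation looks the same from both endpoints
  and the orientation of an entry is immaterial. \<open>unique\<close> makes two entries for the
  same pair of vertices consistent, as \<open>psi\<close> is indexed by the unordered edge.\<close>

locale involutive_edges =
  fixes vs :: "'v::enc list" and ss :: "'a::enc list" and es :: "('v \<times> 'v \<times> ('a \<Rightarrow> 'a)) list"
  assumes endpoints: "(u, v, f) \<in> set es \<Longrightarrow> u \<in> set vs \<and> v \<in> set vs \<and> u \<noteq> v"
    and involution: "(u, v, f) \<in> set es \<Longrightarrow> a \<in> set ss \<Longrightarrow> f a \<in> set ss \<and> f (f a) = a"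
    and unique: "(u, v, f) \<in> set es \<Longrightarrow> (u', v', f') \<in> set es \<Longrightarrow> {u, v} = {u', v'} \<Longrightarrow> a \<in> set ss \<Longrightarrow> f a = f' a"
begin

definition graph :: "('a \<Rightarrow> 'a) \<Rightarrow> (tree \<times> tree) set" where
  "graph f = (\<lambda>a. (enc a, enc (f a))) ` set ss"

lemma graph_converse: "(u, v, f) \<in> set es \<Longrightarrow> (graph f)\<inverse> = graph f"
proof -
  assume e: "(u, v, f) \<in> set es"
  have "(enc (f a), enc a) \<in> graph f" if "a \<in> set ss" for a
    using involution[OF e that] unfolding graph_def by (metis (mono_tags, lifting) image_eqI)
  then have "(graph f)\<inverse> \<subseteq> graph f" by (auto simp: graph_def)
  then show ?thesis by (metis converse_converse converse_mono subset_antisym)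
qed

lemma graph_permutation: assumes "(u, v, f) \<in> set es" shows "is_permutation (enc ` set ss) (graph f)"
  unfolding is_permutation_def
proof (intro exI conjI)
  let ?g = "\<lambda>t. enc (f (inv enc t))"
  show "bij_betw ?g (enc ` set ss) (enc ` set ss)"
    using involution[OF assms] by (intro bij_betw_byWitness[where f' = ?g]) auto
  show "graph f = {(a, ?g a) | a. a \<in> enc ` set ss}"
    by (auto simp: graph_def)
qed

lemma permutation_partial: "is_permutation S r \<Longrightarrow> partial_permutation S r"
  unfolding is_permutation_def partial_permutation_def
  by (auto simp: single_valued_def bij_betw_def inj_on_def)

lemma finite_violated: "finite (violated es \<Psi>)"
proof (rule finite_subset)
  show "violated es \<Psi> \<subseteq> (\<lambda>(u, v, f). {u, v}) ` set es" by (force simp: violated_def)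
qed simp

lemma edge_cases:
  assumes "{s, t} \<in> (\<lambda>(u, v, f). {enc u, enc v}) ` set es"
  obtains u v f where "(u, v, f) \<in> set es" "s = enc u" "t = enc v"
    | u v f where "(u, v, f) \<in> set es" "s = enc v" "t = enc u"
proof -
  from assms obtain u v f where "(u, v, f) \<in> set es" "{s, t} = {enc u, enc v}" by auto
  then show thesis using that by (auto simp: doubleton_eq_iff)
qed

text \<open>The union selects the common graph of all entries for \<open>e\<close> without a
  choice.\<close>

definition the_eulc :: "(tree, tree) eulc" where
  "the_eulc = \<lparr>vertices = enc ` set vs, edges = (\<lambda>(u, v, f). {enc u, enc v}) ` set es,
     alphabet = enc ` set ss, phi = (\<lambda>_. enc ` set ss),
     psi = (\<lambda>e _. \<Union> {graph f | u v f. (u, v, f) \<in> set es \<and> e = {enc u, enc v}})\<rparr>"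

lemma the_eulc_simps [simp]:
  "vertices the_eulc = enc ` set vs" "edges the_eulc = (\<lambda>(u, v, f). {enc u, enc v}) ` set es"
  "alphabet the_eulc = enc ` set ss" "phi the_eulc v = enc ` set ss"
  by (simp_all add: the_eulc_def)

lemma psi_the_eulc: assumes "(u, v, f) \<in> set es" shows "psi the_eulc {enc u, enc v} w = graph f"
proof -
  have "graph f' = graph f" if "(u', v', f') \<in> set es" "{enc u, enc v} = {enc u', enc v'}" for u' v' f'
  proof -
    from that(2) have "{u, v} = {u', v'}" by (auto simp: doubleton_eq_iff)
    then show ?thesis unfolding graph_def using unique[OF assms that(1)] by (intro image_cong) auto
  qed
  then have "{graph f' | u' v' f'. (u', v', f') \<in> set es \<and> {enc u, enc v} = {enc u', enc v'}} = {graph f}"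
    using assms by blast
  then show ?thesis by (simp add: the_eulc_def)
qed

lemma psi_the_eulc': "{s, t} \<in> edges the_eulc \<Longrightarrow>
    is_permutation (enc ` set ss) (psi the_eulc {s, t} w) \<and>
    psi the_eulc {s, t} w = (psi the_eulc {s, t} w')\<inverse>"
proof -
  assume "{s, t} \<in> edges the_eulc"
  then have "{s, t} \<in> (\<lambda>(u, v, f). {enc u, enc v}) ` set es" by simp
  then obtain u v f where e: "(u, v, f) \<in> set es" and st: "{s, t} = {enc u, enc v}" by auto
  show ?thesis
    unfolding st psi_the_eulc[OF e] using graph_converse[OF e] graph_permutation[OF e] by simp
qed

lemma the_eulc_encoded: "encodes (eulc_input vs ss es) the_eulc"
  unfolding encodes_eulc_input using psi_the_eulc by (auto simp: graph_def)

lemma the_eulc_instance: "eulc_instance the_eulc"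
  unfolding eulc_instance_def
proof (intro conjI)
  show "edges the_eulc \<subseteq> {{u, v} |u v. u \<in> vertices the_eulc \<and> v \<in> vertices the_eulc \<and> u \<noteq> v}"
    using endpoints by fastforce
  show "\<forall>u v. {u, v} \<in> edges the_eulc \<longrightarrow>
      partial_permutation (alphabet the_eulc) (psi the_eulc {u, v} u) \<and>
      psi the_eulc {u, v} u = (psi the_eulc {u, v} v)\<inverse>"
    using psi_the_eulc'[of _ _ _] permutation_partial by (simp only: the_eulc_simps(3)) blast
qed simp_all

lemma the_eulc_restricted: "eulc_restricted the_eulc"
  unfolding eulc_restricted_def using psi_the_eulc' by (simp only: the_eulc_simps(3,4)) blast

lemma the_eulc_solvable: assumes "labelable vs ss es k" shows "eulc_solvable the_eulc k"
proof -
  from assms obtain \<Psi> where \<Psi>: "\<And>v. v \<in> set vs \<Longrightarrow> \<Psi> v \<in> set ss" "card (violated es \<Psi>) \<le> k"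
    unfolding labelable_def by blast
  let ?F = "(`) enc ` violated es \<Psi>" and ?P = "\<lambda>t. enc (\<Psi> (inv enc t))"
  have "?F \<subseteq> edges the_eulc"
  proof (clarsimp simp: violated_def)
    fix u v f assume "(u, v, f) \<in> set es"
    then show "{enc u, enc v} \<in> (\<lambda>(u, v, f). {enc u, enc v}) ` set es"
      by (rule rev_image_eqI) simp
  qed
  moreover have "card ?F \<le> k" using card_image_le[OF finite_violated] \<Psi>(2) by (rule le_trans)
  moreover have "(?P s, ?P t) \<in> psi the_eulc {s, t} s" if "{s, t} \<in> edges the_eulc - ?F" for s t
  proof -
    from that have "{s, t} \<in> (\<lambda>(u, v, f). {enc u, enc v}) ` set es" by simp
    then show ?thesis
    proof (cases rule: edge_cases)
      case (1 u v f)
      have "f (\<Psi> u) = \<Psi> v"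
      proof (rule ccontr)
        assume "f (\<Psi> u) \<noteq> \<Psi> v"
        then have "enc ` {u, v} \<in> ?F" using 1 by (intro imageI) (auto simp: violated_def)
        then show False using that 1 by simp
      qed
      then have "(enc (\<Psi> u), enc (\<Psi> v)) \<in> graph f"
        unfolding graph_def using 1 \<Psi>(1) endpoints by (intro image_eqI[where x = "\<Psi> u"]) auto
      with 1 show ?thesis using psi_the_eulc[OF 1(1)] by simp
    next
      case (2 u v f)
      have "f (\<Psi> u) = \<Psi> v"
      proof (rule ccontr)
        assume "f (\<Psi> u) \<noteq> \<Psi> v"
        then have "enc ` {u, v} \<in> ?F" using 2 by (intro imageI) (auto simp: violated_def)
        then show False using that 2 by (simp add: insert_commute)
      qed
      then have "(enc (\<Psi> u), enc (\<Psi> v)) \<in> graph f"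
        unfolding graph_def using 2 \<Psi>(1) endpoints by (intro image_eqI[where x = "\<Psi> u"]) auto
      then have "(enc (\<Psi> v), enc (\<Psi> u)) \<in> graph f"
        using graph_converse[OF 2(1)] by blast
      with 2 show ?thesis using psi_the_eulc[OF 2(1)] by (simp add: insert_commute)
    qed
  qed
  moreover have "\<forall>v\<in>vertices the_eulc. ?P v \<in> alphabet the_eulc \<and> ?P v \<in> phi the_eulc v"
    using \<Psi>(1) by simp
  ultimately show ?thesis unfolding eulc_solvable_def
    by (intro exI[of _ ?F] exI[of _ ?P] conjI allI impI) simp_all
qed

text \<open>Membership in the problem concerns some instance with this encoding, hence an arbitrary
  \<open>I\<close>; the encoding fixes it on all listed vertices and edges. After decoding the
  labels, the violated edges map injectively into \<open>F\<close>.\<close>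

lemma solvable_labelable:
  assumes "encodes (eulc_input vs ss es) I" "eulc_solvable I k"
  shows "labelable vs ss es k"
proof -
  from assms(1) have I: "vertices I = enc ` set vs" "alphabet I = enc ` set ss"
     "edges I = (\<lambda>(u, v, f). {enc u, enc v}) ` set es"
     "\<And>u v f. (u, v, f) \<in> set es \<Longrightarrow> psi I {enc u, enc v} (enc u) = graph f"
    unfolding encodes_eulc_input graph_def by auto
  from assms(2) obtain F P where F: "F \<subseteq> edges I" "card F \<le> k"
    and P: "\<And>v. v \<in> vertices I \<Longrightarrow> P v \<in> alphabet I"
    and FP: "\<And>u v. {u, v} \<in> edges I - F \<Longrightarrow> (P u, P v) \<in> psi I {u, v} u"
    unfolding eulc_solvable_def by blast
  let ?\<Psi> = "\<lambda>v. inv enc (P (enc v))"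
  have "enc ` {u, v} \<in> F" if "(u, v, f) \<in> set es" "f (?\<Psi> u) \<noteq> ?\<Psi> v" for u v f
  proof (rule ccontr)
    assume "enc ` {u, v} \<notin> F"
    then have "{enc u, enc v} \<in> edges I - F" using that(1) unfolding I by force
    from FP[OF this] that show False by (auto simp: I(4) graph_def)
  qed
  then have sub: "(`) enc ` violated es ?\<Psi> \<subseteq> F" by (auto simp: violated_def)
  have "inj_on ((`) enc) (violated es ?\<Psi>)"
    using inj_enc by (meson inj_image_eq_iff inj_onI)
  moreover have "finite F" using F(1) I(3) by (simp add: finite_subset)
  ultimately have "card (violated es ?\<Psi>) \<le> k"
    using sub F(2) by (meson card_inj_on_le le_trans)
  moreover have "?\<Psi> v \<in> set ss" if "v \<in> set vs" for v
    using P[of "enc v"] that I by auto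
  ultimately show ?thesis unfolding labelable_def by (intro exI[of _ ?\<Psi>] conjI ballI)
qed

theorem eulc_input_iff:
  "(eulc_input vs ss es, k) \<in> edge_unique_label_cover \<longleftrightarrow> labelable vs ss es k"
  "(eulc_input vs ss es, k) \<in> restricted_edge_unique_label_cover \<longleftrightarrow> labelable vs ss es k"
proof -
  show "(eulc_input vs ss es, k) \<in> edge_unique_label_cover \<longleftrightarrow> labelable vs ss es k"
    unfolding edge_unique_label_cover_def mem_Collect_eq case_prod_conv
    using the_eulc_encoded the_eulc_instance the_eulc_solvable solvable_labelable by metis
  show "(eulc_input vs ss es, k) \<in> restricted_edge_unique_label_cover \<longleftrightarrow> labelable vs ss es k"
    unfolding restricted_edge_unique_label_cover_def mem_Collect_eq case_prod_conv
    using the_eulc_encoded the_eulc_instance the_eulc_restricted the_eulc_solvable solvable_labelable by metis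
qed

end

section \<open>Uncuttable unary constraints\<close>

text \<open>
  Labels carry a bit. A vertex \<open>b\<close> is the tip of \<open>K + 1\<close> triangles; two sides of each are identity
  edges and the third one flips the bit of exactly the labels that are not allowed at \<open>b\<close>. A
  forbidden label at \<open>b\<close> thus costs \<open>K + 1\<close> edges.
\<close>

definition tri_vs :: "'b list \<Rightarrow> nat \<Rightarrow> ('b \<times> nat list) list" where
  "tri_vs BV K = map (\<lambda>b. (b, [])) BV @
     concat (map (\<lambda>b. concat (map (\<lambda>j. [(b, [j, 0]), (b, [j, 1])]) [0..<Suc K])) BV)"

definition tri_ss :: "'l list \<Rightarrow> (bool \<times> 'l) list" where
  "tri_ss L = map (\<lambda>l. (False, l)) L @ map (\<lambda>l. (True, l)) L"

definition tri_flip :: "('b \<Rightarrow> 'l \<Rightarrow> bool) \<Rightarrow> 'b \<Rightarrow> bool \<times> 'l \<Rightarrow> bool \<times> 'l" where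
  "tri_flip ok b z = (if ok b (snd z) then z else (\<not> fst z, snd z))"

definition tri_es :: "('b \<Rightarrow> 'l \<Rightarrow> bool) \<Rightarrow> 'b list \<Rightarrow> ('b \<times> 'b) list \<Rightarrow> nat \<Rightarrow>
    (('b \<times> nat list) \<times> ('b \<times> nat list) \<times> (bool \<times> 'l \<Rightarrow> bool \<times> 'l)) list" where
  "tri_es ok BV BE K = map (\<lambda>e. ((fst e, []), (snd e, []), \<lambda>z. z)) BE @
     concat (map (\<lambda>b. concat (map (\<lambda>j.
       [((b, []), (b, [j, 0]), \<lambda>z. z), ((b, []), (b, [j, 1]), \<lambda>z. z),
        ((b, [j, 0]), (b, [j, 1]), tri_flip ok b)]) [0..<Suc K])) BV)"

locale triangles =
  fixes ok :: "'b::enc \<Rightarrow> 'l::enc \<Rightarrow> bool" and BV :: "'b list" and BE :: "('b \<times> 'b) list"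
    and L :: "'l list" and K :: nat
  assumes BE: "(b, b') \<in> set BE \<Longrightarrow> b \<in> set BV \<and> b' \<in> set BV \<and> b \<noteq> b'"
begin

abbreviation "es \<equiv> tri_es ok BV BE K"
abbreviation "vs \<equiv> tri_vs BV K"
abbreviation "ss \<equiv> tri_ss L"

lemma set_tri_es:
  "e \<in> set es \<longleftrightarrow> (\<exists>b b'. (b, b') \<in> set BE \<and> e = ((b, []), (b', []), \<lambda>z. z)) \<or>
     (\<exists>b j. b \<in> set BV \<and> j \<le> K \<and> (e = ((b, []), (b, [j, 0]), \<lambda>z. z) \<or>
       e = ((b, []), (b, [j, 1]), \<lambda>z. z) \<or> e = ((b, [j, 0]), (b, [j, 1]), tri_flip ok b)))"
  unfolding tri_es_def by (force simp: less_Suc_eq_le)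

lemma set_tri_vs:
  "v \<in> set vs \<longleftrightarrow> (\<exists>b\<in>set BV. v = (b, []) \<or> (\<exists>j\<le>K. v = (b, [j, 0]) \<or> v = (b, [j, 1])))"
  unfolding tri_vs_def by (auto simp: less_Suc_eq_le)

lemma set_tri_ss: "z \<in> set ss \<longleftrightarrow> snd z \<in> set L"
  unfolding tri_ss_def by (cases z) auto

sublocale involutive_edges vs ss es
proof
  fix u v f assume e: "(u, v, f) \<in> set es"
  show "u \<in> set vs \<and> v \<in> set vs \<and> u \<noteq> v"
    using e BE unfolding set_tri_es set_tri_vs by auto
  fix a assume "a \<in> set ss"
  then show "f a \<in> set ss \<and> f (f a) = a"
    using e unfolding set_tri_es set_tri_ss by (auto simp: tri_flip_def)
next
  fix u v f u' v' f' a assume "(u, v, f) \<in> set es" "(u', v', f') \<in> set es" "{u, v} = {u', v'}"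
  then show "f a = f' a"
    unfolding set_tri_es by (auto simp: doubleton_eq_iff)
qed

definition cut :: "('b \<Rightarrow> 'l) \<Rightarrow> 'b set set" where
  "cut \<psi> = {{b, b'} | b b'. (b, b') \<in> set BE \<and> \<psi> b \<noteq> \<psi> b'}"

lemma finite_cut: "finite (cut \<psi>)"
proof (rule finite_subset)
  show "cut \<psi> \<subseteq> (\<lambda>(b, b'). {b, b'}) ` set BE" by (force simp: cut_def)
qed simp

text \<open>With all bits false and every triangle copying its tip, the flips act trivially on
  allowed labels, and only base edges can be violated.\<close>

lemma labelable_if_cut:
  assumes "\<And>b. b \<in> set BV \<Longrightarrow> \<psi> b \<in> set L \<and> ok b (\<psi> b)" "card (cut \<psi>) \<le> K"
  shows "labelable vs ss es K"
proof -
  let ?\<Psi> = "\<lambda>v. (False, \<psi> (fst v))"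
  have flip: "tri_flip ok b (False, \<psi> b) = (False, \<psi> b)" if "b \<in> set BV" for b
    using assms(1)[OF that] by (simp add: tri_flip_def)
  have "violated es ?\<Psi> \<subseteq> (`) (\<lambda>b. (b, [])) ` cut \<psi>"
  proof
    fix E assume "E \<in> violated es ?\<Psi>"
    then obtain u v f where E: "E = {u, v}" "(u, v, f) \<in> set es" "f (?\<Psi> u) \<noteq> ?\<Psi> v"
      unfolding violated_def by blast
    then obtain b b' where "(b, b') \<in> set BE" "u = (b, [])" "v = (b', [])" "\<psi> b \<noteq> \<psi> b'"
      unfolding set_tri_es by (elim disjE exE conjE) (simp_all add: flip)
    then show "E \<in> (`) (\<lambda>b. (b, [])) ` cut \<psi>"
      unfolding E(1) by (intro image_eqI[where x = "{b, b'}"]) (auto simp: cut_def)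
  qed
  then have "card (violated es ?\<Psi>) \<le> card (cut \<psi>)"
    by (rule surj_card_le[OF finite_cut])
  moreover have "?\<Psi> v \<in> set ss" if "v \<in> set vs" for v
    using that assms(1) unfolding set_tri_vs set_tri_ss by auto
  ultimately show ?thesis
    unfolding labelable_def using assms(2) by (intro exI[of _ ?\<Psi>] conjI ballI) simp_all
qed

text \<open>With a forbidden label at \<open>b\<close>, following the relations around a triangle
  changes the bit, so each of the \<open>K + 1\<close> triangles has a violated edge, one more than
  the budget.\<close>

lemma cut_if_labelable:
  assumes "labelable vs ss es K"
  obtains \<psi> where "\<And>b. b \<in> set BV \<Longrightarrow> \<psi> b \<in> set L \<and> ok b (\<psi> b)" "card (cut \<psi>) \<le> K"
proof -
  from assms obtain \<Psi> where \<Psi>: "\<And>v. v \<in> set vs \<Longrightarrow> \<Psi> v \<in> set ss" and card: "card (violated es \<Psi>) \<le> K"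
    unfolding labelable_def by blast
  let ?\<psi> = "\<lambda>b. snd (\<Psi> (b, []))"
  have violatedI: "{u, v} \<in> violated es \<Psi>" if "(u, v, f) \<in> set es" "f (\<Psi> u) \<noteq> \<Psi> v" for u v f
    using that unfolding violated_def by blast
  have "?\<psi> b \<in> set L" if "b \<in> set BV" for b
    using \<Psi>[of "(b, [])"] that unfolding set_tri_vs set_tri_ss by blast
  moreover have "ok b (?\<psi> b)" if b: "b \<in> set BV" for b
  proof (rule ccontr)
    assume nok: "\<not> ok b (?\<psi> b)"
    \<comment> \<open>Requiring a private corner of the triangle in \<open>E\<close> makes the edges
      for different \<open>j\<close> distinct.\<close>
    have "\<exists>E\<in>violated es \<Psi>. E \<subseteq> {(b, []), (b, [j, 0]), (b, [j, 1])} \<and> ((b, [j, 0]) \<in> E \<or> (b, [j, 1]) \<in> E)"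
      if j: "j \<le> K" for j
    proof (rule ccontr)
      assume no: "\<not> ?thesis"
      have e: "((b, []), (b, [j, 0]), \<lambda>z. z) \<in> set es" "((b, []), (b, [j, 1]), \<lambda>z. z) \<in> set es"
        "((b, [j, 0]), (b, [j, 1]), tri_flip ok b) \<in> set es"
        using b j unfolding set_tri_es by blast+
      have "\<Psi> (b, []) = \<Psi> (b, [j, 0])" using violatedI[OF e(1)] no by fastforce
      moreover have "\<Psi> (b, []) = \<Psi> (b, [j, 1])" using violatedI[OF e(2)] no by fastforce
      moreover have "tri_flip ok b (\<Psi> (b, [j, 0])) = \<Psi> (b, [j, 1])" using violatedI[OF e(3)] no by fastforce
      ultimately have "tri_flip ok b (\<Psi> (b, [])) = \<Psi> (b, [])" by simp
      then show False using nok by (cases "\<Psi> (b, [])") (simp add: tri_flip_def)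
    qed
    then obtain E where E: "\<And>j. j \<le> K \<Longrightarrow> E j \<in> violated es \<Psi> \<and>
      E j \<subseteq> {(b, []), (b, [j, 0]), (b, [j, 1])} \<and> ((b, [j, 0]) \<in> E j \<or> (b, [j, 1]) \<in> E j)"
      by metis
    have "inj_on E {..K}"
    proof (rule inj_onI)
      fix i j assume "i \<in> {..K}" "j \<in> {..K}" and eq: "E i = E j"
      then have "(b, [i, 0]) \<in> E j \<or> (b, [i, 1]) \<in> E j" "E j \<subseteq> {(b, []), (b, [j, 0]), (b, [j, 1])}"
        using E[of i] E[of j] by auto
      then show "i = j" by auto
    qed
    moreover have "E ` {..K} \<subseteq> violated es \<Psi>" using E by auto
    ultimately have "card {..K} \<le> card (violated es \<Psi>)"
      using finite_violated by (rule card_inj_on_le)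
    with card show False by simp
  qed
  moreover have "card (cut ?\<psi>) \<le> K"
  proof -
    have "(`) (\<lambda>b. (b, [])) ` cut ?\<psi> \<subseteq> violated es \<Psi>"
    proof (rule image_subsetI)
      fix E assume "E \<in> cut ?\<psi>"
      then obtain b b' where E: "E = {b, b'}" "(b, b') \<in> set BE" "?\<psi> b \<noteq> ?\<psi> b'"
        unfolding cut_def by blast
      then have "((b, []), (b', []), \<lambda>z. z) \<in> set es" unfolding set_tri_es by blast
      moreover have "\<Psi> (b, []) \<noteq> \<Psi> (b', [])" using E(3) by auto
      ultimately show "(\<lambda>b. (b, [])) ` E \<in> violated es \<Psi>" unfolding E(1) by (simp add: violatedI)
    qed
    moreover have "inj_on ((`) (\<lambda>b. (b, []))) (cut ?\<psi>)"
      by (rule inj_on_subset[OF inj_on_image[of "\<lambda>b. (b, [])" UNIV]]) (auto intro: inj_onI)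
    ultimately have "card (cut ?\<psi>) \<le> card (violated es \<Psi>)"
      by (intro card_inj_on_le finite_violated)
    with card show ?thesis by simp
  qed
  ultimately show thesis using that[of ?\<psi>] by blast
qed

end

section \<open>Constraint satisfaction as a labelling problem\<close>

text \<open>
  For each tuple \<open>\<tau>\<close> of variables there is a vertex \<open>(\<tau>, [])\<close>, whose label \<open>(False, x)\<close> proposes the
  values \<open>x\<close> for \<open>\<tau>\<close>, and for each variable \<open>s\<close> a vertex \<open>([], [s])\<close> whose label
  \<open>(True, y)\<close> proposes the value \<open>y ! 0\<close>. Two paths of identity edges connect \<open>\<tau>\<close> with its \<open>p\<close>-th
  variable. Since the labels at the ends are of different kinds, each path must be cut; with a
  budget equal to the number of paths it is cut once, at some position \<open>i\<close>. The unary constraints on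
  the inner vertices enforce \<open>y ! 0 \<le> i \<le> x ! p\<close> on one path and the converse on the other one.
\<close>

type_synonym bvert = "nat list \<times> nat list"
type_synonym path = "nat list \<times> nat \<times> nat"

definition paths :: "nat \<Rightarrow> nat list list \<Rightarrow> path list" where
  "paths r TT = concat (map (\<lambda>\<tau>. concat (map (\<lambda>p. [(\<tau>, p, 0), (\<tau>, p, 1)]) [0..<r])) TT)"

text \<open>The two paths run in opposite directions: with last component 0 from the tuple to the
  variable, otherwise from the variable to the tuple. In the intended labelling both are then cut at
  the same position, the value of the variable.\<close>

definition pnode :: "nat \<Rightarrow> path \<Rightarrow> nat \<Rightarrow> bvert" where
  "pnode M \<pi> i =
    (if i = 0 \<and> snd (snd \<pi>) = 0 \<or> i = M \<and> snd (snd \<pi>) \<noteq> 0 then (fst \<pi>, [])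
     else if i = 0 \<or> i = M then ([], [nthd 0 (fst \<pi>) (fst (snd \<pi>))])
     else (fst \<pi>, [fst (snd \<pi>), snd (snd \<pi>), i]))"

text \<open>The shape of \<open>b\<close> tells its kind: \<open>snd b = []\<close> for a tuple,
  \<open>fst b = []\<close> for a variable, and \<open>(\<tau>, [p, d, i])\<close> for an inner
  vertex, which compares its own position \<open>i\<close> with the relevant coordinate of whichever
  label reaches it.\<close>

definition path_ok :: "(nat list \<Rightarrow> nat list \<Rightarrow> bool) \<Rightarrow> bvert \<Rightarrow> bool \<times> nat list \<Rightarrow> bool" where
  "path_ok chk b l =
    (if snd b = [] then \<not> fst l \<and> chk (fst b) (snd l)
     else if fst b = [] then fst l
     else if nthd 0 (snd b) 1 = 0 then
       (if fst l then nthd 0 (snd l) 0 < nthd 0 (snd b) 2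
        else nthd 0 (snd b) 2 \<le> nthd 0 (snd l) (nthd 0 (snd b) 0))
     else
       (if fst l then nthd 0 (snd b) 2 \<le> nthd 0 (snd l) 0
        else nthd 0 (snd l) (nthd 0 (snd b) 0) < nthd 0 (snd b) 2))"

definition path_BV :: "nat \<Rightarrow> nat \<Rightarrow> nat list list \<Rightarrow> bvert list" where
  "path_BV r M TT = concat (map (\<lambda>\<pi>. map (\<lambda>i. pnode M \<pi> i) [0..<Suc M]) (paths r TT))"

definition path_BE :: "nat \<Rightarrow> nat \<Rightarrow> nat list list \<Rightarrow> (bvert \<times> bvert) list" where
  "path_BE r M TT = concat (map (\<lambda>\<pi>. map (\<lambda>i. (pnode M \<pi> i, pnode M \<pi> (Suc i))) [0..<M]) (paths r TT))"

text \<open>All vertices share one alphabet, so labels of variables are lists of length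
  \<open>r\<close> too, although they speak through entry 0 alone.\<close>

definition path_L :: "nat \<Rightarrow> nat \<Rightarrow> (bool \<times> nat list) list" where
  "path_L r M = map (\<lambda>x. (False, x)) (List.n_lists r [0..<M]) @ map (\<lambda>x. (True, x)) (List.n_lists r [0..<M])"

definition csp_eulc :: "nat \<Rightarrow> nat \<Rightarrow> nat list list \<Rightarrow> (nat list \<Rightarrow> nat list \<Rightarrow> bool) \<Rightarrow> tree" where
  "csp_eulc r M TT chk = eulc_input (tri_vs (path_BV r M TT) (length (paths r TT))) (tri_ss (path_L r M))
     (tri_es (path_ok chk) (path_BV r M TT) (path_BE r M TT) (length (paths r TT)))"

lemma nthd_simps [simp]:
  "nthd d (x # xs) 0 = x" "nthd d (x # xs) (Suc i) = nthd d xs i"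
  "nthd d (x # xs) 1 = nthd d xs 0" "nthd d (x # y # xs) 2 = nthd d xs 0"
  by (simp_all add: nthd_def hdd_def numeral_2_eq_2)

text \<open>\<open>0 < r\<close> keeps tuples nonempty, so that the first component separates tuple
  vertices from variable vertices. \<open>2 \<le> M\<close> gives each path an inner vertex;
  otherwise the two paths of a coordinate would be the same edge.\<close>

locale csp =
  fixes r M :: nat and TT :: "nat list list" and chk :: "nat list \<Rightarrow> nat list \<Rightarrow> bool"
  assumes r: "0 < r" and M: "2 \<le> M" and distinct: "distinct TT"
    and len: "\<tau> \<in> set TT \<Longrightarrow> length \<tau> = r"
begin

lemma set_paths: "(\<tau>, p, d) \<in> set (paths r TT) \<longleftrightarrow> \<tau> \<in> set TT \<and> p < r \<and> d < 2"
  unfolding paths_def by (auto simp: less_2_cases_iff)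

lemma path_cases:
  assumes "\<pi> \<in> set (paths r TT)"
  obtains \<tau> p where "\<tau> \<in> set TT" "p < r" "\<tau> \<noteq> []" "nthd 0 \<tau> p = \<tau> ! p" "\<pi> = (\<tau>, p, 0)"
    | \<tau> p where "\<tau> \<in> set TT" "p < r" "\<tau> \<noteq> []" "nthd 0 \<tau> p = \<tau> ! p" "\<pi> = (\<tau>, p, 1)"
proof -
  obtain \<tau> p d where \<pi>: "\<pi> = (\<tau>, p, d)" by (cases \<pi>)
  then have "\<tau> \<in> set TT" "p < r" "d = 0 \<or> d = 1" using assms set_paths by (auto simp: less_2_cases_iff)
  moreover from this have "\<tau> \<noteq> []" "nthd 0 \<tau> p = \<tau> ! p" using len[of \<tau>] r by (auto simp: nthd_nth)
  ultimately show thesis using that \<pi> by blast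
qed

lemma card_paths: "card (set (paths r TT)) = length (paths r TT)"
proof -
  have "set (paths r TT) = set TT \<times> {..<r} \<times> {..<2}" using set_paths by auto
  moreover have "length (paths r TT) = length TT * (r * 2)"
    unfolding paths_def by (simp add: length_concat comp_def sum_list_triv)
  ultimately show ?thesis using distinct by (simp add: card_cartesian_product distinct_card)
qed

lemma pnode_inner: "0 < i \<Longrightarrow> i < M \<Longrightarrow> pnode M (\<tau>, p, d) i = (\<tau>, [p, d, i])"
  by (simp add: pnode_def)

lemma pnode_0: "pnode M (\<tau>, p, d) 0 = (if d = 0 then (\<tau>, []) else ([], [nthd 0 \<tau> p]))"
  using M by (simp add: pnode_def)

lemma pnode_M: "pnode M (\<tau>, p, d) M = (if d = 0 then ([], [nthd 0 \<tau> p]) else (\<tau>, []))"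
  using M by (simp add: pnode_def)

lemma pnode_inj:
  assumes "pnode M \<pi> i = pnode M \<pi>' j" "0 < i" "i < M" "j \<le> M"
  shows "\<pi> = \<pi>' \<and> i = j"
  using assms by (cases \<pi>; cases \<pi>') (auto simp: pnode_def split: if_splits)

lemma pnode_inj_path:
  assumes "pnode M \<pi> i = pnode M \<pi> j" "i \<le> M" "j \<le> M"
  shows "i = j"
  using assms M by (cases \<pi>) (auto simp: pnode_def split: if_splits)

text \<open>By \<open>2 \<le> M\<close> every edge has an inner endpoint, and an inner vertex
  records its path and its position.\<close>

lemma edge_inj:
  assumes eq: "{pnode M \<pi> i, pnode M \<pi> (Suc i)} = {pnode M \<pi>' j, pnode M \<pi>' (Suc j)}"
    and ij: "i < M" "j < M"
  shows "\<pi> = \<pi>' \<and> i = j"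
proof -
  have "\<pi> = \<pi>'"
  proof (cases "0 < i")
    case True
    then show ?thesis
      using eq ij pnode_inj[of \<pi> i \<pi>' j] pnode_inj[of \<pi> i \<pi>' "Suc j"] by (auto simp: doubleton_eq_iff)
  next
    case False
    then have "0 < Suc i" "Suc i < M" using M by auto
    then show ?thesis
      using eq ij pnode_inj[of \<pi> "Suc i" \<pi>' j] pnode_inj[of \<pi> "Suc i" \<pi>' "Suc j"] by (auto simp: doubleton_eq_iff)
  qed
  moreover from this have "i = j \<or> i = Suc j \<and> Suc i = j"
    using eq ij pnode_inj_path[of \<pi>] by (auto simp: doubleton_eq_iff)
  ultimately show ?thesis by auto
qed

lemma set_path_BV: "b \<in> set (path_BV r M TT) \<longleftrightarrow> (\<exists>\<pi>\<in>set (paths r TT). \<exists>i\<le>M. b = pnode M \<pi> i)"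
proof -
  have "set (path_BV r M TT) = (\<Union>\<pi>\<in>set (paths r TT). pnode M \<pi> ` {..M})"
    unfolding path_BV_def
    by (simp add: atLeastLessThanSuc_atLeastAtMost atMost_atLeast0 del: upt_Suc)
  then show ?thesis by auto
qed

lemma set_path_BE: "e \<in> set (path_BE r M TT) \<longleftrightarrow>
    (\<exists>\<pi>\<in>set (paths r TT). \<exists>i<M. e = (pnode M \<pi> i, pnode M \<pi> (Suc i)))"
proof -
  have "set (path_BE r M TT) = (\<Union>\<pi>\<in>set (paths r TT). (\<lambda>i. (pnode M \<pi> i, pnode M \<pi> (Suc i))) ` {..<M})"
    unfolding path_BE_def by (simp add: atLeast0LessThan)
  then show ?thesis by auto
qed

lemma set_path_L: "l \<in> set (path_L r M) \<longleftrightarrow> length (snd l) = r \<and> (\<forall>a\<in>set (snd l). a < M)"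
  unfolding path_L_def by (cases l) (auto simp: set_n_lists image_iff)

sublocale triangles "path_ok chk" "path_BV r M TT" "path_BE r M TT" "path_L r M" "length (paths r TT)"
proof
  fix b b' assume "(b, b') \<in> set (path_BE r M TT)"
  then obtain \<pi> i where "\<pi> \<in> set (paths r TT)" "i < M" "b = pnode M \<pi> i" "b' = pnode M \<pi> (Suc i)"
    unfolding set_path_BE by blast
  then show "b \<in> set (path_BV r M TT) \<and> b' \<in> set (path_BV r M TT) \<and> b \<noteq> b'"
    unfolding set_path_BV using pnode_inj_path[of \<pi> i "Suc i"] by (metis Suc_leI less_imp_le n_not_Suc_n)
qed

text \<open>A path to the variable \<open>s\<close> is cut only between the positions
  \<open>y s\<close> and \<open>y s + 1\<close>, so there are at most as many cut edges as
  paths.\<close>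

lemma sound:
  assumes y: "\<And>s. y s < M" and chk: "\<And>\<tau>. \<tau> \<in> set TT \<Longrightarrow> chk \<tau> (map y \<tau>)"
  shows "labelable vs ss es (length (paths r TT))"
proof -
  let ?X = "\<lambda>\<tau>. (False, map y \<tau>)" and ?Y = "\<lambda>s. (True, replicate r (y s))"
  define \<psi> where "\<psi> b = (if snd b = [] then ?X (fst b) else if fst b = [] then ?Y (nthd 0 (snd b) 0)
     else let s = nthd 0 (fst b) (nthd 0 (snd b) 0) in
       if (nthd 0 (snd b) 2 \<le> y s) = (nthd 0 (snd b) 1 = 0) then ?X (fst b) else ?Y s)" for b :: bvert
  \<comment> \<open>The end vertices fit the same formula because \<open>0 \<le> y s\<close> and
    \<open>y s < M\<close>.\<close>
  have \<psi>: "\<psi> (pnode M (\<tau>, p, d) i) =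
      (if (i \<le> y (nthd 0 \<tau> p)) = (d = 0) then ?X \<tau> else ?Y (nthd 0 \<tau> p))" if "\<tau> \<noteq> []" "i \<le> M" for \<tau> p d i
    using that y[of "nthd 0 \<tau> p"] M by (auto simp: \<psi>_def pnode_def Let_def)
  show ?thesis
  proof (rule labelable_if_cut[of \<psi>])
    fix b assume "b \<in> set (path_BV r M TT)"
    then obtain \<pi> i where \<pi>: "\<pi> \<in> set (paths r TT)" and i: "i \<le> M" and b: "b = pnode M \<pi> i"
      unfolding set_path_BV by blast
    have X: "?X \<tau> \<in> set (path_L r M)" if "\<tau> \<in> set TT" for \<tau>
      using that len y by (auto simp: set_path_L)
    have Y: "?Y s \<in> set (path_L r M)" for s
      using y by (auto simp: set_path_L)
    from \<pi> show "\<psi> b \<in> set (path_L r M) \<and> path_ok chk b (\<psi> b)"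
    proof (cases rule: path_cases)
      case (1 \<tau> p)
      then have "nthd 0 (map y \<tau>) p = y (\<tau> ! p)" using len[of \<tau>] by (simp add: nthd_nth)
      moreover have "nthd 0 (replicate r a) 0 = a" for a :: nat using r by (simp add: nthd_nth)
      ultimately show ?thesis unfolding b
        using 1 i \<psi>[of \<tau> i p 0] X[of \<tau>] Y chk[of \<tau>] y[of "\<tau> ! p"]
        by (auto simp: path_ok_def pnode_def)
    next
      case (2 \<tau> p)
      then have "nthd 0 (map y \<tau>) p = y (\<tau> ! p)" using len[of \<tau>] by (simp add: nthd_nth)
      moreover have "nthd 0 (replicate r a) 0 = a" for a :: nat using r by (simp add: nthd_nth)
      ultimately show ?thesis unfolding b
        using 2 i \<psi>[of \<tau> i p 1] X[of \<tau>] Y chk[of \<tau>] y[of "\<tau> ! p"]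
        by (auto simp: path_ok_def pnode_def)
    qed
  next
    let ?e = "\<lambda>\<pi>. let i = y (nthd 0 (fst \<pi>) (fst (snd \<pi>))) in {pnode M \<pi> i, pnode M \<pi> (Suc i)}"
    have "cut \<psi> \<subseteq> ?e ` set (paths r TT)"
    proof
      fix E assume "E \<in> cut \<psi>"
      then obtain \<pi> i where E: "\<pi> \<in> set (paths r TT)" "i < M" "E = {pnode M \<pi> i, pnode M \<pi> (Suc i)}"
        "\<psi> (pnode M \<pi> i) \<noteq> \<psi> (pnode M \<pi> (Suc i))"
        unfolding cut_def set_path_BE by blast
      obtain \<tau> p d where \<pi>: "\<pi> = (\<tau>, p, d)" by (cases \<pi>)
      then have "\<tau> \<noteq> []" using E(1) set_paths len[of \<tau>] r by auto
      then have "(i \<le> y (nthd 0 \<tau> p)) \<noteq> (Suc i \<le> y (nthd 0 \<tau> p))"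
        using E(2,4) \<psi>[of \<tau> i p d] \<psi>[of \<tau> "Suc i" p d] unfolding \<pi> by (auto split: if_splits)
      then have "i = y (nthd 0 \<tau> p)" by auto
      then show "E \<in> ?e ` set (paths r TT)" using E(1,3) \<pi> by (intro image_eqI[where x = \<pi>]) (simp_all add: Let_def)
    qed
    then have "card (cut \<psi>) \<le> card (set (paths r TT))"
      by (rule surj_card_le[OF finite_set])
    then show "card (cut \<psi>) \<le> length (paths r TT)" using card_length le_trans by blast
  qed
qed

text \<open>Every path has ends of different kinds and is cut at least once; paths share no edge and
  the budget is their number, so each is cut exactly once. The two cuts between
  \<open>\<tau>\<close> and a variable then give both inequalities between the proposed
  values.\<close>

lemma complete:
  assumes "labelable vs ss es (length (paths r TT))"
  obtains y where "\<And>s. y s < M" "\<And>\<tau>. \<tau> \<in> set TT \<Longrightarrow> chk \<tau> (map y \<tau>)"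
proof -
  obtain \<psi> where L: "\<And>b. b \<in> set (path_BV r M TT) \<Longrightarrow> \<psi> b \<in> set (path_L r M)"
    and ok: "\<And>b. b \<in> set (path_BV r M TT) \<Longrightarrow> path_ok chk b (\<psi> b)"
    and card: "card (cut \<psi>) \<le> length (paths r TT)"
    using cut_if_labelable[OF assms] by metis
  have node: "pnode M \<pi> i \<in> set (path_BV r M TT)" if "\<pi> \<in> set (paths r TT)" "i \<le> M" for \<pi> i
    using that unfolding set_path_BV by blast
  define C where "C = {(\<pi>, i). \<pi> \<in> set (paths r TT) \<and> i < M \<and> \<psi> (pnode M \<pi> i) \<noteq> \<psi> (pnode M \<pi> (Suc i))}"
  have ends: "\<psi> (pnode M \<pi> 0) \<noteq> \<psi> (pnode M \<pi> M)" if \<pi>: "\<pi> \<in> set (paths r TT)" for \<pi>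
    using \<pi>
  proof (cases rule: path_cases)
    case (1 \<tau> p)
    then show ?thesis using ok[OF node[OF \<pi>, of 0]] ok[OF node[OF \<pi>, of M]]
      by (auto simp: pnode_0 pnode_M path_ok_def)
  next
    case (2 \<tau> p)
    then show ?thesis using ok[OF node[OF \<pi>, of 0]] ok[OF node[OF \<pi>, of M]]
      by (auto simp: pnode_0 pnode_M path_ok_def)
  qed
  have const: "\<psi> (pnode M \<pi> i) = \<psi> (pnode M \<pi> j)"
    if "i \<le> j" "\<And>k. i \<le> k \<Longrightarrow> k < j \<Longrightarrow> \<psi> (pnode M \<pi> k) = \<psi> (pnode M \<pi> (Suc k))" for \<pi> i j
    using that by (induction j rule: dec_induct) auto
  have ex: "\<exists>i. (\<pi>, i) \<in> C" if "\<pi> \<in> set (paths r TT)" for \<pi>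
    using ends[OF that] const[of 0 M \<pi>] that unfolding C_def by auto
  have finC: "finite C"
    by (rule finite_subset[of _ "set (paths r TT) \<times> {..<M}"]) (auto simp: C_def)
  have "card C \<le> card (cut \<psi>)"
  proof (rule card_inj_on_le)
    show "inj_on (\<lambda>(\<pi>, i). {pnode M \<pi> i, pnode M \<pi> (Suc i)}) C"
      using edge_inj by (auto simp: inj_on_def C_def)
    show "(\<lambda>(\<pi>, i). {pnode M \<pi> i, pnode M \<pi> (Suc i)}) ` C \<subseteq> cut \<psi>"
    proof (clarsimp simp: C_def cut_def simp del: split_paired_Ex)
      fix \<tau> p d i
      assume "(\<tau>, p, d) \<in> set (paths r TT)" "i < M"
        and ne: "\<psi> (pnode M (\<tau>, p, d) i) \<noteq> \<psi> (pnode M (\<tau>, p, d) (Suc i))"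
      then have "(pnode M (\<tau>, p, d) i, pnode M (\<tau>, p, d) (Suc i)) \<in> set (path_BE r M TT)"
        unfolding set_path_BE by blast
      with ne show "\<exists>b b'. {pnode M (\<tau>, p, d) i, pnode M (\<tau>, p, d) (Suc i)} = {b, b'} \<and>
          (b, b') \<in> set (path_BE r M TT) \<and> \<psi> b \<noteq> \<psi> b'"
        by blast
    qed
  qed (rule finite_cut)
  also have "\<dots> \<le> card (set (paths r TT))" using card card_paths by simp
  \<comment> \<open>\<open>C\<close> is no larger than its projection to paths, so the projection is
    injective: one cut for each path.\<close>
  also have "set (paths r TT) = fst ` C" using ex by (force simp: C_def)
  finally have "card (fst ` C) = card C" using card_image_le[OF finC] by (intro antisym) auto
  then have "inj_on fst C" using finC by (simp add: eq_card_imp_inj_on)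
  then have uniq: "i = j" if "(\<pi>, i) \<in> C" "(\<pi>, j) \<in> C" for \<pi> i j
    using inj_onD[OF \<open>inj_on fst C\<close> _ that] by simp
  have split: "\<exists>c<M. (\<forall>i\<le>c. \<psi> (pnode M \<pi> i) = \<psi> (pnode M \<pi> 0)) \<and>
      (\<forall>i. c < i \<longrightarrow> i \<le> M \<longrightarrow> \<psi> (pnode M \<pi> i) = \<psi> (pnode M \<pi> M))" if \<pi>: "\<pi> \<in> set (paths r TT)" for \<pi>
  proof -
    obtain c where c: "(\<pi>, c) \<in> C" using ex[OF \<pi>] by blast
    have step: "\<psi> (pnode M \<pi> k) = \<psi> (pnode M \<pi> (Suc k))" if "k \<noteq> c" "k < M" for k
      using uniq[OF c, of k] that \<pi> by (auto simp: C_def)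
    have "c < M" using c by (simp add: C_def)
    moreover have "\<psi> (pnode M \<pi> i) = \<psi> (pnode M \<pi> 0)" if "i \<le> c" for i
      using const[of 0 i \<pi>] step \<open>c < M\<close> that by simp
    moreover have "\<psi> (pnode M \<pi> i) = \<psi> (pnode M \<pi> M)" if "c < i" "i \<le> M" for i
      using const[of i M \<pi>] step that by simp
    ultimately show ?thesis by blast
  qed
  \<comment> \<open>Variables that occur in no tuple get the arbitrary value 0.\<close>
  define y where "y s = (if ([], [s]) \<in> set (path_BV r M TT) then snd (\<psi> ([], [s])) ! 0 else 0)" for s
  have y: "y s < M" for s
    using L[of "([], [s])"] M r by (auto simp: y_def set_path_L)
  have "snd (\<psi> (\<tau>, [])) = map y \<tau>" if \<tau>: "\<tau> \<in> set TT" for \<tau>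
  proof (rule nth_equalityI)
    have "(\<tau>, 0, 0) \<in> set (paths r TT)" using \<tau> r by (simp add: set_paths)
    from L[OF node[OF this, of 0]] have len\<tau>: "length (snd (\<psi> (\<tau>, []))) = r"
      and small: "\<forall>a\<in>set (snd (\<psi> (\<tau>, []))). a < M"
      by (auto simp: pnode_0 set_path_L)
    then show "length (snd (\<psi> (\<tau>, []))) = length (map y \<tau>)" using len[OF \<tau>] by simp
    fix p assume "p < length (snd (\<psi> (\<tau>, [])))"
    then have p: "p < r" using len\<tau> by simp
    then have sp: "nthd 0 \<tau> p = \<tau> ! p" using len[OF \<tau>] by (simp add: nthd_nth)
    have ne: "\<tau> \<noteq> []" using p len[OF \<tau>] by auto
    have P0: "(\<tau>, p, 0) \<in> set (paths r TT)" and P1: "(\<tau>, p, 1) \<in> set (paths r TT)"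
      using \<tau> p by (auto simp: set_paths)
    let ?x = "snd (\<psi> (\<tau>, [])) ! p" and ?y = "snd (\<psi> ([], [\<tau> ! p])) ! 0"
    have x: "nthd 0 (snd (\<psi> (\<tau>, []))) p = ?x" using p len\<tau> by (simp add: nthd_nth)
    have Y: "([], [\<tau> ! p]) \<in> set (path_BV r M TT)" using node[OF P0, of M] sp by (simp add: pnode_M)
    from L[OF Y] have yl: "length (snd (\<psi> ([], [\<tau> ! p]))) = r" "?y < M" using r by (auto simp: set_path_L)
    then have yn: "nthd 0 (snd (\<psi> ([], [\<tau> ! p]))) 0 = ?y" using r by (simp add: nthd_nth)
    have types: "\<not> fst (\<psi> (\<tau>, []))" "fst (\<psi> ([], [\<tau> ! p]))"
      using ok[OF node[OF P0, of 0]] ok[OF Y] by (auto simp: pnode_0 path_ok_def)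
    have "?y \<le> ?x"
    proof -
      obtain c where c: "c < M" "\<And>i. i \<le> c \<Longrightarrow> \<psi> (pnode M (\<tau>, p, 0) i) = \<psi> (\<tau>, [])"
        "\<And>i. c < i \<Longrightarrow> i \<le> M \<Longrightarrow> \<psi> (pnode M (\<tau>, p, 0) i) = \<psi> ([], [\<tau> ! p])"
        using split[OF P0] by (auto simp: pnode_0 pnode_M sp)
      have "c \<le> ?x"
      \<comment> \<open>Position 0 is an end vertex without a bound of its own; there the inequality
        is trivial.\<close>
      proof (cases "c = 0")
        case False
        then show ?thesis
          using ok[OF node[OF P0, of c]] c(1) c(2)[of c] types x ne by (simp add: pnode_inner path_ok_def)
      qed simp
      moreover have "?y \<le> c"
      \<comment> \<open>Position \<open>M\<close> is an end vertex too; there the domain bound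
        \<open>?y < M\<close> replaces the unary constraint.\<close>
      proof (cases "Suc c = M")
        case False
        then show ?thesis
          using ok[OF node[OF P0, of "Suc c"]] c(1) c(3)[of "Suc c"] types yn ne by (simp add: pnode_inner path_ok_def)
      qed (use yl in auto)
      ultimately show ?thesis by simp
    qed
    moreover have "?x \<le> ?y"
    proof -
      obtain c where c: "c < M" "\<And>i. i \<le> c \<Longrightarrow> \<psi> (pnode M (\<tau>, p, 1) i) = \<psi> ([], [\<tau> ! p])"
        "\<And>i. c < i \<Longrightarrow> i \<le> M \<Longrightarrow> \<psi> (pnode M (\<tau>, p, 1) i) = \<psi> (\<tau>, [])"
        using split[OF P1] by (auto simp: pnode_0 pnode_M sp)
      have "c \<le> ?y"
      proof (cases "c = 0")
        case False
        then show ?thesis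
          using ok[OF node[OF P1, of c]] c(1) c(2)[of c] types yn ne by (simp add: pnode_inner path_ok_def)
      qed simp
      moreover have "?x \<le> c"
      proof (cases "Suc c = M")
        case False
        then show ?thesis
          using ok[OF node[OF P1, of "Suc c"]] c(1) c(3)[of "Suc c"] types x ne by (simp add: pnode_inner path_ok_def)
      next
        case True
        then show ?thesis using small p len\<tau> by (metis less_Suc_eq_le nth_mem)
      qed
      ultimately show ?thesis by simp
    qed
    ultimately show "?x = map y \<tau> ! p" using Y p len[OF \<tau>] by (simp add: y_def)
  qed
  moreover have "chk \<tau> (snd (\<psi> (\<tau>, [])))" if \<tau>: "\<tau> \<in> set TT" for \<tau>
  proof -
    have "(\<tau>, 0, 0) \<in> set (paths r TT)" using \<tau> r by (simp add: set_paths)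
    from ok[OF node[OF this, of 0]] show ?thesis by (simp add: pnode_0 path_ok_def)
  qed
  ultimately show thesis using that[of y] y by metis
qed

theorem csp_eulc_iff:
  "(csp_eulc r M TT chk, length (paths r TT)) \<in> edge_unique_label_cover \<longleftrightarrow>
     (\<exists>y. (\<forall>s. y s < M) \<and> (\<forall>\<tau>\<in>set TT. chk \<tau> (map y \<tau>)))"
  "(csp_eulc r M TT chk, length (paths r TT)) \<in> restricted_edge_unique_label_cover \<longleftrightarrow>
     (\<exists>y. (\<forall>s. y s < M) \<and> (\<forall>\<tau>\<in>set TT. chk \<tau> (map y \<tau>)))"
  unfolding csp_eulc_def eulc_input_iff using sound complete by metis+

end

section \<open>Evaluating circuits on partially known inputs\<close>

text \<open>Unlike in \<open>output_label\<close>, the step sees the whole list of earlier labels,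
  so that a rule can consult guessed nodes and knows its own node number as
  \<open>length vs\<close>.\<close>

definition run :: "('a list \<Rightarrow> gate \<Rightarrow> 'a) \<Rightarrow> 'a list \<Rightarrow> gate list \<Rightarrow> 'a list" where
  "run step xs gs = foldl (\<lambda>vs g. vs @ [step vs g]) xs gs"

lemma run_Nil [simp]: "run step xs [] = xs"
  and run_snoc [simp]: "run step xs (gs @ [g]) = run step xs gs @ [step (run step xs gs) g]"
  by (simp_all add: run_def)

lemma length_run [simp]: "length (run step xs gs) = length xs + length gs"
  by (induction gs rule: rev_induct) simp_all

lemma run_input: "i < length xs \<Longrightarrow> run step xs gs ! i = xs ! i"
  by (induction gs rule: rev_induct) (simp_all add: nth_append)

lemma run_gate:
  "i < length gs \<Longrightarrow>
   run step xs gs ! (length xs + i) = step (take (length xs + i) (run step xs gs)) (gs ! i)"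
proof (induction gs rule: rev_induct)
  case (snoc g gs)
  then show ?case by (cases "i = length gs") (auto simp: nth_append)
qed simp

lemma output_label_run: "output_label h xs gs = last (run (\<lambda>vs g. h g (map (\<lambda>j. vs ! j) (fanin g))) xs gs)"
  by (simp add: output_label_def run_def)

text \<open>
  The labels are 0 (false), 1 (true), 2 (not determined by the known inputs) and 3 (a refuted guess,
  which takes precedence over 2). Input node \<open>a\<close> has the number \<open>a + 1\<close>. \<open>Z\<close> lists some of the
  pairs \<open>(i, y i)\<close>, where \<open>y 1 < \<dots> < y k\<close> are the true inputs, framed by \<open>y 0 = 0\<close> and
  \<open>y (k + 1) = n + 1\<close>, so that an input is known to be false when it lies strictly between two
  consecutive values. For \<open>c < q\<close>, \<open>y (k + 2 + c)\<close> is a large gate and \<open>y (k + 2 + q + c)\<close> the guess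
  for it: either an in-neighbour that determines its value, or the number \<open>N\<close> of all nodes if there
  is none.
\<close>

definition ilab :: "nat \<Rightarrow> (nat \<times> nat) list \<Rightarrow> nat \<Rightarrow> nat" where
  "ilab k Z a =
    (if \<exists>z\<in>set Z. fst z \<le> Suc k \<and> snd z = Suc a then 1
     else if \<exists>z\<in>set Z. \<exists>z'\<in>set Z. fst z' = Suc (fst z) \<and> fst z' \<le> Suc k \<and> snd z < Suc a \<and> Suc a < snd z'
     then 0 else 2)"

definition guesses :: "nat \<Rightarrow> nat \<Rightarrow> (nat \<times> nat) list \<Rightarrow> nat \<Rightarrow> nat list" where
  "guesses k q Z v = concat (map (\<lambda>z. concat (map (\<lambda>z'.
     if Suc (Suc k) \<le> fst z \<and> fst z' = fst z + q \<and> snd z = v then [snd z'] else []) Z)) Z)"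

text \<open>The controlling value of a conjunction or disjunction: one in-neighbour carrying it
  fixes the gate.\<close>

definition determining :: "gate \<Rightarrow> nat" where
  "determining g = (if kind g = 1 then 0 else 1)"

definition small_label :: "gate \<Rightarrow> nat list \<Rightarrow> nat" where
  "small_label g ls =
    (if 3 \<in> set ls then 3 else if 2 \<in> set ls then 2
     else if kind g = 0 then (if 1 \<in> set ls then 0 else 1)
     else if kind g = 1 then (if 0 \<in> set ls then 0 else 1)
     else (if 1 \<in> set ls then 1 else 0))"

text \<open>\<open>W\<close> collects the guesses of all slots that name this gate. Only a known
  label can speak against a guess; an in-neighbour labelled 2 never does. A large gate therefore
  gets a definite value or 3, but never 2.\<close>

definition large_label :: "nat \<Rightarrow> nat list \<Rightarrow> nat list \<Rightarrow> gate \<Rightarrow> nat" where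
  "large_label N W vs g =
    (if W = [] then 3
     else if N \<in> set W then
       (if \<exists>j\<in>set (fanin g). nthd 0 vs j = determining g then 3 else 1 - determining g)
     else if \<forall>w\<in>set W. w \<in> set (fanin g) \<and> (nthd 0 vs w = determining g \<or> nthd 0 vs w = 2)
       then determining g else 3)"

definition label_step :: "nat \<Rightarrow> nat \<Rightarrow> nat \<Rightarrow> (nat \<times> nat) list \<Rightarrow> nat list \<Rightarrow> gate \<Rightarrow> nat" where
  "label_step N k q Z vs g =
    (if 2 < length (fanin g) then large_label N (guesses k q Z (length vs)) vs g
     else small_label g (map (\<lambda>j. nthd 0 vs j) (fanin g)))"

definition order_ok :: "nat \<Rightarrow> nat \<Rightarrow> (nat \<times> nat) list \<Rightarrow> bool" where
  "order_ok n k Z \<longleftrightarrow> (\<forall>z\<in>set Z. (fst z = 0 \<longrightarrow> snd z = 0) \<and> (fst z = Suc k \<longrightarrow> snd z = Suc n) \<and>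
     (\<forall>z'\<in>set Z. fst z' = Suc (fst z) \<and> fst z' \<le> Suc k \<longrightarrow> snd z < snd z'))"

text \<open>An unknown output is accepted, since a partial view may reject only on evidence. The
  form \<open>set [1, 2]\<close> is the one covered by \<open>pt_mem\<close>.\<close>

definition Z_ok :: "circuit \<Rightarrow> nat \<Rightarrow> nat \<Rightarrow> (nat \<times> nat) list \<Rightarrow> bool" where
  "Z_ok C k q Z \<longleftrightarrow> order_ok (fst C) k Z \<and>
     nthd 0 (run (label_step (fst C + length (snd C)) k q Z) (map (\<lambda>a. ilab k Z a) [0..<fst C]) (snd C))
       (fst C + length (snd C) - 1) \<in> set [1, 2]"

definition wcs_chk :: "circuit \<Rightarrow> nat \<Rightarrow> nat \<Rightarrow> nat list \<Rightarrow> nat list \<Rightarrow> bool" where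
  "wcs_chk C k q \<tau> x \<longleftrightarrow> Z_ok C k q (map (\<lambda>p. (nthd 0 \<tau> p, nthd 0 x p)) [0..<length \<tau>])"

text \<open>Every tuple contains all guess variables, since large gates are labelled from them;
  \<open>2 * q\<close> positions are enough to settle any \<open>q\<close> inputs.\<close>

definition wcs_tuples :: "nat \<Rightarrow> nat \<Rightarrow> nat list list" where
  "wcs_tuples k q = map (\<lambda>gl. [Suc (Suc k)..<Suc (Suc k) + 2 * q] @ gl) (List.n_lists (2 * q) [0..<Suc (Suc k)])"

abbreviation bit :: "bool \<Rightarrow> nat" where "bit b \<equiv> (if b then 1 else 0)"

lemma small_label_exact:
  assumes "\<And>j. j \<in> set (fanin g) \<Longrightarrow> l j = bit (b j)"
  shows "small_label g (map l (fanin g)) = bit (gate_value g (map b (fanin g)))"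
proof -
  have "map l (fanin g) = map (\<lambda>j. bit (b j)) (fanin g)" using assms by simp
  then show ?thesis by (cases g) (auto simp: small_label_def image_iff)
qed

lemma small_label_sound:
  assumes "\<And>j. j \<in> set (fanin g) \<Longrightarrow> l j = bit (b j) \<or> l j = 2"
  shows "small_label g (map l (fanin g)) = bit (gate_value g (map b (fanin g))) \<or>
    small_label g (map l (fanin g)) = 2"
proof (cases "\<exists>j\<in>set (fanin g). l j = 2")
  case True
  moreover have "3 \<notin> set (map l (fanin g))"
  proof
    assume "3 \<in> set (map l (fanin g))"
    then obtain j where "j \<in> set (fanin g)" "l j = 3" by auto
    with assms[of j] show False by (simp split: if_splits)
  qed
  ultimately show ?thesis by (force simp: small_label_def)
next
  case False
  then show ?thesis using small_label_exact[of g l b] assms by blast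
qed

lemma small_label_refuted: "3 \<in> set ls \<Longrightarrow> small_label g ls = 3"
  by (simp add: small_label_def)

lemma gate_value_determined:
  assumes "kind g \<noteq> 0"
  shows "bit (gate_value g (map b (fanin g))) =
    (if \<exists>j\<in>set (fanin g). bit (b j) = determining g then determining g else 1 - determining g)"
  using assms by (cases g) (auto simp: determining_def)

text \<open>Constraints have fixed arity, so smaller sets of revealed positions are padded by
  repetition.\<close>

lemma padded_list:
  assumes "finite A" "A \<noteq> {}" "card A \<le> m"
  shows "\<exists>xs. length xs = m \<and> set xs = A"
proof -
  obtain ys where ys: "set ys = A" "distinct ys" using finite_distinct_list[OF assms(1)] by blast
  then have "length ys \<le> m" "ys \<noteq> []" using assms distinct_card[of ys] by auto
  with ys show ?thesis
    by (intro exI[of _ "ys @ replicate (m - length ys) (hd ys)"]) (auto simp: set_replicate_conv_if)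
qed

lemma count_list_True: "count_list (map P [0..<n]) True = card {a. a < n \<and> P a}"
proof (induction n)
  case (Suc n)
  have "{a. a < Suc n \<and> P a} = (if P n then insert n {a. a < n \<and> P a} else {a. a < n \<and> P a})"
    by (auto simp: less_Suc_eq)
  with Suc show ?case by simp
qed simp

locale circuit =
  fixes n :: nat and gs :: "gate list"
  assumes wf: "wf_circuit (n, gs)"
begin

abbreviation "N \<equiv> n + length gs"
abbreviation "gat v \<equiv> gs ! (v - n)"
abbreviation "ins v \<equiv> set (fanin (gs ! (v - n)))"
definition "out = N - 1"
definition "large v \<longleftrightarrow> n \<le> v \<and> v < N \<and> 2 < length (fanin (gat v))"

lemma wf_gate:
  assumes "n \<le> v" "v < N"
  shows "fanin (gat v) \<noteq> []" "j \<in> ins v \<Longrightarrow> j < v"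
proof -
  have "v - n < length gs" using assms by auto
  then show "fanin (gat v) \<noteq> []" "j \<in> ins v \<Longrightarrow> j < v"
    using wf assms(1) unfolding wf_circuit_def by force+
qed

lemma N_pos: "0 < N"
  using wf by (auto simp: wf_circuit_def)

lemma out_less: "out < N"
  using N_pos by (simp add: out_def)

lemma node_induct [consumes 1, case_names input gate]:
  assumes "v < N" "\<And>v. v < n \<Longrightarrow> P v"
    "\<And>v. n \<le> v \<Longrightarrow> v < N \<Longrightarrow> (\<And>j. j \<in> ins v \<Longrightarrow> j < v) \<Longrightarrow> (\<And>j. j \<in> ins v \<Longrightarrow> P j) \<Longrightarrow> P v"
  shows "P v"
  using assms(1)
proof (induction v rule: less_induct)
  case (less v)
  show ?case
  proof (cases "v < n")
    case False
    then show ?thesis using less assms(3)[of v] wf_gate(2)[of v] by (meson leI less_trans)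
  qed (rule assms(2))
qed

lemma run_node:
  assumes "length xs = n" "n \<le> v" "v < N"
  shows "run (\<lambda>vs g. h g (map (\<lambda>j. vs ! j) (fanin g))) xs gs ! v =
    h (gat v) (map (\<lambda>j. run (\<lambda>vs g. h g (map (\<lambda>j. vs ! j) (fanin g))) xs gs ! j) (fanin (gat v)))"
proof -
  have "v = length xs + (v - n)" "v - n < length gs" using assms by auto
  from run_gate[OF this(2), of "\<lambda>vs g. h g (map (\<lambda>j. vs ! j) (fanin g))" xs] this(1)
  have "run (\<lambda>vs g. h g (map (\<lambda>j. vs ! j) (fanin g))) xs gs ! v =
    h (gat v) (map (\<lambda>j. take v (run (\<lambda>vs g. h g (map (\<lambda>j. vs ! j) (fanin g))) xs gs) ! j) (fanin (gat v)))"
    by simp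
  also have "map (\<lambda>j. take v (run (\<lambda>vs g. h g (map (\<lambda>j. vs ! j) (fanin g))) xs gs) ! j) (fanin (gat v)) =
     map (\<lambda>j. run (\<lambda>vs g. h g (map (\<lambda>j. vs ! j) (fanin g))) xs gs ! j) (fanin (gat v))"
    using wf_gate(2)[OF assms(2,3)] by (intro map_cong) auto
  finally show ?thesis .
qed

lemma run_out: "length xs = n \<Longrightarrow> last (run step xs gs) = run step xs gs ! out"
  using N_pos by (subst last_conv_nth) (auto simp: out_def simp flip: length_greater_0_conv)

section \<open>Values, depth, weft and leaves of the nodes of a circuit\<close>

definition val :: "bool list \<Rightarrow> nat \<Rightarrow> bool" where
  "val xs v = run (\<lambda>vs g. gate_value g (map (\<lambda>j. vs ! j) (fanin g))) xs gs ! v"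

definition dep :: "nat \<Rightarrow> nat" where
  "dep v = run (\<lambda>vs g. Suc (Max (set (map (\<lambda>j. vs ! j) (fanin g))))) (replicate n 0) gs ! v"

definition wft :: "nat \<Rightarrow> nat" where
  "wft v = run (\<lambda>vs g. (if length (fanin g) > 2 then 1 else 0) + Max (set (map (\<lambda>j. vs ! j) (fanin g))))
     (replicate n 0) gs ! v"

text \<open>The inputs and large gates on which \<open>v\<close> depends through small gates only; a
  large gate is its own leaf. The filter \<open>j < v\<close> makes the recursion terminate.\<close>

fun lvs :: "nat \<Rightarrow> nat set" where
  "lvs v = (if n \<le> v \<and> v < N \<and> \<not> large v then (\<Union>j\<in>{j \<in> ins v. j < v}. lvs j) else {v})"

declare lvs.simps [simp del]

lemma val_input: "length xs = n \<Longrightarrow> v < n \<Longrightarrow> val xs v = xs ! v"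
  by (simp add: val_def run_input)

lemma val_gate: "length xs = n \<Longrightarrow> n \<le> v \<Longrightarrow> v < N \<Longrightarrow>
    val xs v = gate_value (gat v) (map (val xs) (fanin (gat v)))"
  unfolding val_def by (rule run_node)

lemma circuit_value_val: "length xs = n \<Longrightarrow> circuit_value (n, gs) xs = val xs out"
  by (simp add: circuit_value_def output_label_run run_out val_def)

lemma dep_gate: "n \<le> v \<Longrightarrow> v < N \<Longrightarrow> dep v = Suc (Max (dep ` ins v))"
  unfolding dep_def using run_node[of "replicate n 0" v "\<lambda>g ds. Suc (Max (set ds))"] by simp

lemma circuit_depth_dep: "circuit_depth (n, gs) = dep out"
  by (simp add: circuit_depth_def output_label_run run_out dep_def)

lemma wft_gate: "n \<le> v \<Longrightarrow> v < N \<Longrightarrow> wft v = (if large v then 1 else 0) + Max (wft ` ins v)"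
  unfolding wft_def large_def
  using run_node[of "replicate n 0" v "\<lambda>g ws. (if length (fanin g) > 2 then 1 else 0) + Max (set ws)"] by simp

lemma circuit_weft_wft: "circuit_weft (n, gs) = wft out"
  by (simp add: circuit_weft_def output_label_run run_out wft_def)

lemma dep_child: "n \<le> v \<Longrightarrow> v < N \<Longrightarrow> j \<in> ins v \<Longrightarrow> dep j < dep v"
  by (simp add: dep_gate less_Suc_eq_le)

lemma wft_child: "n \<le> v \<Longrightarrow> v < N \<Longrightarrow> j \<in> ins v \<Longrightarrow> (if large v then 1 else 0) + wft j \<le> wft v"
  by (simp add: wft_gate)

lemma lvs_input: "v < n \<Longrightarrow> lvs v = {v}"
  by (simp add: lvs.simps)

lemma lvs_large: "large v \<Longrightarrow> lvs v = {v}"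
  by (simp add: lvs.simps)

lemma lvs_small: assumes "n \<le> v" "v < N" "\<not> large v" shows "lvs v = (\<Union>j\<in>ins v. lvs j)"
proof -
  have "{j \<in> ins v. j < v} = ins v" using wf_gate(2)[OF assms(1,2)] by auto
  with assms show ?thesis by (subst lvs.simps) simp
qed

text \<open>A small gate has at most two in-neighbours, of smaller depth, so the count at most
  doubles with each level.\<close>

lemma lvs_card: assumes "v < N" shows "finite (lvs v) \<and> card (lvs v) \<le> 2 ^ dep v"
  using assms
proof (induction v rule: node_induct)
  case (input v)
  then show ?case by (simp add: lvs_input)
next
  case (gate v)
  show ?case
  proof (cases "large v")
    case True
    then show ?thesis by (simp add: lvs_large)
  next
    case False
    have fin: "finite (lvs j)" if "j \<in> ins v" for j using gate(4)[OF that] by simp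
    have "card (lvs v) \<le> (\<Sum>j\<in>ins v. card (lvs j))"
      unfolding lvs_small[OF gate(1,2) False] by (rule card_UN_le) simp
    also have "\<dots> \<le> (\<Sum>j\<in>ins v. 2 ^ (dep v - 1))"
    proof (rule sum_mono)
      fix j assume j: "j \<in> ins v"
      have "card (lvs j) \<le> 2 ^ dep j" using gate(4)[OF j] by simp
      also have "\<dots> \<le> 2 ^ (dep v - 1)" using dep_child[OF gate(1,2) j] by (intro power_increasing) auto
      finally show "card (lvs j) \<le> 2 ^ (dep v - 1)" .
    qed
    also have "\<dots> = card (ins v) * 2 ^ (dep v - 1)" by simp
    also have "\<dots> \<le> 2 * 2 ^ (dep v - 1)"
    proof (rule mult_le_mono1)
      show "card (ins v) \<le> 2" using False gate(1,2) card_length[of "fanin (gat v)"] by (auto simp: large_def)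
    qed
    also have "\<dots> = 2 ^ dep v" using dep_gate[OF gate(1,2)] by simp
    finally show ?thesis using fin lvs_small[OF gate(1,2) False] by simp
  qed
qed

text \<open>Neither weft nor depth increases towards the leaves. This limits what lies below a large
  leaf of the output.\<close>

lemma lvs_below:
  assumes "v < N" shows "\<forall>u\<in>lvs v. (u < n \<or> large u) \<and> (large u \<longrightarrow> wft u \<le> wft v \<and> dep u \<le> dep v)"
  using assms
proof (induction v rule: node_induct)
  case (input v)
  then show ?case by (simp add: lvs_input large_def)
next
  case (gate v)
  show ?case
  proof (cases "large v")
    case True
    then show ?thesis by (simp add: lvs_large)
  next
    case False
    then show ?thesis
      using gate(4) wft_child[OF gate(1,2)] dep_child[OF gate(1,2)]
      unfolding lvs_small[OF gate(1,2) False] by (fastforce intro: le_trans less_imp_le)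
  qed
qed

lemma wft_large: "large u \<Longrightarrow> 0 < wft u"
  using wft_gate[of u] by (simp add: large_def)

lemma wft_0_lvs: "v < N \<Longrightarrow> wft v = 0 \<Longrightarrow> u \<in> lvs v \<Longrightarrow> u < n"
  using lvs_below[of v] wft_large[of u] by fastforce

end

section \<open>Weft-1 circuits as constraint satisfaction\<close>

locale guessed_circuit = circuit +
  fixes k q :: nat and y :: "nat \<Rightarrow> nat"
begin

definition valid :: bool where
  "valid \<longleftrightarrow> y 0 = 0 \<and> y (Suc k) = Suc n \<and> (\<forall>i\<le>k. y i < y (Suc i))"

definition inputs :: "bool list" where
  "inputs = map (\<lambda>a. Suc a \<in> y ` {1..k}) [0..<n]"

text \<open>\<open>D\<close> is the set of revealed indices. The guesses are always revealed, so
  tuples differ only in the positions they reveal.\<close>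

definition shown :: "nat set \<Rightarrow> (nat \<times> nat) list \<Rightarrow> bool" where
  "shown D Z \<longleftrightarrow> set Z = (\<lambda>i. (i, y i)) ` D \<and>
     {Suc (Suc k)..<Suc (Suc k) + 2 * q} \<subseteq> D \<and> D \<subseteq> {..<Suc (Suc k) + 2 * q}"

definition lab :: "(nat \<times> nat) list \<Rightarrow> nat \<Rightarrow> nat" where
  "lab Z v = run (label_step N k q Z) (map (\<lambda>a. ilab k Z a) [0..<n]) gs ! v"

definition guess :: "nat \<Rightarrow> nat set" where
  "guess v = {y (i + q) | i. Suc (Suc k) \<le> i \<and> i < Suc (Suc k) + q \<and> y i = v}"

lemma length_inputs [simp]: "length inputs = n"
  by (simp add: inputs_def)

section \<open>The assignment described by the positions, and what a partial view tells about
  it\<close>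

lemma y_mono: assumes valid "i < j" "j \<le> Suc k" shows "y i < y j"
  using assms(2,3)
proof (induction j)
  case (Suc j)
  have "y j < y (Suc j)" using assms(1) Suc.prems by (simp add: valid_def)
  then show ?case using Suc by (cases "i = j") auto
qed simp

lemma y_inj: assumes valid "i \<le> Suc k" "j \<le> Suc k" "y i = y j" shows "i = j"
  using y_mono[OF assms(1), of i j] y_mono[OF assms(1), of j i] assms(2-4) by (cases i j rule: linorder_cases) auto

lemma inputs_nth: "a < n \<Longrightarrow> inputs ! a \<longleftrightarrow> (\<exists>i. 1 \<le> i \<and> i \<le> k \<and> y i = Suc a)"
  by (simp add: inputs_def image_iff Bex_def conj_assoc eq_commute[of "Suc a"])

lemma count_inputs: assumes valid shows "count_list inputs True = k"
proof -
  have "Suc ` {a. a < n \<and> Suc a \<in> y ` {1..k}} = y ` {1..k}"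
  proof (intro equalityI subsetI)
    fix b assume b: "b \<in> y ` {1..k}"
    then obtain i where i: "1 \<le> i" "i \<le> k" "b = y i" by auto
    have "0 < y i" "y i < Suc n"
      using y_mono[OF assms, of 0 i] y_mono[OF assms, of i "Suc k"] i assms by (auto simp: valid_def)
    then show "b \<in> Suc ` {a. a < n \<and> Suc a \<in> y ` {1..k}}"
      using b i by (intro image_eqI[where x = "b - 1"]) auto
  qed auto
  then have "card {a. a < n \<and> Suc a \<in> y ` {1..k}} = card (y ` {1..k})"
    by (metis card_image inj_Suc)
  also have "\<dots> = card {1..k}"
    by (intro card_image inj_onI) (use y_inj[OF assms] in auto)
  finally show ?thesis by (simp add: inputs_def count_list_True)
qed

lemma ilab_sound:
  assumes valid "shown D Z" "a < n"
  shows "ilab k Z a = bit (inputs ! a) \<or> ilab k Z a = 2"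
proof -
  have Z: "set Z = (\<lambda>i. (i, y i)) ` D" using assms(2) by (simp add: shown_def)
  consider (T) "\<exists>z\<in>set Z. fst z \<le> Suc k \<and> snd z = Suc a"
    | (F) "\<not> (\<exists>z\<in>set Z. fst z \<le> Suc k \<and> snd z = Suc a)"
      "\<exists>z\<in>set Z. \<exists>z'\<in>set Z. fst z' = Suc (fst z) \<and> fst z' \<le> Suc k \<and> snd z < Suc a \<and> Suc a < snd z'"
    | (U) "ilab k Z a = 2"
    unfolding ilab_def by metis
  then show ?thesis
  proof cases
    case T
    then obtain i where i: "i \<le> Suc k" "y i = Suc a" using Z by auto
    \<comment> \<open>The frame values 0 and \<open>n + 1\<close> are not numbers of inputs, so the
      match is a genuine position.\<close>
    have "i \<noteq> 0" "i \<noteq> Suc k" using i(2) assms(1,3) by (auto simp: valid_def intro: ccontr)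
    then have "inputs ! a" using i assms(3) by (auto simp: inputs_nth intro!: exI[of _ i])
    then show ?thesis using T by (simp add: ilab_def)
  next
    case F
    then obtain i where i: "Suc i \<le> Suc k" "y i < Suc a" "Suc a < y (Suc i)" using Z by auto
    have "\<not> inputs ! a"
    proof
      assume "inputs ! a"
      then obtain j where j: "j \<le> k" "y j = Suc a" using assms(3) by (auto simp: inputs_nth)
      then have "\<not> j \<le> i" "\<not> Suc i \<le> j"
        using i y_mono[OF assms(1), of j i] y_mono[OF assms(1), of "Suc i" j] by (auto simp: le_less)
      then show False by simp
    qed
    then show ?thesis using F by (simp add: ilab_def)
  qed simp
qed

lemma gap_exists: assumes valid "a < n" shows "\<exists>i\<le>k. y i \<le> Suc a \<and> Suc a < y (Suc i)"
proof -
  define j where "j = (LEAST j. Suc a < y j)"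
  have ex: "Suc a < y (Suc k)" using assms by (simp add: valid_def)
  have "Suc a < y j" "j \<le> Suc k" unfolding j_def using LeastI[of "\<lambda>j. Suc a < y j", OF ex] Least_le[of "\<lambda>j. Suc a < y j", OF ex] by auto
  moreover from this obtain i where i: "j = Suc i" using assms(1) by (cases j) (auto simp: valid_def)
  moreover have "\<not> Suc a < y i" using not_less_Least[of i "\<lambda>j. Suc a < y j"] i j_def by auto
  ultimately show ?thesis by (intro exI[of _ i]) auto
qed

definition gap :: "nat \<Rightarrow> nat" where
  "gap a = (SOME i. i \<le> k \<and> y i \<le> Suc a \<and> Suc a < y (Suc i))"

lemma gap: assumes valid "a < n" shows "gap a \<le> k" "y (gap a) \<le> Suc a" "Suc a < y (Suc (gap a))"
  using someI_ex[OF gap_exists[OF assms]] unfolding gap_def by auto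

text \<open>Input \<open>a\<close> either is the position \<open>y (gap a)\<close> or lies strictly
  between it and the next one, so two revealed indices settle it.\<close>

lemma ilab_exact:
  assumes valid "shown D Z" "a < n" "{gap a, Suc (gap a)} \<subseteq> D"
  shows "ilab k Z a = bit (inputs ! a)"
proof -
  have Z: "(gap a, y (gap a)) \<in> set Z" "(Suc (gap a), y (Suc (gap a))) \<in> set Z"
    using assms(2,4) by (auto simp: shown_def)
  have "ilab k Z a \<noteq> 2"
  proof (cases "y (gap a) = Suc a")
    case True
    then have "\<exists>z\<in>set Z. fst z \<le> Suc k \<and> snd z = Suc a"
      using Z gap(1)[OF assms(1,3)] by (intro bexI[OF _ Z(1)]) simp
    then show ?thesis by (simp add: ilab_def)
  next
    case False
    then have "\<exists>z\<in>set Z. \<exists>z'\<in>set Z. fst z' = Suc (fst z) \<and> fst z' \<le> Suc k \<and> snd z < Suc a \<and> Suc a < snd z'"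
      using gap[OF assms(1,3)] by (intro bexI[OF _ Z(1)] bexI[OF _ Z(2)]) simp
    then show ?thesis by (simp add: ilab_def)
  qed
  then show ?thesis using ilab_sound[OF assms(1-3)] by blast
qed

lemma set_guesses: assumes "shown D Z" shows "set (guesses k q Z v) = guess v"
proof -
  have "set (guesses k q Z v) = {snd z' | z z'. z \<in> set Z \<and> z' \<in> set Z \<and>
      Suc (Suc k) \<le> fst z \<and> fst z' = fst z + q \<and> snd z = v}"
    by (auto simp: guesses_def) force
  also have "\<dots> = {y (i + q) | i. i \<in> D \<and> i + q \<in> D \<and> Suc (Suc k) \<le> i \<and> y i = v}"
    using assms by (auto simp: shown_def)
  also have "\<dots> = guess v"
  proof -
    \<comment> \<open>An index \<open>i + q\<close> below \<open>k + 2 + 2 * q\<close> means that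
      \<open>i\<close> is one of the \<open>q\<close> gate slots.\<close>
    have "i \<in> D \<and> i + q \<in> D \<and> Suc (Suc k) \<le> i \<longleftrightarrow> Suc (Suc k) \<le> i \<and> i < Suc (Suc k) + q" for i
      using assms unfolding shown_def by (auto simp: subset_iff)
    then show ?thesis unfolding guess_def by (metis (lifting))
  qed
  finally show ?thesis .
qed

section \<open>Node labels computed from a partial view\<close>

lemma lab_input: "v < n \<Longrightarrow> lab Z v = ilab k Z v"
  by (simp add: lab_def run_input)

lemma lab_gate:
  assumes "n \<le> v" "v < N"
  shows "\<exists>vs. length vs = v \<and> (\<forall>j<v. nthd 0 vs j = lab Z j) \<and> lab Z v = label_step N k q Z vs (gat v)"
proof -
  let ?xs = "map (\<lambda>a. ilab k Z a) [0..<n]"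
  let ?vs = "take v (run (label_step N k q Z) ?xs gs)"
  have "v - n < length gs" "v = length ?xs + (v - n)" using assms by auto
  then have "lab Z v = label_step N k q Z ?vs (gat v)"
    unfolding lab_def using run_gate[of "v - n" gs "label_step N k q Z" ?xs] by simp
  moreover have "length ?vs = v" using assms by simp
  moreover have "nthd 0 ?vs j = lab Z j" if "j < v" for j
    using that calculation(2) by (simp add: nthd_nth lab_def)
  ultimately show ?thesis by blast
qed

lemma lab_small:
  assumes "n \<le> v" "v < N" "\<not> large v"
  shows "lab Z v = small_label (gat v) (map (lab Z) (fanin (gat v)))"
proof -
  obtain vs where vs: "\<And>j. j < v \<Longrightarrow> nthd 0 vs j = lab Z j" "lab Z v = label_step N k q Z vs (gat v)"
    using lab_gate[OF assms(1,2)] by blast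
  have "map (\<lambda>j. nthd 0 vs j) (fanin (gat v)) = map (lab Z) (fanin (gat v))"
    using vs(1) wf_gate(2)[OF assms(1,2)] by (intro map_cong) auto
  then show ?thesis using vs(2) assms by (simp add: label_step_def large_def cong: map_cong)
qed

lemma lab_large:
  assumes "large v" "shown D Z"
  shows "lab Z v =
    (if guess v = {} then 3
     else if N \<in> guess v then
       (if \<exists>j\<in>ins v. lab Z j = determining (gat v) then 3 else 1 - determining (gat v))
     else if \<forall>w\<in>guess v. w \<in> ins v \<and> (lab Z w = determining (gat v) \<or> lab Z w = 2)
       then determining (gat v) else 3)"
proof -
  have v: "n \<le> v" "v < N" using assms(1) by (auto simp: large_def)
  obtain vs where vs: "length vs = v" "\<And>j. j < v \<Longrightarrow> nthd 0 vs j = lab Z j"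
    "lab Z v = label_step N k q Z vs (gat v)"
    using lab_gate[OF v] by blast
  have ins: "nthd 0 vs j = lab Z j" if "j \<in> ins v" for j
    using vs(2) wf_gate(2)[OF v] that by blast
  have W: "set (guesses k q Z v) = guess v" using assms(2) by (rule set_guesses)
  then have "guesses k q Z v = [] \<longleftrightarrow> guess v = {}" by auto
  moreover have "(\<exists>j\<in>ins v. nthd 0 vs j = c) \<longleftrightarrow> (\<exists>j\<in>ins v. lab Z j = c)" for c
    using ins by auto
  moreover have "(\<forall>w\<in>guess v. w \<in> ins v \<and> (nthd 0 vs w = c \<or> nthd 0 vs w = 2)) \<longleftrightarrow>
      (\<forall>w\<in>guess v. w \<in> ins v \<and> (lab Z w = c \<or> lab Z w = 2))" for c
    using ins by auto
  ultimately show ?thesis using vs(1,3) assms(1) W by (simp only: label_step_def large_def large_label_def if_True)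
qed

text \<open>Between \<open>v\<close> and its leaves there are only small gates, and these pass
  soundness upward; \<open>lab_exact\<close> does the same for exactness.\<close>

lemma lab_sound:
  assumes "v < N" "\<And>u. u \<in> lvs v \<Longrightarrow> lab Z u = bit (val inputs u) \<or> lab Z u = 2"
  shows "lab Z v = bit (val inputs v) \<or> lab Z v = 2"
  using assms
proof (induction v rule: node_induct)
  case (input v)
  then show ?case by (simp add: lvs_input)
next
  case (gate v)
  show ?case
  proof (cases "large v")
    case True
    then show ?thesis using gate(5)[of v] by (simp add: lvs_large)
  next
    case False
    have "lab Z j = bit (val inputs j) \<or> lab Z j = 2" if "j \<in> ins v" for j
      using gate(4)[OF that] gate(5) that unfolding lvs_small[OF gate(1,2) False] by blast
    from small_label_sound[of "gat v", OF this] show ?thesis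
      by (simp add: lab_small[OF gate(1,2) False] val_gate[OF length_inputs gate(1,2)])
  qed
qed

lemma lab_exact:
  assumes "v < N" "\<And>u. u \<in> lvs v \<Longrightarrow> lab Z u = bit (val inputs u)"
  shows "lab Z v = bit (val inputs v)"
  using assms
proof (induction v rule: node_induct)
  case (input v)
  then show ?case by (simp add: lvs_input)
next
  case (gate v)
  show ?case
  proof (cases "large v")
    case True
    then show ?thesis using gate(5)[of v] by (simp add: lvs_large)
  next
    case False
    have "lab Z j = bit (val inputs j)" if "j \<in> ins v" for j
      using gate(4)[OF that] gate(5) that unfolding lvs_small[OF gate(1,2) False] by blast
    from small_label_exact[of "gat v", OF this] show ?thesis
      by (simp add: lab_small[OF gate(1,2) False] val_gate[OF length_inputs gate(1,2)])
  qed
qed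

text \<open>Label 3 takes precedence at small gates, so a guess refuted at any leaf shows at
  \<open>v\<close>, whatever the other leaves say.\<close>

lemma lab_refuted:
  assumes "v < N" "u \<in> lvs v" "lab Z u = 3"
  shows "lab Z v = 3"
  using assms(1,2)
proof (induction v rule: node_induct)
  case (input v)
  then show ?case using assms(3) by (simp add: lvs_input)
next
  case (gate v)
  show ?case
  proof (cases "large v")
    case True
    then show ?thesis using gate(5) assms(3) by (simp add: lvs_large)
  next
    case False
    then obtain j where "j \<in> ins v" "u \<in> lvs j"
      using gate(5) lvs_small[OF gate(1,2) False] by blast
    then have "3 \<in> set (map (lab Z) (fanin (gat v)))" using gate(4) by force
    then show ?thesis by (simp add: lab_small[OF gate(1,2) False] small_label_refuted)
  qed
qed

lemma lab_input_sound:
  assumes valid "shown D Z" "a < n"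
  shows "lab Z a = bit (val inputs a) \<or> lab Z a = 2"
  using ilab_sound[OF assms] assms(3) by (simp add: lab_input val_input)

lemma lab_input_exact:
  assumes valid "shown D Z" "a < n" "{gap a, Suc (gap a)} \<subseteq> D"
  shows "lab Z a = bit (val inputs a)"
  using ilab_exact[OF assms] assms(3) by (simp add: lab_input val_input)

lemma val_large:
  assumes "large v"
  shows "bit (val inputs v) =
    (if \<exists>j\<in>ins v. bit (val inputs j) = determining (gat v)
     then determining (gat v) else 1 - determining (gat v))"
proof -
  have v: "n \<le> v" "v < N" using assms by (auto simp: large_def)
  have "kind (gat v) \<noteq> 0" using assms by (cases "gat v") (auto simp: large_def)
  from gate_value_determined[OF this] show ?thesis by (simp only: val_gate[OF length_inputs v])
qed

lemma shown_map:
  assumes "set gl \<subseteq> {..<Suc (Suc k)}"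
  shows "shown (set ([Suc (Suc k)..<Suc (Suc k) + 2 * q] @ gl))
    (map (\<lambda>i. (i, y i)) ([Suc (Suc k)..<Suc (Suc k) + 2 * q] @ gl))"
  using assms by (auto simp: shown_def)

lemma wcs_chk_map: "wcs_chk (n, gs) k q \<tau> (map y \<tau>) \<longleftrightarrow>
    order_ok n k (map (\<lambda>i. (i, y i)) \<tau>) \<and> lab (map (\<lambda>i. (i, y i)) \<tau>) out \<in> {1, 2}"
proof -
  have "map (\<lambda>p. (nthd 0 \<tau> p, nthd 0 (map y \<tau>) p)) [0..<length \<tau>] = map (\<lambda>i. (i, y i)) \<tau>"
    by (rule nth_equalityI) (simp_all add: nthd_nth)
  then show ?thesis
    using out_less by (simp add: wcs_chk_def Z_ok_def lab_def out_def nthd_nth)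
qed

end

lemma order_okD:
  assumes "order_ok n k Z" "(i, v) \<in> set Z"
  shows "i = 0 \<Longrightarrow> v = 0" "i = Suc k \<Longrightarrow> v = Suc n"
    "(Suc i, w) \<in> set Z \<Longrightarrow> i \<le> k \<Longrightarrow> v < w"
  using assms(1)[unfolded order_ok_def, THEN bspec, OF assms(2)] by auto

locale weft1_circuit = circuit +
  fixes q :: nat
  assumes weft: "wft out \<le> 1" and depth: "2 ^ dep out \<le> q"
begin

lemma q_pos: "0 < q"
  using depth by (metis gr0I not_one_le_zero one_le_numeral one_le_power order_trans)

lemma leaf: assumes "u \<in> lvs out" shows "u < n \<or> large u"
  using lvs_below[OF out_less] assms by blast

text \<open>The large leaf itself uses up the weft of 1, so its in-neighbours have weft 0.\<close>

lemma leaf_child: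
  assumes "u \<in> lvs out" "large u" "j \<in> ins u"
  shows "j < N" "wft j = 0" "card (lvs j) \<le> q"
proof -
  have u: "n \<le> u" "u < N" using assms(2) by (auto simp: large_def)
  have le: "wft u \<le> wft out" "dep u \<le> dep out" using lvs_below[OF out_less] assms(1,2) by auto
  show "j < N" using wf_gate(2)[OF u assms(3)] u by simp
  show "wft j = 0" using wft_child[OF u assms(3)] le weft assms(2) by simp
  have "card (lvs j) \<le> 2 ^ dep j" using lvs_card[OF \<open>j < N\<close>] by simp
  also have "\<dots> \<le> 2 ^ dep out" using dep_child[OF u assms(3)] le by (intro power_increasing) auto
  finally show "card (lvs j) \<le> q" using depth by simp
qed

text \<open>Every false guess is caught by some tuple. The tuples through \<open>i\<close> and
  \<open>Suc i\<close> make \<open>y\<close> increasing. An in-neighbour of a large leaf depends on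
  at most \<open>q\<close> inputs, so some tuple reveals its exact value; a guess contradicted by it
  would give label 3 at the leaf and hence at the output. So large leaves carry their true values
  under every tuple, and the tuple that reveals the at most \<open>q\<close> input leaves of
  \<open>out\<close> shows the output exactly. Since it is accepted and not unknown, the output is
  true.\<close>

lemma sound:
  assumes chk: "\<And>\<tau>. \<tau> \<in> set (wcs_tuples k q) \<Longrightarrow> wcs_chk (n, gs) k q \<tau> (map y \<tau>)"
  shows "\<exists>xs. length xs = n \<and> count_list xs True = k \<and> circuit_value (n, gs) xs"
proof -
  interpret guessed_circuit n gs k q y ..
  define tuple where "tuple gl = [Suc (Suc k)..<Suc (Suc k) + 2 * q] @ gl" for gl
  let ?Z = "\<lambda>gl. map (\<lambda>i. (i, y i)) (tuple gl)"
  have tuple: "i \<in> set (tuple gl)" "(i, y i) \<in> set (?Z gl)" if "i \<in> set gl" for i gl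
    using that by (simp_all add: tuple_def)
  have chk': "order_ok n k (?Z gl)" "lab (?Z gl) out \<in> {1, 2}" "shown (set (tuple gl)) (?Z gl)"
    if "length gl = 2 * q" "set gl \<subseteq> {..<Suc (Suc k)}" for gl
  proof -
    have "tuple gl \<in> set (wcs_tuples k q)"
      using that unfolding tuple_def wcs_tuples_def set_map set_n_lists
      by (intro imageI) (simp add: atLeast0LessThan del: upt_Suc)
    from chk[OF this] show "order_ok n k (?Z gl)" "lab (?Z gl) out \<in> {1, 2}"
      unfolding wcs_chk_map by auto
    show "shown (set (tuple gl)) (?Z gl)" 
      unfolding tuple_def using that(2) by (rule shown_map)
  qed
  have cover: "\<exists>gl. length gl = 2 * q \<and> set gl = A" if "A \<subseteq> {..<Suc (Suc k)}" "A \<noteq> {}" "card A \<le> 2 * q" for A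
    using padded_list[OF finite_subset[OF that(1)] that(2,3)] by simp
  have valid: valid
    unfolding valid_def
  proof (intro conjI allI impI)
    obtain gl where gl: "length gl = 2 * q" "set gl = {0, Suc k}"
      using cover[of "{0, Suc k}"] q_pos by auto
    have "order_ok n k (?Z gl)" using gl by (intro chk') auto
    from order_okD(1)[OF this tuple(2)[of 0]] order_okD(2)[OF this tuple(2)[of "Suc k"]]
    show "y 0 = 0" "y (Suc k) = Suc n" using gl(2) by simp_all
    fix i assume i: "i \<le> k"
    obtain gl where gl: "length gl = 2 * q" "set gl = {i, Suc i}"
      using cover[of "{i, Suc i}"] q_pos i by auto
    have "order_ok n k (?Z gl)" using gl i by (intro chk') auto
    from order_okD(3)[OF this tuple(2)[of i] tuple(2)[of "Suc i"] i]
    show "y i < y (Suc i)" using gl(2) by simp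
  qed
  have reveal: "\<exists>gl. length gl = 2 * q \<and> set gl \<subseteq> {..<Suc (Suc k)} \<and> (\<forall>a\<in>A. lab (?Z gl) a = bit (val inputs a))"
    if A: "A \<subseteq> {..<n}" "card A \<le> q" for A
  proof (cases "A = {}")
    case True
    obtain gl where "length gl = 2 * q" "set gl = {0::nat}" using cover[of "{0}"] q_pos by auto
    then show ?thesis using True by (intro exI[of _ gl]) auto
  next
    case False
    have fin: "finite A" using that(1) finite_subset by blast
    let ?A = "gap ` A \<union> (Suc \<circ> gap) ` A"
    have gap_le: "gap a \<le> k" if "a \<in> A" for a using gap(1)[OF valid] that \<open>A \<subseteq> {..<n}\<close> by auto
    have "card ?A \<le> card A + card A"
      using card_Un_le[of "gap ` A" "(Suc \<circ> gap) ` A"] card_image_le[OF fin, of gap]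
        card_image_le[OF fin, of "Suc \<circ> gap"] by linarith
    moreover have sub: "?A \<subseteq> {..<Suc (Suc k)}" using gap_le by (auto simp: less_Suc_eq_le le_SucI)
    ultimately obtain gl where gl: "length gl = 2 * q" "set gl = ?A"
      using cover[of ?A] False A(2) by auto
    have "shown (set (tuple gl)) (?Z gl)" using gl sub by (intro chk') auto
    then have "lab (?Z gl) a = bit (val inputs a)" if "a \<in> A" for a
      using that \<open>A \<subseteq> {..<n}\<close> gl(2) by (intro lab_input_exact[OF valid]) (auto intro: tuple(1))
    with gl sub show ?thesis by blast
  qed
  have large_not3: "lab (?Z gl) u \<noteq> 3"
    if "u \<in> lvs out" "length gl = 2 * q" "set gl \<subseteq> {..<Suc (Suc k)}" for u gl
    using lab_refuted[OF out_less that(1), of "?Z gl"] chk'(2)[OF that(2,3)] by auto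
  have reveal_child: "\<exists>gl. length gl = 2 * q \<and> set gl \<subseteq> {..<Suc (Suc k)} \<and> lab (?Z gl) j = bit (val inputs j)"
    if "u \<in> lvs out" "large u" "j \<in> ins u" for u j
  proof -
    have "lvs j \<subseteq> {..<n}" using wft_0_lvs leaf_child[OF that] by blast
    from reveal[OF this leaf_child(3)[OF that]] show ?thesis
      using lab_exact[OF leaf_child(1)[OF that]] by blast
  qed
  have large_exact: "lab (?Z gl) u = bit (val inputs u)"
    if u: "u \<in> lvs out" "large u" and gl: "length gl = 2 * q" "set gl \<subseteq> {..<Suc (Suc k)}" for u gl
  proof -
    let ?d = "determining (gat u)"
    note L = lab_large[OF u(2) chk'(3)]
    have ne: "guess u \<noteq> {}" using large_not3[OF u(1) gl] L[OF gl] by auto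
    show ?thesis
    proof (cases "N \<in> guess u")
      case True
      \<comment> \<open>If \<open>j\<close> had the determining value, revealing the inputs below
        \<open>j\<close> would refute the guess that no in-neighbour decides.\<close>
      have "bit (val inputs j) \<noteq> ?d" if j: "j \<in> ins u" for j
      proof
        assume d: "bit (val inputs j) = ?d"
        obtain gl' where gl': "length gl' = 2 * q" "set gl' \<subseteq> {..<Suc (Suc k)}"
          "lab (?Z gl') j = bit (val inputs j)" using reveal_child[OF u j] by blast
        then have "lab (?Z gl') u = 3" using L[OF gl'(1,2)] True ne j d by auto
        with large_not3[OF u(1) gl'(1,2)] show False by simp
      qed
      then have "\<not> (\<exists>j\<in>ins u. bit (val inputs j) = ?d)" by blast
      then have "bit (val inputs u) = 1 - ?d" unfolding val_large[OF u(2)] by (simp only: if_False)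
      moreover have "lab (?Z gl) u = 1 - ?d" using L[OF gl] large_not3[OF u(1) gl] True ne by (auto split: if_splits)
      ultimately show ?thesis by simp
    next
      case False
      obtain w where w: "w \<in> guess u" using ne by blast
      have all: "\<forall>w\<in>guess u. w \<in> ins u \<and> (lab (?Z gl') w = ?d \<or> lab (?Z gl') w = 2)"
        if "length gl' = 2 * q" "set gl' \<subseteq> {..<Suc (Suc k)}" for gl'
        using L[OF that] large_not3[OF u(1) that] False ne by (auto split: if_splits)
      have wi: "w \<in> ins u" using all[OF gl] w by blast
      obtain gl' where gl': "length gl' = 2 * q" "set gl' \<subseteq> {..<Suc (Suc k)}"
        "lab (?Z gl') w = bit (val inputs w)" using reveal_child[OF u wi] by blast
      \<comment> \<open>Once the inputs below \<open>w\<close> are revealed, its label is exact;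
        this closes the escape through label 2 and leaves the determining value.\<close>
      have "bit (val inputs w) \<noteq> 2" by simp
      then have "bit (val inputs w) = ?d" using all[OF gl'(1,2)] w gl'(3) by metis
      then have "\<exists>j\<in>ins u. bit (val inputs j) = ?d" using wi by blast
      then have "bit (val inputs u) = ?d" unfolding val_large[OF u(2)] by (simp only: if_True)
      moreover have "lab (?Z gl) u = ?d" using L[OF gl] all[OF gl] False ne by auto
      ultimately show ?thesis by simp
    qed
  qed
  have "card (lvs out \<inter> {..<n}) \<le> q"
    using lvs_card[OF out_less] depth card_mono[of "lvs out" "lvs out \<inter> {..<n}"] by auto
  then obtain gl where gl: "length gl = 2 * q" "set gl \<subseteq> {..<Suc (Suc k)}"
    "\<forall>a\<in>lvs out \<inter> {..<n}. lab (?Z gl) a = bit (val inputs a)" using reveal[of "lvs out \<inter> {..<n}"] by auto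
  have "lab (?Z gl) out = bit (val inputs out)"
    using gl leaf large_exact[OF _ _ gl(1,2)] by (intro lab_exact[OF out_less]) blast
  with chk'(2)[OF gl(1,2)] have "val inputs out" by (auto split: if_splits)
  then show ?thesis
    using count_inputs[OF valid] circuit_value_val[OF length_inputs] by (intro exI[of _ inputs]) simp
qed

text \<open>The positions are the true inputs in increasing order, the slots hold the large leaves
  of \<open>out\<close>, and each guess is a true witness or the marker \<open>N\<close>. Labels at
  the leaves of \<open>out\<close> are then never wrong, only possibly unknown, so no tuple
  rejects.\<close>

lemma complete:
  assumes xs: "length xs = n" "count_list xs True = k" "circuit_value (n, gs) xs"
  shows "\<exists>y. (\<forall>s. y s < Suc (Suc N)) \<and> (\<forall>\<tau>\<in>set (wcs_tuples k q). wcs_chk (n, gs) k q \<tau> (map y \<tau>))"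
proof -
  define T where "T = {a. a < n \<and> xs ! a}"
  have finT: "finite T" by (simp add: T_def)
  have cardT: "card T = k"
    using count_list_True[of "(!) xs" n] xs(1,2) map_nth[of xs] by (simp add: T_def)
  define ts where "ts = sorted_list_of_set T"
  have ts: "length ts = k" "set ts = T" "sorted_wrt (<) ts"
    using finT cardT by (simp_all add: ts_def)
  define wit where "wit u = (if large u \<and> (\<exists>j\<in>ins u. bit (val xs j) = determining (gat u))
    then SOME j. j \<in> ins u \<and> bit (val xs j) = determining (gat u) else N)" for u
  let ?G = "{u \<in> lvs out. large u}"
  obtain bs where bs: "length bs = q" "?G \<subseteq> set bs" "set bs \<subseteq> {..<N}"
  proof -
    have "finite ?G" "card ?G \<le> q"
      using lvs_card[OF out_less] depth card_mono[of "lvs out" ?G] by auto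
    \<comment> \<open>There are exactly \<open>q\<close> slots for large gates: repetitions fill the
      surplus, and node 0 fills them all when the output has no large leaf.\<close>
    then have "\<exists>bs. length bs = q \<and> set bs = (if ?G = {} then {0} else ?G)"
      using q_pos by (intro padded_list) auto
    then obtain bs where "length bs = q" "set bs = (if ?G = {} then {0} else ?G)" by blast
    moreover have "0 < N" using N_pos .
    ultimately show thesis using that[of bs] by (auto simp: large_def split: if_splits)
  qed
  define y where "y i = (if i = 0 then 0 else if i \<le> k then Suc (ts ! (i - 1)) else if i = Suc k then Suc n
    else if i < Suc (Suc k) + q then bs ! (i - Suc (Suc k))
    else if i < Suc (Suc k) + 2 * q then wit (bs ! (i - Suc (Suc k) - q)) else 0)" for i
  interpret guessed_circuit n gs k q y ..
  have ts_less: "ts ! i < n" if "i < k" for i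
    using that ts nth_mem[of i ts] by (auto simp: T_def)
  have wit_cases: "wit u = N \<and> \<not> (\<exists>j\<in>ins u. bit (val xs j) = determining (gat u)) \<or>
      wit u \<in> ins u \<and> bit (val xs (wit u)) = determining (gat u)" if "large u" for u
  proof (cases "\<exists>j\<in>ins u. bit (val xs j) = determining (gat u)")
    case True
    then have w: "wit u = (SOME j. j \<in> ins u \<and> bit (val xs j) = determining (gat u))"
      unfolding wit_def using that by (simp only: simp_thms if_True)
    from True have "\<exists>j. j \<in> ins u \<and> bit (val xs j) = determining (gat u)" by blast
    from someI_ex[OF this] show ?thesis unfolding w by (rule disjI2)
  next
    case False
    then show ?thesis unfolding wit_def by (simp only: simp_thms if_False)
  qed
  have wit_le: "wit u \<le> N" for u
  proof (cases "large u")
    case True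
    then have "n \<le> u" "u < N" by (auto simp: large_def)
    with wit_cases[OF True] wf_gate(2)[of u "wit u"] show ?thesis by auto
  qed (simp add: wit_def)
  \<comment> \<open>The largest values that can occur are the end frame \<open>n + 1\<close> and the
    marker \<open>N\<close>, hence a domain of size \<open>N + 2\<close>.\<close>
  have y_less: "y s < Suc (Suc N)" for s
  proof -
    have 1: "Suc (ts ! i) < Suc (Suc N)" if "i < k" for i using ts_less[OF that] by simp
    have 2: "bs ! c < Suc (Suc N)" if "c < q" for c
    proof -
      have "bs ! c \<in> set bs" using that bs(1) by simp
      then have "bs ! c < N" using bs(3) by blast
      then show ?thesis by simp
    qed
    have 3: "wit u < Suc (Suc N)" for u using wit_le[of u] by simp
    show ?thesis
      unfolding y_def using 1[of "s - 1"] 2[of "s - Suc (Suc k)"] 3 by simp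
  qed
  have valid: valid unfolding valid_def
  proof (intro conjI allI impI)
    fix i assume i: "i \<le> k"
    show "y i < y (Suc i)"
    proof (cases "i = 0 \<or> i = k")
      case True
      then show ?thesis using i ts_less[of "i - 1"] by (auto simp: y_def)
    next
      case False
      then have "ts ! (i - 1) < ts ! i"
        using ts i by (intro sorted_wrt_nth_less[of "(<)" ts "i - 1" i]) auto
      then show ?thesis using False i by (simp add: y_def)
    qed
  qed (simp_all add: y_def)
  have inputs: "inputs = xs"
  proof (rule nth_equalityI)
    fix a assume "a < length inputs"
    then have a: "a < n" by simp
    have "inputs ! a \<longleftrightarrow> (\<exists>i. 1 \<le> i \<and> i \<le> k \<and> ts ! (i - 1) = a)"
      unfolding inputs_nth[OF a] by (rule ex_cong) (auto simp: y_def)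
    also have "\<dots> \<longleftrightarrow> (\<exists>i<k. ts ! i = a)"
      by (metis One_nat_def Suc_leI Suc_pred diff_Suc_1 le_simps(3) less_eq_Suc_le zero_less_Suc)
    also have "\<dots> \<longleftrightarrow> a \<in> set ts" using ts(1) by (auto simp: in_set_conv_nth)
    also have "\<dots> \<longleftrightarrow> xs ! a" using a ts(2) by (simp add: T_def)
    finally show "inputs ! a = xs ! a" by simp
  qed (simp add: xs(1))
  have guess: "guess u = {wit u}" if u: "u \<in> lvs out" "large u" for u
  proof -
    have y_gate: "y (Suc (Suc k) + c) = bs ! c" if "c < q" for c
      using that by (simp add: y_def)
    have y_wit: "y (Suc (Suc k) + c + q) = wit (bs ! c)" if "c < q" for c
      using that by (simp add: y_def)
    show ?thesis
    proof (intro equalityI subsetI)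
      fix x assume "x \<in> guess u"
      then obtain i where i: "x = y (i + q)" "Suc (Suc k) \<le> i" "i < Suc (Suc k) + q" "y i = u"
        unfolding guess_def by blast
      then obtain c where c: "i = Suc (Suc k) + c" "c < q" using le_Suc_ex[OF i(2)] by auto
      show "x \<in> {wit u}" using i(1,4) y_gate[OF c(2)] y_wit[OF c(2)] unfolding c(1) by simp
    next
      fix x assume "x \<in> {wit u}"
      moreover have "u \<in> set bs" using u bs(2) by blast
      then obtain c where c: "c < q" "bs ! c = u" using bs(1) by (auto simp: in_set_conv_nth)
      ultimately have "x = y (Suc (Suc k) + c + q)" "y (Suc (Suc k) + c) = u"
        using y_gate y_wit by simp_all
      then show "x \<in> guess u"
        unfolding guess_def using c(1) by (intro CollectI exI[of _ "Suc (Suc k) + c"] conjI) simp_all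
    qed
  qed
  have "wcs_chk (n, gs) k q \<tau> (map y \<tau>)" if "\<tau> \<in> set (wcs_tuples k q)" for \<tau>
  proof -
    let ?Z = "map (\<lambda>i. (i, y i)) \<tau>"
    from that obtain gl where gl: "set gl \<subseteq> set [0..<Suc (Suc k)]"
      and \<tau>: "\<tau> = [Suc (Suc k)..<Suc (Suc k) + 2 * q] @ gl"
      unfolding wcs_tuples_def set_map set_n_lists by blast
    from gl have "set gl \<subseteq> {..<Suc (Suc k)}" by (simp only: set_upt atLeast0LessThan)
    then have shown: "shown (set \<tau>) ?Z" unfolding \<tau> by (rule shown_map)
    have "order_ok n k ?Z"
      unfolding order_ok_def using valid by (auto simp: valid_def)
    moreover have "lab ?Z u = bit (val inputs u) \<or> lab ?Z u = 2" if u: "u \<in> lvs out" for u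
    proof (cases "u < n")
      case True
      then show ?thesis by (rule lab_input_sound[OF valid shown])
    next
      case False
      then have lg: "large u" using leaf[OF u] by blast
      then have uN: "n \<le> u" "u < N" by (auto simp: large_def)
      \<comment> \<open>By weft at most 1, an in-neighbour of a large leaf has only inputs as
        leaves, so its label depends on no guess.\<close>
      have child: "lab ?Z j = bit (val inputs j) \<or> lab ?Z j = 2" if j: "j \<in> ins u" for j
        using lab_input_sound[OF valid shown] wft_0_lvs[OF leaf_child(1,2)[OF u lg j]]
        by (intro lab_sound[OF leaf_child(1)[OF u lg j]]) blast
      note L = lab_large[OF lg shown, unfolded guess[OF u lg]]
      have det: "determining (gat u) \<noteq> 2" by (simp add: determining_def)
      from wit_cases[OF lg] show ?thesis
      proof
        assume w: "wit u = N \<and> \<not> (\<exists>j\<in>ins u. bit (val xs j) = determining (gat u))"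
        then have "\<not> (\<exists>j\<in>ins u. lab ?Z j = determining (gat u))"
          using child det unfolding inputs by metis
        then have "lab ?Z u = 1 - determining (gat u)" using L w by simp
        moreover have "bit (val inputs u) = 1 - determining (gat u)"
          unfolding inputs val_large[OF lg, unfolded inputs] using w by (simp only: if_False)
        ultimately show ?thesis by simp
      next
        assume w: "wit u \<in> ins u \<and> bit (val xs (wit u)) = determining (gat u)"
        then have "wit u \<noteq> N" using wf_gate(2)[OF uN] uN by fastforce
        moreover have "lab ?Z (wit u) = determining (gat u) \<or> lab ?Z (wit u) = 2"
          using child[of "wit u"] w unfolding inputs by metis
        ultimately have "lab ?Z u = determining (gat u)" using L w by simp
        moreover have "\<exists>j\<in>ins u. bit (val xs j) = determining (gat u)" using w by blast
        then have "bit (val inputs u) = determining (gat u)"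
          unfolding inputs val_large[OF lg, unfolded inputs] by (simp only: if_True)
        ultimately show ?thesis by simp
      qed
    qed
    then have "lab ?Z out = bit (val inputs out) \<or> lab ?Z out = 2" by (rule lab_sound[OF out_less])
    moreover have "val inputs out" using xs circuit_value_val inputs by simp
    ultimately show ?thesis unfolding wcs_chk_map by auto
  qed
  with y_less show ?thesis by blast
qed

end

section \<open>Decoding circuits\<close>

fun dec_list :: "tree \<Rightarrow> tree list" where
  "dec_list Leaf = []"
| "dec_list (Node a b) = a # dec_list b"

lemma enc_dec_list [simp]: "enc (dec_list t) = t"
  by (induction t) (simp_all add: enc_tree)

text \<open>A list of trees is encoded by the very tree that it was decoded from, so nothing has to
  be computed.\<close>

lemma pt_dec_list [pt_intros]: "pt f \<Longrightarrow> pt (\<lambda>x. dec_list (f x))"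
  by (rule pt_recast[of f]) (simp_all add: enc_tree)

definition nat_code :: "tree \<Rightarrow> bool" where
  "nat_code t \<longleftrightarrow> (\<forall>u\<in>set (dec_list t). u = Leaf)"

definition gate_code :: "tree \<Rightarrow> bool" where
  "gate_code t \<longleftrightarrow> t \<noteq> Leaf \<and>
     (tleft t = enc (0::nat) \<and> nat_code (tright t) \<or>
      (tleft t = enc (1::nat) \<or> tleft t = enc (2::nat)) \<and> (\<forall>u\<in>set (dec_list (tright t)). nat_code u))"

text \<open>The reduction is defined on all trees, so those that encode no circuit must be
  recognised. Every tree is a list of trees along its right spine, which turns the test into nested
  bounded quantifiers.\<close>

definition circuit_code :: "tree \<Rightarrow> bool" where
  "circuit_code t \<longleftrightarrow> t \<noteq> Leaf \<and> nat_code (tleft t) \<and> (\<forall>u\<in>set (dec_list (tright t)). gate_code u)"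

lemma nat_code_iff: "nat_code t \<longleftrightarrow> (\<exists>m::nat. t = enc m)"
proof
  show "nat_code t \<Longrightarrow> \<exists>m::nat. t = enc m"
  proof (induction t)
    case Leaf
    then show ?case by (intro exI[of _ 0]) simp
  next
    case (Node a b)
    then obtain m :: nat where "b = enc m" "a = Leaf" by (auto simp: nat_code_def)
    then show ?case by (intro exI[of _ "Suc m"]) simp
  qed
  have "nat_code (enc m)" for m :: nat by (induction m) (auto simp: nat_code_def)
  then show "\<exists>m::nat. t = enc m \<Longrightarrow> nat_code t" by blast
qed

lemma list_code:
  assumes "\<And>u. P u \<longleftrightarrow> (\<exists>m::'a::enc. u = enc m)"
  shows "(\<forall>u\<in>set (dec_list t). P u) \<longleftrightarrow> (\<exists>ms::'a list. t = enc ms)"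
proof
  show "\<forall>u\<in>set (dec_list t). P u \<Longrightarrow> \<exists>ms::'a list. t = enc ms"
  proof (induction t)
    case Leaf
    then show ?case by (intro exI[of _ "[]"]) simp
  next
    case (Node a b)
    then obtain ms :: "'a list" where "b = enc ms" by auto
    moreover obtain m :: 'a where "a = enc m" using Node.prems assms by auto
    ultimately show ?case by (intro exI[of _ "m # ms"]) simp
  qed
  have "\<forall>u\<in>set (dec_list (enc ms)). P u" for ms :: "'a list"
    by (induction ms) (auto simp: assms)
  then show "\<exists>ms::'a list. t = enc ms \<Longrightarrow> \<forall>u\<in>set (dec_list t). P u" by blast
qed

lemma gate_code_iff: "gate_code t \<longleftrightarrow> (\<exists>g::gate. t = enc g)"
proof
  assume "gate_code t"
  then consider (N) j :: nat where "t = Node (enc (0::nat)) (enc j)"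
    | (A) js :: "nat list" where "t = Node (enc (1::nat)) (enc js)"
    | (O) js :: "nat list" where "t = Node (enc (2::nat)) (enc js)"
    unfolding gate_code_def list_code[OF nat_code_iff] nat_code_iff by (cases t) auto
  then show "\<exists>g::gate. t = enc g"
  proof cases
    case N
    then show ?thesis by (intro exI[of _ "NotG j"]) simp
  next
    case A
    then show ?thesis by (intro exI[of _ "AndG js"]) simp
  next
    case O
    then show ?thesis by (intro exI[of _ "OrG js"]) simp
  qed
next
  assume "\<exists>g::gate. t = enc g"
  then obtain g :: gate where "t = enc g" by blast
  then show "gate_code t"
    unfolding gate_code_def list_code[OF nat_code_iff] nat_code_iff by (cases g) auto
qed

lemma circuit_code_iff: "circuit_code t \<longleftrightarrow> (\<exists>C::circuit. t = enc C)"
  unfolding circuit_code_def list_code[OF gate_code_iff] nat_code_iff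
  by (cases t) (auto simp: enc_prod)

lemma pt_circuit_code: "pt f \<Longrightarrow> pt (\<lambda>x. circuit_code (f x))"
proof (rule pt_comp[of circuit_code])
  show "pt circuit_code"
    unfolding circuit_code_def gate_code_def nat_code_def by (intro pt_intros)
qed

lemma enc_circuit_eq: "enc_circuit C = enc C"
proof -
  have "enc_nat = enc" "enc_gate = enc" by (auto simp: enc_nat_eq enc_gate_eq)
  then show ?thesis by (cases C) (simp add: enc_list_eq)
qed

section \<open>The reduction runs in polynomial time\<close>

text \<open>A bound on single labels suffices, as the list gains one entry for each gate.\<close>

lemma pt_run:
  fixes xs :: "'a::enc \<Rightarrow> 'b::enc list"
  assumes xs: "pt xs" and gs: "pt gs"
    and step: "pt (\<lambda>z. step (fst z) (fst (snd z)) (snd (snd z)))"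
    and h: "pb h" "\<And>x ys zs v. gs x = ys @ zs \<Longrightarrow> v \<in> set (run (step x) (xs x) ys) \<Longrightarrow> sz v \<le> h x"
  shows "pt (\<lambda>x. run (step x) (xs x) (gs x))"
proof -
  have run: "run st ws hs = fold (\<lambda>g vs. vs @ [st vs g]) hs ws" for st :: "'b list \<Rightarrow> gate \<Rightarrow> 'b" and ws hs
    by (simp add: run_def foldl_conv_fold)
  let ?H = "\<lambda>x. 1 + (sz (xs x) + sz (gs x)) * (1 + h x)"
  have "pt (\<lambda>x. fold (\<lambda>g vs. vs @ [step x vs g]) (gs x) (xs x))"
  proof (rule pt_fold[OF gs xs, where h = ?H])
    have "pt (\<lambda>z. step (fst z) (snd (snd z)) (fst (snd z)))"
      using pt_comp[OF step, of "\<lambda>z. (fst z, snd (snd z), fst (snd z))"] by (simp add: pt_intros)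
    then show "pt (\<lambda>z. snd (snd z) @ [step (fst z) (snd (snd z)) (fst (snd z))])"
      by (intro pt_append pt_Cons pt_const pt_snd pt_id)
    show "pb ?H" by (intro pb_add pb_mult pb_const pt_size xs gs h)
    fix x ys zs assume eq: "gs x = ys @ zs"
    have "sz (run (step x) (xs x) ys) \<le> 1 + length (run (step x) (xs x) ys) * (1 + h x)"
      using h(2)[OF eq] by (rule sz_list_bound)
    also have "\<dots> \<le> ?H x"
      using length_le_sz[of "xs x"] length_le_sz[of "gs x"] eq by (intro add_left_mono mult_le_mono1) simp
    finally show "sz (fold (\<lambda>g vs. vs @ [step x vs g]) ys (xs x)) \<le> ?H x" by (simp add: run)
  qed
  then show ?thesis by (simp only: run)
qed

lemma run_bounded:
  assumes "\<And>v. v \<in> set xs \<Longrightarrow> v \<le> (b::nat)" "\<And>vs g. step vs g \<le> b"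
  shows "v \<in> set (run step xs gs) \<Longrightarrow> v \<le> b"
  using assms by (induction gs rule: rev_induct) auto

text \<open>Weft and depth grow by at most one with each gate, which keeps their unary encodings
  small.\<close>

lemma run_growth:
  assumes "\<And>v. v \<in> set xs \<Longrightarrow> v = (0::nat)"
    "\<And>vs g m. (\<And>v. v \<in> set vs \<Longrightarrow> v \<le> m) \<Longrightarrow> step vs g \<le> Suc m"
  shows "v \<in> set (run step xs gs) \<Longrightarrow> v \<le> length gs"
proof (induction gs arbitrary: v rule: rev_induct)
  case (snoc g gs)
  then show ?case using assms(2)[of "run step xs gs" "length gs" g] by (auto intro: le_SucI)
qed (use assms(1) in auto)

section \<open>Recognising circuits of weft at most 1 and bounded depth\<close>

definition maxl :: "nat list \<Rightarrow> nat" where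
  "maxl xs = fold max xs 0"

lemma maxl_eq: "xs \<noteq> [] \<Longrightarrow> maxl xs = Max (set xs)"
proof -
  assume ne: "xs \<noteq> []"
  have "fold max xs a = Max (insert a (set xs))" for a
    by (metis Max.set_eq_fold list.simps(15))
  then have "maxl xs = Max (insert 0 (set xs))" by (simp add: maxl_def)
  also have "\<dots> = Max (set xs)" using ne by simp
  finally show ?thesis .
qed

lemma maxl_le: "(\<And>v. v \<in> set xs \<Longrightarrow> v \<le> m) \<Longrightarrow> maxl xs \<le> m"
proof -
  assume le: "\<And>v. v \<in> set xs \<Longrightarrow> v \<le> m"
  have "a \<le> m \<Longrightarrow> fold max xs a \<le> m" for a
    using le by (induction xs arbitrary: a) auto
  then show ?thesis by (simp add: maxl_def)
qed

lemma pt_maxl: fixes l :: "'a::enc \<Rightarrow> nat list" assumes "pt l" shows "pt (\<lambda>x. maxl (l x))"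
  unfolding maxl_def
proof (rule pt_fold[OF assms pt_const, where h = "\<lambda>x. sz (l x)"])
  show "pt (\<lambda>z. max (fst (snd z)) (snd (snd z)) :: nat)"
    unfolding max_def by (intro pt_intros)
  show "pb (\<lambda>x. sz (l x))" using assms by (rule pt_size)
  fix x ys zs assume eq: "l x = ys @ zs"
  have "fold max ys a \<in> insert a (set ys)" for a :: nat
  proof (induction ys arbitrary: a)
    case (Cons y ys)
    from Cons[of "max y a"] show ?case by (auto simp: max_def split: if_splits)
  qed simp
  from this[of 0] have "fold max ys 0 = 0 \<or> fold max ys 0 \<in> set (l x)" using eq by auto
  then show "sz (fold max ys 0) \<le> sz (l x)" using sz_mem[of "fold max ys 0" "l x"] by (auto simp: sz_nat)
qed

text \<open>The clauses use \<open>nthd\<close> and \<open>maxl\<close>, for which running times are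
  known on all arguments, so the test runs on every circuit, well-formed or not.\<close>

definition circuit_check :: "nat \<Rightarrow> circuit \<Rightarrow> bool" where
  "circuit_check d C \<longleftrightarrow> 0 < fst C + length (snd C) \<and>
     (\<forall>i\<in>set [0..<length (snd C)]. fanin (nthd (NotG 0) (snd C) i) \<noteq> [] \<and>
        (\<forall>j\<in>set (fanin (nthd (NotG 0) (snd C) i)). j < fst C + i)) \<and>
     nthd 0 (run (\<lambda>vs g. (if 2 < length (fanin g) then 1 else 0) + maxl (map (\<lambda>j. nthd 0 vs j) (fanin g)))
       (map (\<lambda>_. 0) [0..<fst C]) (snd C)) (fst C + length (snd C) - 1) \<le> 1 \<and>
     nthd 0 (run (\<lambda>vs g. Suc (maxl (map (\<lambda>j. nthd 0 vs j) (fanin g))))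
       (map (\<lambda>_. 0) [0..<fst C]) (snd C)) (fst C + length (snd C) - 1) \<le> d"

lemma nthd_le: "(\<And>v. v \<in> set vs \<Longrightarrow> v \<le> (m::nat)) \<Longrightarrow> nthd 0 vs j \<le> m"
  by (cases "j < length vs") (auto simp: nthd_nth, simp add: nthd_def hdd_def)

lemma maxl_nthd_le: "(\<And>v. v \<in> set vs \<Longrightarrow> v \<le> m) \<Longrightarrow> maxl (map (\<lambda>j. nthd 0 vs j) js) \<le> m"
  by (rule maxl_le) (auto intro: nthd_le)

lemma pt_circuit_check: "pt (circuit_check d)"
proof -
  have 1: "pt (\<lambda>C::circuit. run (\<lambda>vs g. (if 2 < length (fanin g) then 1 else 0) + maxl (map (\<lambda>j. nthd 0 vs j) (fanin g)))
       (map (\<lambda>_. 0) [0..<fst C]) (snd C))"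
  proof (rule pt_run[where h = "\<lambda>C. 1 + 2 * sz (snd C)"])
    show "pb (\<lambda>C::circuit. 1 + 2 * sz (snd C))" by (intro pb_add pb_mult pb_const pt_size pt_intros)
    fix C :: circuit and ys zs v assume eq: "snd C = ys @ zs"
      and v: "v \<in> set (run (\<lambda>vs g. (if 2 < length (fanin g) then 1 else 0) + maxl (map (\<lambda>j. nthd 0 vs j) (fanin g)))
       (map (\<lambda>_. 0) [0..<fst C]) ys)"
    from v have "v \<le> length ys"
    proof (rule run_growth[rotated 2])
      show "(if 2 < length (fanin g) then 1 else 0) + maxl (map (\<lambda>j. nthd 0 vs j) (fanin g)) \<le> Suc m"
        if "\<And>v. v \<in> set vs \<Longrightarrow> v \<le> m" for vs g m
      proof -
        have "maxl (map (\<lambda>j. nthd 0 vs j) (fanin g)) \<le> m" by (rule maxl_nthd_le) (rule that)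
        then show ?thesis by simp
      qed
    qed auto
    then show "sz v \<le> 1 + 2 * sz (snd C)" using eq length_le_sz[of "snd C"] by (simp add: sz_nat)
  qed (intro pt_intros pt_maxl)+
  have 2: "pt (\<lambda>C::circuit. run (\<lambda>vs g. Suc (maxl (map (\<lambda>j. nthd 0 vs j) (fanin g))))
       (map (\<lambda>_. 0) [0..<fst C]) (snd C))"
  proof (rule pt_run[where h = "\<lambda>C. 1 + 2 * sz (snd C)"])
    show "pb (\<lambda>C::circuit. 1 + 2 * sz (snd C))" by (intro pb_add pb_mult pb_const pt_size pt_intros)
    fix C :: circuit and ys zs v assume eq: "snd C = ys @ zs"
      and v: "v \<in> set (run (\<lambda>vs g. Suc (maxl (map (\<lambda>j. nthd 0 vs j) (fanin g))))
       (map (\<lambda>_. 0) [0..<fst C]) ys)"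
    from v have "v \<le> length ys"
    proof (rule run_growth[rotated 2])
      show "Suc (maxl (map (\<lambda>j. nthd 0 vs j) (fanin g))) \<le> Suc m"
        if "\<And>v. v \<in> set vs \<Longrightarrow> v \<le> m" for vs g m
      proof -
        have "maxl (map (\<lambda>j. nthd 0 vs j) (fanin g)) \<le> m" by (rule maxl_nthd_le) (rule that)
        then show ?thesis by simp
      qed
    qed auto
    then show "sz v \<le> 1 + 2 * sz (snd C)" using eq length_le_sz[of "snd C"] by (simp add: sz_nat)
  qed (intro pt_intros pt_maxl)+
  show ?thesis unfolding circuit_check_def by (intro pt_intros 1 2)
qed

text \<open>In a well-formed circuit each gate reads at least one label and only earlier ones, so
  rules that agree there can be exchanged. This links \<open>Max\<close> and \<open>!\<close> with
  \<open>maxl\<close> and \<open>nthd\<close>.\<close>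

lemma run_cong:
  assumes wf: "wf_circuit (n, gs)" and len: "length xs = n"
    and eq: "\<And>vs g. fanin g \<noteq> [] \<Longrightarrow> (\<And>j. j \<in> set (fanin g) \<Longrightarrow> j < length vs) \<Longrightarrow> f vs g = h vs g"
  shows "run f xs gs = run h xs gs"
proof -
  have "m \<le> length gs \<Longrightarrow> run f xs (take m gs) = run h xs (take m gs)" for m
  proof (induction m)
    case (Suc m)
    have "fanin (gs ! m) \<noteq> []" "\<And>j. j \<in> set (fanin (gs ! m)) \<Longrightarrow> j < n + m"
      using wf Suc.prems by (auto simp: wf_circuit_def)
    then show ?case
      using Suc len eq[of "gs ! m" "run h xs (take m gs)"] by (simp add: take_Suc_conv_app_nth)
  qed simp
  from this[of "length gs"] show ?thesis by simp
qed

lemma circuit_check_iff: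
  "circuit_check d C \<longleftrightarrow> wf_circuit C \<and> circuit_weft C \<le> 1 \<and> circuit_depth C \<le> d"
proof -
  obtain n gs where C: "C = (n, gs)" by (cases C)
  have wf: "wf_circuit C \<longleftrightarrow> 0 < n + length gs \<and>
     (\<forall>i\<in>set [0..<length gs]. fanin (nthd (NotG 0) gs i) \<noteq> [] \<and>
        (\<forall>j\<in>set (fanin (nthd (NotG 0) gs i)). j < n + i))"
    by (auto simp: C wf_circuit_def nthd_nth)
  have last: "last vs = nthd 0 vs (length vs - 1)" if "vs \<noteq> []" for vs :: "nat list"
    using that by (simp add: last_conv_nth nthd_nth)
  have zeros: "map (\<lambda>_. 0::nat) [0..<n] = replicate n 0" by (simp add: map_replicate_const)
  show ?thesis
  proof (cases "wf_circuit C")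
    case True
    then have W: "wf_circuit (n, gs)" by (simp add: C)
    then have N: "0 < n + length gs" by (simp add: wf_circuit_def)
    have max: "Max (set (map (\<lambda>j. vs ! j) (fanin g))) = maxl (map (\<lambda>j. nthd 0 vs j) (fanin g))"
      if "fanin g \<noteq> []" "\<And>j. j \<in> set (fanin g) \<Longrightarrow> j < length vs" for vs g
    proof -
      have "map (\<lambda>j. nthd 0 vs j) (fanin g) = map (\<lambda>j. vs ! j) (fanin g)"
        using that(2) by (simp add: nthd_nth)
      then show ?thesis using that(1) by (simp add: maxl_eq)
    qed
    let ?w = "run (\<lambda>vs g. (if 2 < length (fanin g) then 1 else 0) + maxl (map (\<lambda>j. nthd 0 vs j) (fanin g))) (replicate n 0) gs"
    let ?d = "run (\<lambda>vs g. Suc (maxl (map (\<lambda>j. nthd 0 vs j) (fanin g)))) (replicate n 0) gs"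
    have "circuit_weft C = last ?w"
      unfolding circuit_weft_def output_label_run C fst_conv snd_conv
    proof (rule arg_cong[of _ _ last], rule run_cong[OF W])
      fix vs :: "nat list" and g
      assume "fanin g \<noteq> []" "\<And>j. j \<in> set (fanin g) \<Longrightarrow> j < length vs"
      from max[OF this] show "(if 2 < length (fanin g) then 1 else 0) + Max (set (map (\<lambda>j. vs ! j) (fanin g))) =
        (if 2 < length (fanin g) then 1 else 0) + maxl (map (\<lambda>j. nthd 0 vs j) (fanin g))" by (simp only:)
    qed simp
    moreover have "circuit_depth C = last ?d"
      unfolding circuit_depth_def output_label_run C fst_conv snd_conv
    proof (rule arg_cong[of _ _ last], rule run_cong[OF W])
      fix vs :: "nat list" and g
      assume "fanin g \<noteq> []" "\<And>j. j \<in> set (fanin g) \<Longrightarrow> j < length vs"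
      from max[OF this] show "Suc (Max (set (map (\<lambda>j. vs ! j) (fanin g)))) =
        Suc (maxl (map (\<lambda>j. nthd 0 vs j) (fanin g)))" by (simp only:)
    qed simp
    moreover have "last (run f (replicate n 0) gs) = nthd 0 (run f (replicate n 0) gs) (n + length gs - 1)"
      for f :: "nat list \<Rightarrow> gate \<Rightarrow> nat"
    proof -
      have "length (run f (replicate n 0) gs) = n + length gs" by simp
      moreover from this N have "run f (replicate n 0) gs \<noteq> []" by (metis list.size(3) neq0_conv)
      ultimately show ?thesis using last by metis
    qed
    ultimately have "circuit_weft C = nthd 0 ?w (n + length gs - 1)" "circuit_depth C = nthd 0 ?d (n + length gs - 1)"
      by metis+
    then show ?thesis using True wf by (simp add: circuit_check_def C zeros)
  next
    case False
    then show ?thesis using wf by (auto simp: circuit_check_def C)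
  qed
qed

lemma pt_guesses:
  assumes "pt k" "pt Z" "pt v"
  shows "pt (\<lambda>x. guesses (k x) q (Z x) (v x))"
  unfolding guesses_def by (intro pt_intros pt_comp[OF assms(1)] pt_comp[OF assms(2)] pt_comp[OF assms(3)])

lemma pt_label_step:
  assumes "pt N" "pt k" "pt Z" "pt vs" "pt g"
  shows "pt (\<lambda>x. label_step (N x) (k x) q (Z x) (vs x) (g x))"
  unfolding label_step_def large_label_def small_label_def determining_def
  by (intro pt_intros pt_guesses pt_comp[OF assms(1)] pt_comp[OF assms(2)] pt_comp[OF assms(3)]
      pt_comp[OF assms(4)] pt_comp[OF assms(5)])

lemma pt_ilab:
  assumes "pt k" "pt Z" "pt a"
  shows "pt (\<lambda>x. ilab (k x) (Z x) (a x))"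
  unfolding ilab_def
  by (intro pt_intros pt_comp[OF assms(1)] pt_comp[OF assms(2)] pt_comp[OF assms(3)])

lemma label_step_le: "label_step N k q Z vs g \<le> 3"
  by (simp add: label_step_def large_label_def small_label_def determining_def)

lemma pt_Z_ok:
  assumes C: "pt C" and k: "pt k" and Z: "pt Z"
  shows "pt (\<lambda>x. Z_ok (C x) (k x) q (Z x))"
proof -
  have 1: "pt (\<lambda>x. run (label_step (fst (C x) + length (snd (C x))) (k x) q (Z x))
      (map (\<lambda>a. ilab (k x) (Z x) a) [0..<fst (C x)]) (snd (C x)))"
  proof (rule pt_run[where h = "\<lambda>_. 7"])
    fix x ys zs v
    assume "v \<in> set (run (label_step (fst (C x) + length (snd (C x))) (k x) q (Z x))
      (map (\<lambda>a. ilab (k x) (Z x) a) [0..<fst (C x)]) ys)"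
    then have "v \<le> 3" by (rule run_bounded[rotated 2]) (auto simp: label_step_le ilab_def)
    then show "sz v \<le> 7" by (simp add: sz_nat)
  qed (intro pt_intros pb_const pt_label_step pt_ilab C Z k pt_comp[OF C] pt_comp[OF k] pt_comp[OF Z])+
  show ?thesis unfolding Z_ok_def order_ok_def
    by (intro pt_intros 1 pt_comp[OF C] pt_comp[OF k] pt_comp[OF Z])
qed

lemma pt_wcs_chk:
  assumes "pt C" "pt k" "pt \<tau>" "pt x"
  shows "pt (\<lambda>z. wcs_chk (C z) (k z) q (\<tau> z) (x z))"
  unfolding wcs_chk_def
  by (intro pt_intros pt_Z_ok assms pt_comp[OF assms(3)] pt_comp[OF assms(4)])

lemma pt_wcs_tuples: "pt k \<Longrightarrow> pt (\<lambda>x. wcs_tuples (k x) q)"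
proof (rule pt_comp[of "\<lambda>k. wcs_tuples k q"])
  show "pt (\<lambda>k. wcs_tuples k q)" unfolding wcs_tuples_def by (intro pt_intros)
qed

section \<open>Writing down the label cover instance in polynomial time\<close>

lemma pt_paths: "pt TT \<Longrightarrow> pt (\<lambda>x. paths r (TT x))"
proof (rule pt_comp[of "paths r"])
  show "pt (paths r)" unfolding paths_def by (intro pt_intros)
qed

lemma pt_pnode:
  assumes "pt M" "pt \<pi>" "pt i"
  shows "pt (\<lambda>x. pnode (M x) (\<pi> x) (i x))"
  unfolding pnode_def by (intro pt_intros assms)

lemma pt_path_ok:
  assumes chk: "pt (\<lambda>z. chk (fst z) (fst (snd z)) (snd (snd z)))" and "pt b" "pt l"
  shows "pt (\<lambda>x. path_ok (chk x) (b x) (l x))"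
proof -
  have "pt (\<lambda>x. chk x (fst (b x)) (snd (l x)))"
    using pt_comp[OF chk, of "\<lambda>x. (x, fst (b x), snd (l x))"] assms(2,3) by (simp add: pt_intros)
  then show ?thesis unfolding path_ok_def by (intro pt_intros assms(2,3))
qed

lemma pt_path_BV:
  assumes "pt M" "pt TT"
  shows "pt (\<lambda>x. path_BV r (M x) (TT x))"
  unfolding path_BV_def by (intro pt_intros pt_paths pt_pnode assms pt_comp[OF assms(1)])

lemma pt_path_BE:
  assumes "pt M" "pt TT"
  shows "pt (\<lambda>x. path_BE r (M x) (TT x))"
  unfolding path_BE_def by (intro pt_intros pt_paths pt_pnode assms pt_comp[OF assms(1)])

lemma pt_path_L: assumes "pt M" shows "pt (\<lambda>x. path_L r (M x))"
  unfolding path_L_def by (intro pt_intros assms)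

text \<open>Functions have no encoding; after this rewriting the edges carry tables, and the
  structural rules apply.\<close>

lemma map_tri_es:
  "map (\<lambda>(u, v, f). (u, v, map (\<lambda>a. (a, f a)) ss)) (tri_es ok BV BE K) =
     map (\<lambda>e. ((fst e, []), (snd e, []), map (\<lambda>a. (a, a)) ss)) BE @
     concat (map (\<lambda>b. concat (map (\<lambda>j.
       [((b, []), (b, [j, 0]), map (\<lambda>a. (a, a)) ss), ((b, []), (b, [j, 1]), map (\<lambda>a. (a, a)) ss),
        ((b, [j, 0]), (b, [j, 1]), map (\<lambda>a. (a, tri_flip ok b a)) ss)]) [0..<Suc K])) BV)"
  unfolding tri_es_def by (simp add: map_concat comp_def del: upt_Suc)

lemma pt_csp_eulc:
  assumes M: "pt M" and TT: "pt TT" and chk: "pt (\<lambda>z. chk (fst z) (fst (snd z)) (snd (snd z)))"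
  shows "pt (\<lambda>x. csp_eulc r (M x) (TT x) (chk x))"
proof -
  note BV = pt_path_BV[OF M TT, of r] and BE = pt_path_BE[OF M TT, of r] and L = pt_path_L[OF M, of r]
    and P = pt_paths[OF TT, of r]
  have ok: "pt (\<lambda>z. path_ok (chk (fst z)) (fst (snd z)) (snd (snd z)))"
  proof (rule pt_path_ok)
    show "pt (\<lambda>z. chk (fst (fst z)) (fst (snd z)) (snd (snd z)))"
      using pt_comp[OF chk, of "\<lambda>z. (fst (fst z), fst (snd z), snd (snd z))"] by (simp add: pt_intros)
  qed (intro pt_intros)+
  have ok': "pt (\<lambda>z. path_ok (chk (x z)) (b z) (l z))" if "pt x" "pt b" "pt l" for x b l
    using pt_comp[OF ok, of "\<lambda>z. (x z, b z, l z)"] that by (simp add: pt_intros)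
  have S: "pt (\<lambda>x. tri_ss (path_L r (M x)))" unfolding tri_ss_def by (intro pt_intros L)
  have V: "pt (\<lambda>x. tri_vs (path_BV r (M x) (TT x)) (length (paths r (TT x))))"
    unfolding tri_vs_def by (intro pt_intros BV P pt_comp[OF BV] pt_comp[OF P])
  show ?thesis
    unfolding csp_eulc_def eulc_input_def map_tri_es tri_flip_def
    by (intro pt_intros V S BV BE P pt_comp[OF S] pt_comp[OF BV] pt_comp[OF P] ok')
qed

text \<open>The arity \<open>4 * 2 ^ d\<close> counts \<open>2 * q\<close> guess variables and
  \<open>2 * q\<close> positions for \<open>q = 2 ^ d\<close>; the second argument is the domain
  size. \<open>(Leaf, 0)\<close> serves as a no-instance, since \<open>Leaf\<close> encodes no
  instance at all.\<close>

definition reduce :: "nat \<Rightarrow> circuit \<times> nat \<Rightarrow> tree \<times> nat" where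
  "reduce d z =
    (if circuit_check d (fst z) then
       (csp_eulc (4 * 2 ^ d) (Suc (Suc (fst (fst z) + length (snd (fst z))))) (wcs_tuples (snd z) (2 ^ d))
          (wcs_chk (fst z) (snd z) (2 ^ d)),
        length (paths (4 * 2 ^ d) (wcs_tuples (snd z) (2 ^ d))))
     else (Leaf, 0))"

definition reduction :: "nat \<Rightarrow> tree \<times> nat \<Rightarrow> tree \<times> nat" where
  "reduction d z = (if circuit_code (fst z) then reduce d (inv enc (fst z), snd z) else (Leaf, 0))"

lemma reduction_enc: "reduction d (enc C, k) = reduce d (C, k)"
proof -
  have "circuit_code (enc C)" unfolding circuit_code_iff by blast
  then show ?thesis by (simp only: reduction_def fst_conv snd_conv if_True inv_enc)
qed

lemma pt_reduction: "pt (reduction d)"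
proof -
  have "pt (reduce d)"
    unfolding reduce_def
    by (intro pt_if pt_Pair pt_const pt_comp[OF pt_circuit_check] pt_csp_eulc pt_length pt_paths pt_wcs_tuples pt_wcs_chk
      pt_Suc pt_add pt_fst pt_snd pt_id)
  \<comment> \<open>On codes of circuits \<open>inv enc\<close> does not change the tree, so
    decoding needs no program.\<close>
  moreover have "enc (inv enc (fst z) :: circuit, snd z) = enc z" if code: "circuit_code (fst z)" for z :: "tree \<times> nat"
  proof -
    obtain C :: circuit where C: "fst z = enc C" using code unfolding circuit_code_iff by blast
    have "inv enc (fst z) = C" unfolding C by (rule inv_enc)
    with C show ?thesis by (simp add: enc_prod enc_tree)
  qed
  ultimately show ?thesis
    unfolding reduction_def
    by (intro pt_if_cast[where f = "reduce d" and D = "\<lambda>z. (inv enc (fst z), snd z)"]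
      pt_circuit_code pt_fst pt_id pt_const)
qed

text \<open>\<open>(k + 2) ^ (2 * q)\<close> tuples with \<open>4 * q\<close> coordinates each, and
  two paths for every coordinate.\<close>

definition budget :: "nat \<Rightarrow> nat \<Rightarrow> nat" where
  "budget d k = Suc (Suc k) ^ (2 * 2 ^ d) * (8 * 2 ^ d)"

lemma pt_budget: "pt (budget d)"
  unfolding budget_def by (intro pt_intros)

lemma budget_mono: "k \<le> k' \<Longrightarrow> budget d k \<le> budget d k'"
  unfolding budget_def by (intro mult_le_mono1 power_mono) auto

lemma reduction_budget: "snd (reduction d (x, k)) \<le> budget d k"
proof -
  have "length (paths r TT) = length TT * (r * 2)" for r TT
    unfolding paths_def by (simp add: length_concat comp_def sum_list_triv)
  then show ?thesis
    by (simp add: reduction_def reduce_def budget_def wcs_tuples_def length_n_lists del: upt_Suc)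
qed

lemma not_Leaf: "(Leaf, k) \<notin> edge_unique_label_cover" "(Leaf, k) \<notin> restricted_edge_unique_label_cover"
  by (auto simp: edge_unique_label_cover_def restricted_edge_unique_label_cover_def encodes_def)

lemma reduction_correct:
  "(x, k) \<in> wcs 1 d \<longleftrightarrow> reduction d (x, k) \<in> edge_unique_label_cover"
  "(x, k) \<in> wcs 1 d \<longleftrightarrow> reduction d (x, k) \<in> restricted_edge_unique_label_cover"
proof -
  have "((x, k) \<in> wcs 1 d \<longleftrightarrow> reduction d (x, k) \<in> edge_unique_label_cover) \<and>
    ((x, k) \<in> wcs 1 d \<longleftrightarrow> reduction d (x, k) \<in> restricted_edge_unique_label_cover)"
  proof (cases "\<exists>C::circuit. x = enc C \<and> circuit_check d C")
    case False
    then have "(x, k) \<notin> wcs 1 d" by (auto simp: wcs_def circuit_check_iff enc_circuit_eq)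
    moreover have "reduction d (x, k) = (Leaf, 0)"
    proof (cases "\<exists>C::circuit. x = enc C")
      case True
      then obtain C :: circuit where C: "x = enc C" by blast
      with False have "\<not> circuit_check d C" by blast
      then show ?thesis unfolding C reduction_enc by (simp add: reduce_def)
    next
      case False
      then show ?thesis by (simp add: reduction_def circuit_code_iff)
    qed
    ultimately show ?thesis using not_Leaf by simp
  next
    case True
    then obtain n gs where x: "x = enc (n, gs)" and check: "circuit_check d (n, gs)" by auto
    let ?q = "2 ^ d :: nat"
    interpret circuit n gs using check by unfold_locales (simp add: circuit_check_iff)
    have "2 ^ dep out \<le> ?q" using check by (intro power_increasing) (simp_all add: circuit_check_iff circuit_depth_dep)
    then interpret weft1_circuit n gs ?q
      using check by unfold_locales (simp_all add: circuit_check_iff circuit_weft_wft)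
    interpret csp "4 * 2 ^ d" "Suc (Suc N)" "wcs_tuples k ?q" "wcs_chk (n, gs) k ?q"
    proof
      show "distinct (wcs_tuples k ?q)"
        unfolding wcs_tuples_def by (simp add: distinct_map distinct_n_lists inj_on_def del: upt_Suc)
      show "length \<tau> = 4 * 2 ^ d" if "\<tau> \<in> set (wcs_tuples k ?q)" for \<tau>
        using that unfolding wcs_tuples_def by (auto simp: set_n_lists simp del: upt_Suc)
    qed simp_all
    have "(x, k) \<in> wcs 1 d \<longleftrightarrow> (\<exists>xs. length xs = n \<and> count_list xs True = k \<and> circuit_value (n, gs) xs)"
      using check unfolding wcs_def x by (auto simp: circuit_check_iff enc_circuit_eq simp del: enc_Pair)
    also have "\<dots> \<longleftrightarrow> (\<exists>y. (\<forall>s. y s < Suc (Suc N)) \<and> (\<forall>\<tau>\<in>set (wcs_tuples k ?q). wcs_chk (n, gs) k ?q \<tau> (map y \<tau>)))"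
      using weft1_circuit.sound[OF weft1_circuit_axioms] weft1_circuit.complete[OF weft1_circuit_axioms] by blast
    finally have iff: "(x, k) \<in> wcs 1 d \<longleftrightarrow> \<dots>" .
    have "reduction d (x, k) = (csp_eulc (4 * 2 ^ d) (Suc (Suc N)) (wcs_tuples k ?q) (wcs_chk (n, gs) k ?q),
        length (paths (4 * 2 ^ d) (wcs_tuples k ?q)))"
      unfolding x reduction_enc using check by (simp add: reduce_def)
    then show ?thesis using iff csp_eulc_iff by simp
  qed
  then show "(x, k) \<in> wcs 1 d \<longleftrightarrow> reduction d (x, k) \<in> edge_unique_label_cover"
    "(x, k) \<in> wcs 1 d \<longleftrightarrow> reduction d (x, k) \<in> restricted_edge_unique_label_cover" by auto
qed

section \<open>Composition with a polynomial-time reduction\<close>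

text \<open>\<open>computes\<close> starts on a clean store but may leave garbage;
  \<open>realizes\<close> tolerates garbage, so \<open>q\<close> can follow \<open>p\<close>
  directly.\<close>

lemma computable_comp: assumes "computable f" "pt F" shows "computable (\<lambda>k. F (f k))"
proof -
  obtain p where p: "\<And>n. \<exists>t. computes p (enc_nat n) t (enc_nat (f n))"
    using assms(1) unfolding computable_def by blast
  obtain q h where q: "realizes q h F" using assms(2) unfolding pt_def by blast
  have "\<exists>t. computes (Seq p q) (enc_nat n) t (enc_nat (F (f n)))" for n
  proof -
    obtain t s where 1: "exec p ((\<lambda>_. Leaf)(0 := enc_nat n)) t s" "s 0 = enc (f n)"
      using p[of n] by (auto simp: computes_def enc_nat_eq)
    obtain t' s' where "exec q s t' s'" "s' 0 = enc (F (f n))" by (rule realizesD[OF q, of s "f n"]) (rule 1(2))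
    with 1 show ?thesis unfolding computes_def by (metis exec_Seq enc_nat_eq)
  qed
  then show ?thesis unfolding computable_def by blast
qed

text \<open>The argument must be saved before \<open>p\<close> runs, whereas \<open>p\<close> is
  only known to work on a store without the saved copy; \<open>exec_agree\<close> bridges the
  two.\<close>

lemma computable_Pair:
  assumes "computable f" "pt F"
  shows "computable (\<lambda>k. F (k, f k))"
proof -
  obtain p where p: "\<And>n. \<exists>t. computes p (enc_nat n) t (enc_nat (f n))"
    using assms(1) unfolding computable_def by blast
  obtain q h where q: "realizes q h F" using assms(2) unfolding pt_def by blast
  define N where "N = Suc (vbc p)"
  have N: "vbc p \<le> N" "N \<noteq> 0" by (auto simp: N_def)
  let ?P = "Seq (Assign N (Var 0)) (Seq p (Seq (Assign 0 (NodeE (Var N) (Var 0))) q))"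
  have "\<exists>t. computes ?P (enc_nat n) t (enc_nat (F (n, f n)))" for n
  proof -
    let ?s0 = "(\<lambda>_. Leaf)(0 := enc_nat n)"
    let ?s1 = "?s0(N := enc_nat n)"
    have 1: "exec (Assign N (Var 0)) ?s0 (1 + ecost (Var 0) ?s0) ?s1"
      using exec_Assign[of N "Var 0" ?s0] by simp
    obtain t s where "exec p ?s0 t s" "s 0 = enc_nat (f n)"
      using p[of n] by (auto simp: computes_def)
    then obtain s2 where 2: "exec p ?s1 t s2" "s2 0 = enc_nat (f n)"
      using exec_agree[of p ?s0 t s N ?s1] N by auto
    have "s2 N = enc_nat n" using exec_frame[OF 2(1) N(1)] by simp
    let ?s3 = "s2(0 := enc (n, f n))"
    have 3: "exec (Assign 0 (NodeE (Var N) (Var 0))) s2 (1 + ecost (NodeE (Var N) (Var 0)) s2) ?s3"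
      using exec_Assign[of 0 "NodeE (Var N) (Var 0)" s2] 2 \<open>s2 N = enc_nat n\<close> by (simp add: enc_nat_eq)
    obtain t4 s4 where 4: "exec q ?s3 t4 s4" "s4 0 = enc (F (n, f n))"
      by (rule realizesD[OF q, of ?s3 "(n, f n)"]) auto
    from exec_Seq[OF 1 exec_Seq[OF 2(1) exec_Seq[OF 3 4(1)]]] 4(2)
    show ?thesis unfolding computes_def by (auto simp: enc_nat_eq)
  qed
  then show ?thesis unfolding computable_def by blast
qed

text \<open>The second reduction runs on an instance whose size is bounded by input size plus time
  of the first one. Its parameter is only known to satisfy \<open>k' \<le> g k\<close>, hence the
  monotonicity of \<open>G\<close>.\<close>

lemma fpt_reducible_pt:
  assumes A: "fpt_reducible A B" and R: "pt R" and G: "pt G"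
    and mono: "\<And>k k'. k \<le> k' \<Longrightarrow> G k \<le> G k'"
    and param: "\<And>x k. snd (R (x, k)) \<le> G k"
    and correct: "\<And>x k. (x, k) \<in> B \<longleftrightarrow> R (x, k) \<in> B'"
  shows "fpt_reducible A B'"
proof -
  obtain p f g c where f: "computable f" and g: "computable g"
    and p: "\<And>x k. \<exists>x' k' t. computes p (Node x (enc_nat k)) t (Node x' (enc_nat k')) \<and>
        t \<le> f k * tsize x ^ c \<and> k' \<le> g k \<and> ((x, k) \<in> A \<longleftrightarrow> (x', k') \<in> B)"
    using A unfolding fpt_reducible_def by blast
  obtain q h where h: "pb h" and q: "realizes q h R" using R unfolding pt_def by blast
  obtain e where e: "\<And>z. h z \<le> (sz z + 1) ^ e" using h unfolding pb_def by blast
  \<comment> \<open>\<open>fst z\<close> stands for \<open>k\<close> and \<open>snd z\<close> for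
    \<open>f k\<close>. The summand \<open>1 + snd z\<close> pays for the first program. The base of
    the power is the part free of \<open>x\<close> in the size of the intermediate instance: the
    input has size \<open>tsize x + 2 * k + 2\<close>, and the time adds
    \<open>f k * tsize x ^ c\<close>.\<close>
  let ?F = "\<lambda>z. 1 + snd z + (2 * fst z + 4 + snd z) ^ e"
  have F: "computable (\<lambda>k. ?F (k, f k))"
    by (rule computable_Pair[OF f]) (intro pt_intros)
  have G': "computable (\<lambda>k. G (g k))" using g G by (rule computable_comp)
  have "\<exists>x' k' t. computes (Seq p q) (Node x (enc_nat k)) t (Node x' (enc_nat k')) \<and>
        t \<le> ?F (k, f k) * tsize x ^ (c + (c + 1) * e) \<and> k' \<le> G (g k) \<and> ((x, k) \<in> A \<longleftrightarrow> (x', k') \<in> B')" for x k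
  proof -
    obtain x' k' t where 1: "computes p (Node x (enc_nat k)) t (Node x' (enc_nat k'))"
      "t \<le> f k * tsize x ^ c" "k' \<le> g k" "(x, k) \<in> A \<longleftrightarrow> (x', k') \<in> B" using p by blast
    let ?s = "(\<lambda>_. Leaf)(0 := Node x (enc_nat k))"
    obtain s where s: "exec p ?s t s" "s 0 = enc (x', k')"
      using 1(1) by (auto simp: computes_def enc_nat_eq enc_tree)
    obtain t' s' where s': "exec q s t' s'" "s' 0 = enc (R (x', k'))" "t' \<le> h (x', k')"
      by (rule realizesD[OF q, of s "(x', k')"]) (rule s(2))
    obtain x2 k2 where R2: "R (x', k') = (x2, k2)" by (cases "R (x', k')")
    have comp: "computes (Seq p q) (Node x (enc_nat k)) (1 + t + t') (Node x2 (enc_nat k2))"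
      unfolding computes_def using exec_Seq[OF s(1) s'(1)] s'(2) R2 by (auto simp: enc_nat_eq enc_tree)
    let ?X = "tsize x"
    have X: "1 \<le> ?X" by simp
    have Xc: "?X ^ a \<le> ?X ^ b" if "a \<le> b" for a b using that X by (rule power_increasing)
    have "sz (x', k') \<le> tsize (Node x (enc_nat k)) + t" using exec_size[OF s(1), of 0] s(2) by simp
    then have "sz (x', k') + 1 \<le> 2 * k + 3 + ?X + t" using sz_nat[of k] by (simp add: enc_nat_eq)
    also have "\<dots> \<le> (2 * k + 4 + f k) * ?X ^ (c + 1)"
    proof -
      have "2 * k + 3 \<le> (2 * k + 3) * ?X ^ (c + 1)" using one_le_power[OF X, of "c + 1"] by simp
      moreover have "?X \<le> 1 * ?X ^ (c + 1)" using Xc[of 1 "c + 1"] by simp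
      moreover have "t \<le> f k * ?X ^ (c + 1)"
        using 1(2) by (rule le_trans) (intro mult_le_mono2 Xc le_add1)
      ultimately have "2 * k + 3 + ?X + t \<le> ((2 * k + 3) + 1 + f k) * ?X ^ (c + 1)"
        unfolding add_mult_distrib by linarith
      then show ?thesis by (simp add: algebra_simps)
    qed
    finally have "(sz (x', k') + 1) ^ e \<le> ((2 * k + 4 + f k) * ?X ^ (c + 1)) ^ e"
      by (rule power_mono) simp
    then have t': "t' \<le> (2 * k + 4 + f k) ^ e * ?X ^ ((c + 1) * e)"
      using s'(3) e[of "(x', k')"] by (simp only: power_mult_distrib power_mult)
    let ?Y = "?X ^ (c + (c + 1) * e)"
    have "1 + t \<le> (1 + f k) * ?X ^ c" 
      using 1(2) one_le_power[OF X, of c] unfolding add_mult_distrib by linarith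
    also have "\<dots> \<le> (1 + f k) * ?Y" by (intro mult_le_mono2 Xc) simp
    finally have "1 + t \<le> (1 + f k) * ?Y" .
    moreover have "(2 * k + 4 + f k) ^ e * ?X ^ ((c + 1) * e) \<le> (2 * k + 4 + f k) ^ e * ?Y"
      by (intro mult_le_mono2 Xc) simp
    ultimately have "1 + t + t' \<le> ?F (k, f k) * ?Y"
      using t' unfolding fst_conv snd_conv add_mult_distrib[of "1 + f k"] by linarith
    moreover have "k2 \<le> G (g k)" using param[of x' k'] mono[OF 1(3)] R2 by simp
    moreover have "(x, k) \<in> A \<longleftrightarrow> (x2, k2) \<in> B'" using 1(4) correct R2 by simp
    ultimately show ?thesis using comp by blast
  qed
  with F G' show ?thesis unfolding fpt_reducible_def by blast
qed

text \<open>Membership of a problem in \<open>W_class 1\<close> provides one depth \<open>d\<close>,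
  and the reduction for this \<open>d\<close> is composed with the given one.\<close>

theorem theorem5:
  shows "W_hard 1 edge_unique_label_cover \<and> W_hard 1 restricted_edge_unique_label_cover"
  unfolding W_hard_def W_class_def
  using fpt_reducible_pt[OF _ pt_reduction pt_budget budget_mono reduction_budget reduction_correct(1)]
    fpt_reducible_pt[OF _ pt_reduction pt_budget budget_mono reduction_budget reduction_correct(2)]
  by blast

end
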